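(* If there is a polynomial-time algorithm solving the problem CMI restricted to acyclic implicational bases, then there is a polynomial-time algorithm solving the problem DUAL restricted to implicational bases in which every premise has size one (i.e., the problem DUAL in distributive lattices).
   Context: All sets are finite. A unit implicational base on $X$ is a set $\Sigma$ of implications $A\to b$, $A\subseteq X$, $b\in X$. A set $S\subseteq X$ is closed in $\Sigma$ if for every $A\to b\in\Sigma$, $A\not\subseteq S$ or $b\in S$; $\mathcal{C}_\Sigma$ is the family of closed sets and $\mathcal{L}_\Sigma=(\mathcal{C}_\Sigma,\subseteq)$ is a lattice. The implication graph of $\Sigma$ has vertex set $X$ and an arc $x\to y$ iff some $A\to y\in\Sigma$ has $x\in A$; $\Sigma$ is acyclic if this graph has no directed cycle. When all premises have size one, $\mathcal{L}_\Sigma$ is distributive (and every distributive lattice arises this way). A set $M$ is meet-irreducible in $\mathcal{C}_\Sigma$ if $M\in\mathcal{C}_\Sigma$, $M\ne X$, and $M=C_1\cap C_2$ with $C_1,C_2\in\mathcal{C}_\Sigma$ implies $C_1=M$ or $C_2=M$; $\mathcal{M}(\mathcal{C}_\Sigma)$ is the set of these. For $\mathcal{B}\subseteq\mathcal{C}_\Sigma$, $\downarrow\mathcal{B}=\{C\in\mathcal{C}_\Sigma: C\subseteq B \text{ for some } B\in\mathcal{B}\}$ and $\uparrow\mathcal{B}=\{C\in\mathcal{C}_\Sigma: B\subseteq C\text{ for some }B\in\mathcal{B}\}$. Problem DUAL: given $X$, $\Sigma$ and two antichains $\mathcal{B}^+,\mathcal{B}^-$ of $\mathcal{L}_\Sigma$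 (the lattice itself is not given), decide whether $\downarrow\mathcal{B}^+\cap\uparrow\mathcal{B}^-=\emptyset$ and $\downarrow\mathcal{B}^+\cup\uparrow\mathcal{B}^-=\mathcal{C}_\Sigma$. Problem CMI: given $X$, an implicational base $\Sigma$ and a family $\mathcal{M}\subseteq 2^X$, decide whether $\mathcal{M}=\mathcal{M}(\mathcal{C}_\Sigma)$. Polynomial time is measured in the input size. *)

theory Defs
  imports Main
begin

text \<open>Ground set X = {0..<n}. An implicational base is a list of implications (A, b),
  meaning A -> b.\<close>

type_synonym impl = "nat set \<times> nat"

definition wf_base :: "nat \<Rightarrow> impl list \<Rightarrow> bool" where
  "wf_base n \<Sigma> \<longleftrightarrow> (\<forall>(A, b) \<in> set \<Sigma>. A \<subseteq> {0..<n} \<and> b < n)"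

definition is_closed :: "impl list \<Rightarrow> nat set \<Rightarrow> bool" where
  "is_closed \<Sigma> S \<longleftrightarrow> (\<forall>(A, b) \<in> set \<Sigma>. \<not> A \<subseteq> S \<or> b \<in> S)"

definition closed_sets :: "nat \<Rightarrow> impl list \<Rightarrow> nat set set" where
  "closed_sets n \<Sigma> = {S. S \<subseteq> {0..<n} \<and> is_closed \<Sigma> S}"

definition impl_graph :: "impl list \<Rightarrow> (nat \<times> nat) set" where
  "impl_graph \<Sigma> = {(x, y). \<exists>A. (A, y) \<in> set \<Sigma> \<and> x \<in> A}"

definition acyclic_base :: "impl list \<Rightarrow> bool" where
  "acyclic_base \<Sigma> \<longleftrightarrow> acyclic (impl_graph \<Sigma>)"

definition unit_premises :: "impl list \<Rightarrow> bool" where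
  "unit_premises \<Sigma> \<longleftrightarrow> (\<forall>(A, b) \<in> set \<Sigma>. card A = 1)"

definition meet_irreducibles :: "nat \<Rightarrow> impl list \<Rightarrow> nat set set" where
  "meet_irreducibles n \<Sigma> =
     {M. M \<in> closed_sets n \<Sigma> \<and> M \<noteq> {0..<n} \<and>
         (\<forall>C1 \<in> closed_sets n \<Sigma>. \<forall>C2 \<in> closed_sets n \<Sigma>.
            M = C1 \<inter> C2 \<longrightarrow> C1 = M \<or> C2 = M)}"

definition down_set :: "nat \<Rightarrow> impl list \<Rightarrow> nat set set \<Rightarrow> nat set set" where
  "down_set n \<Sigma> \<B> = {C \<in> closed_sets n \<Sigma>. \<exists>B \<in> \<B>. C \<subseteq> B}"

definition up_set :: "nat \<Rightarrow> impl list \<Rightarrow> nat set set \<Rightarrow> nat set set" where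
  "up_set n \<Sigma> \<B> = {C \<in> closed_sets n \<Sigma>. \<exists>B \<in> \<B>. B \<subseteq> C}"

definition is_antichain_of :: "nat \<Rightarrow> impl list \<Rightarrow> nat set list \<Rightarrow> bool" where
  "is_antichain_of n \<Sigma> Bs \<longleftrightarrow> set Bs \<subseteq> closed_sets n \<Sigma> \<and>
     (\<forall>B1 \<in> set Bs. \<forall>B2 \<in> set Bs. B1 \<subseteq> B2 \<longrightarrow> B1 = B2)"

definition dual_instance :: "nat \<Rightarrow> impl list \<Rightarrow> nat set list \<Rightarrow> nat set list \<Rightarrow> bool" where
  "dual_instance n \<Sigma> Bp Bm \<longleftrightarrow> wf_base n \<Sigma> \<and> is_antichain_of n \<Sigma> Bp \<and> is_antichain_of n \<Sigma> Bm"

definition dual_answer :: "nat \<Rightarrow> impl list \<Rightarrow> nat set list \<Rightarrow> nat set list \<Rightarrow> bool" where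
  "dual_answer n \<Sigma> Bp Bm \<longleftrightarrow>
     down_set n \<Sigma> (set Bp) \<inter> up_set n \<Sigma> (set Bm) = {} \<and>
     down_set n \<Sigma> (set Bp) \<union> up_set n \<Sigma> (set Bm) = closed_sets n \<Sigma>"

definition cmi_instance :: "nat \<Rightarrow> impl list \<Rightarrow> nat set list \<Rightarrow> bool" where
  "cmi_instance n \<Sigma> Ms \<longleftrightarrow> wf_base n \<Sigma> \<and> (\<forall>M \<in> set Ms. M \<subseteq> {0..<n})"

definition cmi_answer :: "nat \<Rightarrow> impl list \<Rightarrow> nat set list \<Rightarrow> bool" where
  "cmi_answer n \<Sigma> Ms \<longleftrightarrow> set Ms = meet_irreducibles n \<Sigma>"

text \<open>Input alphabet: 1 = bit 0, 2 = bit 1, 3 = item separator, 4 = section separator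
  (0 is the blank). The ground set size n is written in unary, sets as characteristic
  vectors of length n.\<close>

definition enc_set :: "nat \<Rightarrow> nat set \<Rightarrow> nat list" where
  "enc_set n S = map (\<lambda>i. if i \<in> S then 2 else 1) [0..<n]"

definition enc_sets :: "nat \<Rightarrow> nat set list \<Rightarrow> nat list" where
  "enc_sets n Ss = concat (map (\<lambda>S. enc_set n S @ [3]) Ss)"

definition enc_base :: "nat \<Rightarrow> impl list \<Rightarrow> nat list" where
  "enc_base n \<Sigma> = concat (map (\<lambda>(A, b). enc_set n A @ enc_set n {b} @ [3]) \<Sigma>)"

definition enc_dual :: "nat \<Rightarrow> impl list \<Rightarrow> nat set list \<Rightarrow> nat set list \<Rightarrow> nat list" where
  "enc_dual n \<Sigma> Bp Bm =
     replicate n 1 @ [4] @ enc_base n \<Sigma> @ [4] @ enc_sets n Bp @ [4] @ enc_sets n Bm"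

definition enc_cmi :: "nat \<Rightarrow> impl list \<Rightarrow> nat set list \<Rightarrow> nat list" where
  "enc_cmi n \<Sigma> Ms = replicate n 1 @ [4] @ enc_base n \<Sigma> @ [4] @ enc_sets n Ms"

datatype move = Lft | Stay | Rgt

text \<open>A machine is (Q, S, delta): states {0..<Q} (0 initial, 1 accept, 2 reject),
  tape symbols {0..<S} (0 blank), transition function delta.\<close>

type_synonym tm = "nat \<times> nat \<times> (nat \<Rightarrow> nat \<Rightarrow> nat \<times> nat \<times> move)"

definition wf_tm :: "tm \<Rightarrow> bool" where
  "wf_tm M = (case M of (Q, S, \<delta>) \<Rightarrow> 3 \<le> Q \<and> 5 \<le> S \<and>
     (\<forall>q < Q. \<forall>a < S. fst (\<delta> q a) < Q \<and> fst (snd (\<delta> q a)) < S))"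

text \<open>Configuration: (state, tape left of head reversed, tape from the head on).\<close>

type_synonym config = "nat \<times> nat list \<times> nat list"

definition hd_blank :: "nat list \<Rightarrow> nat" where
  "hd_blank xs = (case xs of [] \<Rightarrow> 0 | a # _ \<Rightarrow> a)"

definition tm_step :: "tm \<Rightarrow> config \<Rightarrow> config" where
  "tm_step M c = (case M of (Q, S, \<delta>) \<Rightarrow> (case c of (q, ls, rs) \<Rightarrow>
     if q = 1 \<or> q = 2 then c else
     (case \<delta> q (hd_blank rs) of (q', a', mv) \<Rightarrow>
       (case mv of
          Stay \<Rightarrow> (q', ls, a' # drop 1 rs)
        | Rgt \<Rightarrow> (q', a' # ls, drop 1 rs)
        | Lft \<Rightarrow> (q', drop 1 ls, hd_blank ls # a' # drop 1 rs)))))"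

definition tm_run :: "tm \<Rightarrow> nat list \<Rightarrow> nat \<Rightarrow> config" where
  "tm_run M w t = (tm_step M ^^ t) (0, [], w)"

definition tm_state :: "config \<Rightarrow> nat" where
  "tm_state c = fst c"

definition decides_within :: "tm \<Rightarrow> nat list \<Rightarrow> bool \<Rightarrow> nat \<Rightarrow> bool" where
  "decides_within M w ans t \<longleftrightarrow>
     tm_state (tm_run M w t) \<in> {1, 2} \<and> (tm_state (tm_run M w t) = 1 \<longleftrightarrow> ans)"

definition poly_time_DUAL_unit :: bool where
  "poly_time_DUAL_unit \<longleftrightarrow> (\<exists>M c k. wf_tm M \<and>
     (\<forall>n \<Sigma> Bp Bm. dual_instance n \<Sigma> Bp Bm \<and> unit_premises \<Sigma> \<longrightarrow>
        decides_within M (enc_dual n \<Sigma> Bp Bm) (dual_answer n \<Sigma> Bp Bm)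
          (c * (length (enc_dual n \<Sigma> Bp Bm) + 1) ^ k)))"

definition poly_time_CMI_acyclic :: bool where
  "poly_time_CMI_acyclic \<longleftrightarrow> (\<exists>M c k. wf_tm M \<and>
     (\<forall>n \<Sigma> Ms. cmi_instance n \<Sigma> Ms \<and> acyclic_base \<Sigma> \<longrightarrow>
        decides_within M (enc_cmi n \<Sigma> Ms) (cmi_answer n \<Sigma> Ms)
          (c * (length (enc_cmi n \<Sigma> Ms) + 1) ^ k)))"

end

theory Submission
  imports Defs
begin

text \<open>
  Let \<open>P x\<close> be the set of elements from which \<open>x\<close> is reachable in the implication graph of a base
  with premises of size one, so that the complements of the \<open>P x\<close> are the meet-irreducible closed
  sets. If the graph is acyclic, add a new element \<open>z\<close> and the implications \<open>B \<rightarrow> z\<close> for \<open>B\<close> in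
  \<open>\<B>\<^sup>-\<close>. The meet-irreducibles of the new base that contain \<open>z\<close> are those of the old one
  with \<open>z\<close> added, and those avoiding \<open>z\<close> are the maximal closed sets that lie above no element of
  \<open>\<B>\<^sup>-\<close>; the latter family is \<open>\<B>\<^sup>+\<close> exactly if the two antichains are dual. Cycles are removed
  beforehand: all elements of a strongly connected component except the largest one are
  implied by the empty set, and the remaining ones carry the strict part of the reachability
  order, which keeps the lattice of closed sets up to isomorphism.

  The sets \<open>P x\<close> have to be computed by a Turing machine. A word function is shown to be computable in
  polynomial time by composing programs over finitely many registers, which are compiled to a
  machine that keeps register \<open>r\<close> in the \<open>r\<close>-th base 5 digit of its tape cells.
\<close>

section \<open>A register language\<close>

text \<open>Polynomial time is fixed here by one-tape machines and a concrete encoding, so the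
  reduction must exist as a program. Its parts are therefore loops over suffixes of words, with
  positions and counters represented by lengths of words. With premises of size one there is at most
  one meet-irreducible per element, namely a complement of some \<open>P x\<close>. These sets can
  all be listed in the output, which settles the part of the CMI answer containing \<open>z\<close>
  and leaves only the family \<open>Bp\<close> to be tested. An implication from \<open>B\<close> in
  \<open>Bm\<close> to \<open>z\<close> says nothing about sets containing \<open>z\<close> and
  excludes the sets above \<open>B\<close> without \<open>z\<close>. If \<open>C\<close> and a
  larger \<open>D\<close> both survive without \<open>z\<close>, then \<open>C\<close> is the
  intersection of \<open>C\<close> with \<open>z\<close> added and \<open>D\<close>; hence only
  maximal survivors can be irreducible. These premises may be large, which is why the target is an
  acyclic base and not a distributive one.\<close>

type_synonym regs = "nat \<Rightarrow> nat list"

datatype com =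
    CSkip
  | CPush nat nat
  | CPop nat
  | CSeq com com (infixr ";;" 60)
  | CIf nat nat com com
  | CWhile nat nat com

text \<open>The guard of \<open>CIf r a\<close> is "the top of register \<open>r\<close> is \<open>a\<close>", and \<open>CWhile r a\<close>
  loops until the top of \<open>r\<close> is \<open>a\<close>; the top of an empty register is the blank 0. The time index
  is an upper bound.\<close>

inductive exec :: "com \<Rightarrow> regs \<Rightarrow> nat \<Rightarrow> regs \<Rightarrow> bool" where
  Skip: "exec CSkip s 0 s"
| Push: "exec (CPush r a) s 1 (s(r := a # s r))"
| Pop: "exec (CPop r) s 1 (s(r := tl (s r)))"
| Seq: "exec c1 s t1 s1 \<Longrightarrow> exec c2 s1 t2 s2 \<Longrightarrow> exec (c1 ;; c2) s (t1 + t2) s2"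
| IfT: "hd_blank (s r) = a \<Longrightarrow> exec c1 s t s1 \<Longrightarrow> exec (CIf r a c1 c2) s (t + 2) s1"
| IfF: "hd_blank (s r) \<noteq> a \<Longrightarrow> exec c2 s t s1 \<Longrightarrow> exec (CIf r a c1 c2) s (t + 2) s1"
| WhileF: "hd_blank (s r) = a \<Longrightarrow> exec (CWhile r a c) s 2 s"
| WhileT: "hd_blank (s r) \<noteq> a \<Longrightarrow> exec c s t1 s1 \<Longrightarrow> exec (CWhile r a c) s1 t2 s2
    \<Longrightarrow> exec (CWhile r a c) s (t1 + t2 + 2) s2"
| Slack: "exec c s t s1 \<Longrightarrow> t \<le> t' \<Longrightarrow> exec c s t' s1"

fun wf_com :: "com \<Rightarrow> bool" where
  "wf_com CSkip = True"
| "wf_com (CPush r a) = (1 \<le> a \<and> a \<le> 4)"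
| "wf_com (CPop r) = True"
| "wf_com (CSeq c1 c2) = (wf_com c1 \<and> wf_com c2)"
| "wf_com (CIf r a c1 c2) = (wf_com c1 \<and> wf_com c2)"
| "wf_com (CWhile r a c) = wf_com c"

fun regs_bound :: "com \<Rightarrow> nat" where
  "regs_bound CSkip = 0"
| "regs_bound (CPush r a) = Suc r"
| "regs_bound (CPop r) = Suc r"
| "regs_bound (CSeq c1 c2) = max (regs_bound c1) (regs_bound c2)"
| "regs_bound (CIf r a c1 c2) = max (Suc r) (max (regs_bound c1) (regs_bound c2))"
| "regs_bound (CWhile r a c) = max (Suc r) (regs_bound c)"

text \<open>The letter 0 is excluded because a zero digit marks the cells above the top of a
  register.\<close>

definition valid :: "nat list \<Rightarrow> bool" where
  "valid xs \<longleftrightarrow> set xs \<subseteq> {1..4}"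

lemma valid_simps [simp]:
  "valid []" "valid (x # xs) \<longleftrightarrow> 1 \<le> x \<and> x \<le> 4 \<and> valid xs" "valid (rev xs) = valid xs"
  "valid (xs @ ys) \<longleftrightarrow> valid xs \<and> valid ys"
  by (auto simp: valid_def)

lemma valid_tl: "valid xs \<Longrightarrow> valid (tl xs)"
  by (cases xs) auto

lemma exec_valid:
  assumes "exec c s t s'" "wf_com c" "\<forall>r. valid (s r)"
  shows "valid (s' r)"
  using assms by (induction arbitrary: r rule: exec.induct) (auto simp: valid_tl)

text \<open>Only a push lengthens a register, by one symbol per unit of time. Every later bound on
  the length of an output is read off from a running time in this way.\<close>

lemma exec_length:
  assumes "exec c s t s'"
  shows "length (s' r) \<le> length (s r) + t"
  using assms
proof (induction arbitrary: r rule: exec.induct)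
  case (Seq c1 s t1 s1 c2 t2 s2)
  from Seq.IH(1)[of r] Seq.IH(2)[of r] show ?case by simp
next
  case (WhileT s r a c t1 s1 t2 s2 r')
  from WhileT.IH(1)[of r'] WhileT.IH(2)[of r'] show ?case by simp
next
  case (IfT s r a c1 t s1 c2 r')
  from IfT.IH[of r'] show ?case by simp
next
  case (IfF s r a c2 t s1 c1 r')
  from IfF.IH[of r'] show ?case by simp
next
  case (Slack c s t s1 t' r')
  from Slack.IH[of r'] Slack.hyps show ?case by simp
qed auto

section \<open>Compilation to straight code with jumps\<close>

datatype instr = IPush nat nat | IPop nat | IBr nat nat nat | IGoto nat

definition istep :: "instr list \<Rightarrow> nat \<times> regs \<Rightarrow> nat \<times> regs" where
  "istep P c = (case c of (pc, s) \<Rightarrow> if pc < length P then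
     (case P ! pc of
        IPush r a \<Rightarrow> (Suc pc, s(r := a # s r))
      | IPop r \<Rightarrow> (Suc pc, s(r := tl (s r)))
      | IBr r a t \<Rightarrow> (if hd_blank (s r) = a then Suc pc else t, s)
      | IGoto t \<Rightarrow> (t, s))
     else c)"

fun csize :: "com \<Rightarrow> nat" where
  "csize CSkip = 0"
| "csize (CPush r a) = 1"
| "csize (CPop r) = 1"
| "csize (CSeq c1 c2) = csize c1 + csize c2"
| "csize (CIf r a c1 c2) = csize c1 + csize c2 + 2"
| "csize (CWhile r a c) = csize c + 3"

text \<open>\<open>compile c n\<close> is the code for \<open>c\<close> placed at address \<open>n\<close>; jump targets are absolute.\<close>

fun compile :: "com \<Rightarrow> nat \<Rightarrow> instr list" where
  "compile CSkip n = []"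
| "compile (CPush r a) n = [IPush r a]"
| "compile (CPop r) n = [IPop r]"
| "compile (CSeq c1 c2) n = compile c1 n @ compile c2 (n + csize c1)"
| "compile (CIf r a c1 c2) n =
     IBr r a (n + csize c1 + 2) # compile c1 (Suc n) @ IGoto (n + csize c1 + csize c2 + 2) #
     compile c2 (n + csize c1 + 2)"
| "compile (CWhile r a c) n =
     IBr r a (n + 2) # IGoto (n + csize c + 3) # compile c (n + 2) @ [IGoto n]"

lemma length_compile [simp]: "length (compile c n) = csize c"
  by (induction c arbitrary: n) auto

definition code_at :: "instr list \<Rightarrow> nat \<Rightarrow> instr list \<Rightarrow> bool" where
  "code_at P n xs \<longleftrightarrow> (\<exists>as bs. P = as @ xs @ bs \<and> length as = n)"

lemma code_at_Nil: "code_at P n [] \<longleftrightarrow> n \<le> length P"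
proof
  assume "n \<le> length P"
  then have "P = take n P @ [] @ drop n P \<and> length (take n P) = n" by simp
  then show "code_at P n []" unfolding code_at_def by blast
qed (auto simp: code_at_def)

lemma code_at_Cons:
  "code_at P n (x # xs) \<longleftrightarrow> n < length P \<and> P ! n = x \<and> code_at P (Suc n) xs"
proof
  assume "code_at P n (x # xs)"
  then obtain as bs where P: "P = as @ (x # xs) @ bs" "length as = n"
    by (auto simp: code_at_def)
  then have "code_at P (Suc n) xs"
    unfolding code_at_def by (intro exI[of _ "as @ [x]"] exI[of _ bs]) simp
  with P show "n < length P \<and> P ! n = x \<and> code_at P (Suc n) xs" by auto
next
  assume a: "n < length P \<and> P ! n = x \<and> code_at P (Suc n) xs"
  then obtain as bs where P: "P = as @ xs @ bs" "length as = Suc n"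
    by (auto simp: code_at_def)
  obtain cs y where as: "as = cs @ [y]" using P(2) by (cases as rule: rev_cases) auto
  have "P = cs @ (x # xs) @ bs" "length cs = n" using a P as by (auto simp: nth_append)
  then show "code_at P n (x # xs)" unfolding code_at_def by blast
qed

lemma code_at_le: "code_at P n xs \<Longrightarrow> n + length xs \<le> length P"
  by (auto simp: code_at_def)

lemma code_at_append:
  "code_at P n (xs @ ys) \<longleftrightarrow> code_at P n xs \<and> code_at P (n + length xs) ys"
proof (induction xs arbitrary: n)
  case Nil
  then show ?case using code_at_le by (fastforce simp: code_at_Nil)
next
  case (Cons x xs)
  then show ?case by (simp add: code_at_Cons)
qed

text \<open>The step count is only an upper bound, in accordance with the rule
  \<open>Slack\<close>.\<close>

definition reaches :: "('c \<Rightarrow> 'c) \<Rightarrow> 'c \<Rightarrow> nat \<Rightarrow> 'c \<Rightarrow> bool" where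
  "reaches f c t c' \<longleftrightarrow> (\<exists>k\<le>t. (f ^^ k) c = c')"

lemma reaches_refl: "reaches f c 0 c"
  by (auto simp: reaches_def)

lemma reaches_mono: "reaches f c t c' \<Longrightarrow> t \<le> t' \<Longrightarrow> reaches f c t' c'"
  by (auto simp: reaches_def intro: order_trans)

lemma reaches_trans: "reaches f c t c1 \<Longrightarrow> reaches f c1 t' c2 \<Longrightarrow> reaches f c (t + t') c2"
  unfolding reaches_def
proof (elim exE conjE)
  fix k k'
  assume "k \<le> t" "(f ^^ k) c = c1" "k' \<le> t'" "(f ^^ k') c1 = c2"
  then show "\<exists>k\<le>t + t'. (f ^^ k) c = c2"
    by (intro exI[of _ "k' + k"]) (auto simp: funpow_add)
qed

lemma reaches_step: "f c = c' \<Longrightarrow> reaches f c 1 c'"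
  unfolding reaches_def by (intro exI[of _ 1]) simp

abbreviation ireach :: "instr list \<Rightarrow> nat \<times> regs \<Rightarrow> nat \<Rightarrow> nat \<times> regs \<Rightarrow> bool" where
  "ireach P \<equiv> reaches (istep P)"

text \<open>The address \<open>n\<close> is arbitrary and \<open>P\<close> may contain other code,
  so the induction applies to subprograms in place; a further round of a loop runs the same code at
  the same address.\<close>

lemma compile_correct:
  assumes "exec c s t s'" "code_at P n (compile c n)"
  shows "ireach P (n, s) t (n + csize c, s')"
  using assms
proof (induction arbitrary: n rule: exec.induct)
  case (Skip s)
  then show ?case by (simp add: reaches_refl)
next
  case (Push r a s)
  then show ?case by (intro reaches_step) (auto simp: istep_def code_at_Cons)
next
  case (Pop r s)
  then show ?case by (intro reaches_step) (auto simp: istep_def code_at_Cons)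
next
  case (Seq c1 s t1 s1 c2 t2 s2)
  have "ireach P (n, s) t1 (n + csize c1, s1)"
    using Seq by (simp add: code_at_append)
  moreover have "ireach P (n + csize c1, s1) t2 (n + csize c1 + csize c2, s2)"
    using Seq by (simp add: code_at_append)
  ultimately show ?case using reaches_trans by (fastforce simp: add.assoc)
next
  case (IfT s r a c1 t s1 c2)
  have code: "n < length P" "P ! n = IBr r a (n + csize c1 + 2)" "code_at P (Suc n) (compile c1 (Suc n))"
    "Suc n + csize c1 < length P" "P ! (Suc n + csize c1) = IGoto (n + csize c1 + csize c2 + 2)"
    using IfT.prems by (auto simp: code_at_Cons code_at_append)
  have "ireach P (n, s) 1 (Suc n, s)"
    by (rule reaches_step) (use code IfT.hyps in \<open>simp add: istep_def\<close>)
  moreover have "ireach P (Suc n, s) t (Suc n + csize c1, s1)" using IfT.IH code by blast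
  moreover have "ireach P (Suc n + csize c1, s1) 1 (n + csize c1 + csize c2 + 2, s1)"
    by (rule reaches_step) (use code in \<open>simp add: istep_def\<close>)
  ultimately have "ireach P (n, s) (1 + t + 1) (n + csize c1 + csize c2 + 2, s1)"
    by (metis reaches_trans)
  then show ?case by (simp add: ac_simps)
next
  case (IfF s r a c2 t s1 c1)
  have code: "n < length P" "P ! n = IBr r a (n + csize c1 + 2)"
    "code_at P (n + csize c1 + 2) (compile c2 (n + csize c1 + 2))"
    using IfF.prems by (auto simp: code_at_Cons code_at_append)
  have "ireach P (n, s) 1 (n + csize c1 + 2, s)"
    by (rule reaches_step) (use code IfF.hyps in \<open>simp add: istep_def\<close>)
  moreover have "ireach P (n + csize c1 + 2, s) t (n + csize c1 + 2 + csize c2, s1)"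
    using IfF.IH code by blast
  ultimately have "ireach P (n, s) (1 + t) (n + csize c1 + 2 + csize c2, s1)"
    by (metis reaches_trans)
  then have "ireach P (n, s) (t + 2) (n + csize c1 + 2 + csize c2, s1)"
    by (rule reaches_mono) simp
  then show ?case by (simp add: ac_simps)
next
  case (WhileF s r a c)
  have code: "n < length P" "P ! n = IBr r a (n + 2)"
    "Suc n < length P" "P ! Suc n = IGoto (n + csize c + 3)"
    using WhileF.prems by (auto simp: code_at_Cons code_at_append)
  have "ireach P (n, s) 1 (Suc n, s)"
    by (rule reaches_step) (use code WhileF.hyps in \<open>simp add: istep_def\<close>)
  moreover have "ireach P (Suc n, s) 1 (n + csize c + 3, s)"
    by (rule reaches_step) (use code in \<open>simp add: istep_def\<close>)
  ultimately have "ireach P (n, s) (1 + 1) (n + csize c + 3, s)" by (rule reaches_trans)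
  then show ?case by (simp add: ac_simps numeral_2_eq_2)
next
  case (WhileT s r a c t1 s1 t2 s2)
  have code: "n < length P" "P ! n = IBr r a (n + 2)"
    "code_at P (n + 2) (compile c (n + 2))"
    "n + 2 + csize c < length P" "P ! (n + 2 + csize c) = IGoto n"
    using WhileT.prems by (auto simp: code_at_Cons code_at_append)
  have "ireach P (n, s) 1 (n + 2, s)"
    by (rule reaches_step) (use code WhileT.hyps in \<open>simp add: istep_def\<close>)
  moreover have "ireach P (n + 2, s) t1 (n + 2 + csize c, s1)"
    using WhileT.IH(1) code by blast
  moreover have "ireach P (n + 2 + csize c, s1) 1 (n, s1)"
    by (rule reaches_step) (use code in \<open>simp add: istep_def\<close>)
  moreover have "ireach P (n, s1) t2 (n + csize (CWhile r a c), s2)"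
    using WhileT.IH(2) WhileT.prems by blast
  ultimately have "ireach P (n, s) (1 + t1 + 1 + t2) (n + csize (CWhile r a c), s2)"
    by (metis reaches_trans)
  then show ?case by (simp add: ac_simps)
next
  case (Slack c s t s1 t')
  then show ?case by (blast intro: reaches_mono)
qed

definition instr_ok :: "nat \<Rightarrow> nat \<Rightarrow> instr \<Rightarrow> bool" where
  "instr_ok R N i \<longleftrightarrow> (case i of
     IPush r a \<Rightarrow> r < R \<and> 1 \<le> a \<and> a \<le> 4
   | IPop r \<Rightarrow> r < R
   | IBr r a t \<Rightarrow> r < R \<and> t \<le> N
   | IGoto t \<Rightarrow> t \<le> N)"

lemma instr_ok_compile:
  assumes "wf_com c" "regs_bound c \<le> R" "n + csize c \<le> N" "i \<in> set (compile c n)"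
  shows "instr_ok R N i"
  using assms
proof (induction c arbitrary: n)
  case (CSeq c1 c2)
  then show ?case using CSeq.IH(1)[of n] CSeq.IH(2)[of "n + csize c1"] by auto
next
  case (CIf r a c1 c2)
  then show ?case using CIf.IH(1)[of "Suc n"] CIf.IH(2)[of "n + csize c1 + 2"]
    by (auto simp: instr_ok_def)
next
  case (CWhile r a c)
  then show ?case using CWhile.IH[of "n + 2"] by (auto simp: instr_ok_def)
qed (auto simp: instr_ok_def)

section \<open>Turing machines on two-sided functional tapes\<close>

type_synonym delta = "nat \<Rightarrow> nat \<Rightarrow> nat \<times> nat \<times> move"
type_synonym tconfig = "nat \<times> int \<times> (int \<Rightarrow> nat)"

definition nthb :: "nat list \<Rightarrow> nat \<Rightarrow> nat" where
  "nthb xs i = (if i < length xs then xs ! i else 0)"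

lemma nthb_simps [simp]:
  "nthb [] i = 0" "nthb (x # xs) 0 = x" "nthb (x # xs) (Suc i) = nthb xs i"
  "nthb (drop n xs) i = nthb xs (n + i)"
  by (auto simp: nthb_def)

lemma hd_blank_nthb: "hd_blank xs = nthb xs 0"
  by (cases xs) (auto simp: hd_blank_def)

fun move_int :: "move \<Rightarrow> int" where
  "move_int Lft = -1" | "move_int Stay = 0" | "move_int Rgt = 1"

definition astep :: "delta \<Rightarrow> tconfig \<Rightarrow> tconfig" where
  "astep d c = (case c of (q, p, tp) \<Rightarrow> if q = 1 \<or> q = 2 then c else
     (case d q (tp p) of (q', a, mv) \<Rightarrow> (q', p + move_int mv, tp(p := a))))"

text \<open>Reading past the end of a list gives 0, so the relation ignores trailing blanks, and
  list configurations that differ only there represent the same tape.\<close>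

definition represents :: "config \<Rightarrow> tconfig \<Rightarrow> bool" where
  "represents c a \<longleftrightarrow> (case c of (q0, ls, rs) \<Rightarrow> case a of (q, p, tp) \<Rightarrow>
     q0 = q \<and> (\<forall>i. tp (p + int i) = nthb rs i) \<and> (\<forall>i. tp (p - 1 - int i) = nthb ls i))"

lemma represents_step:
  assumes "represents c a"
  shows "represents (tm_step (Q, S, d) c) (astep d a)"
proof -
  obtain q ls rs p tp where c: "c = (q, ls, rs)" "a = (q, p, tp)"
    and r: "\<And>i. tp (p + int i) = nthb rs i" and l: "\<And>i. tp (p - 1 - int i) = nthb ls i"
    using assms by (cases c; cases a) (auto simp: represents_def)
  have hd: "hd_blank rs = tp p" using r[of 0] by (simp add: hd_blank_nthb)
  obtain q' b mv where d: "d q (tp p) = (q', b, mv)" by (cases "d q (tp p)")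
  have suc: "x + (1 + int i) = x + int (Suc i)" "x - 1 - int i = x - int (Suc i)" for x i by auto
  have r': "tp (p + 1 + int i) = nthb rs (Suc i)" for i using r[of "Suc i"] by (simp add: add.assoc)
  have l': "tp (p - 1 - 1 - int i) = nthb ls (Suc i)" for i
    using l[of "Suc i"] by (simp add: algebra_simps)
  show ?thesis
  proof (cases "q = 1 \<or> q = 2")
    case True
    then show ?thesis using assms by (auto simp: c tm_step_def astep_def)
  next
    case False
    show ?thesis
    proof (cases mv)
      case Lft
      have "(tp(p := b)) (p - 1 + int i) = nthb (hd_blank ls # b # drop 1 rs) i" for i
      proof (cases i)
        case 0
        then show ?thesis using l[of 0] by (simp add: hd_blank_nthb)
      next
        case (Suc j)
        then show ?thesis using r[of j] by (cases j) (auto simp: ac_simps)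
      qed
      moreover have "(tp(p := b)) (p - 1 - 1 - int i) = nthb (drop 1 ls) i" for i
        using l'[of i] by simp
      ultimately show ?thesis using False
        by (simp add: c tm_step_def astep_def hd d Lft represents_def)
    next
      case Stay
      have "(tp(p := b)) (p + int i) = nthb (b # drop 1 rs) i" for i
        using r[of i] by (cases i) auto
      moreover have "(tp(p := b)) (p - 1 - int i) = nthb ls i" for i
        using l[of i] by simp
      ultimately show ?thesis using False
        by (simp add: c tm_step_def astep_def hd d Stay represents_def)
    next
      case Rgt
      have "(tp(p := b)) (p + 1 + int i) = nthb (drop 1 rs) i" for i
        using r'[of i] by simp
      moreover have "(tp(p := b)) (p + 1 - 1 - int i) = nthb (b # ls) i" for i
      proof (cases i)
        case (Suc j)
        then show ?thesis using l[of j] by (simp add: algebra_simps)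
      qed simp
      ultimately show ?thesis using False
        by (simp add: c tm_step_def astep_def hd d Rgt represents_def)
    qed
  qed
qed

definition input_tape :: "nat list \<Rightarrow> int \<Rightarrow> nat" where
  "input_tape w p = (if p < 0 then 0 else nthb w (nat p))"

lemma represents_run:
  "represents (tm_run (Q, S, d) w t) ((astep d ^^ t) (0, 0, input_tape w))"
proof (induction t)
  case 0
  then show ?case by (simp add: tm_run_def represents_def input_tape_def)
next
  case (Suc t)
  then show ?case using represents_step by (simp add: tm_run_def)
qed

lemma tm_state_run:
  "tm_state (tm_run (Q, S, d) w t) = fst ((astep d ^^ t) (0, 0, input_tape w))"
  using represents_run[of Q S d w t] by (auto simp: represents_def tm_state_def split: prod.splits)

lemma walk_right:
  assumes "q \<noteq> 1" "q \<noteq> 2" "\<And>j. j < n \<Longrightarrow> d q (tp (p + int j)) = (q, tp (p + int j), Rgt)"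
  shows "reaches (astep d) (q, p, tp) n (q, p + int n, tp)"
  using assms(3)
proof (induction n)
  case 0
  then show ?case by (simp add: reaches_refl)
next
  case (Suc n)
  have "reaches (astep d) (q, p + int n, tp) 1 (q, p + int (Suc n), tp)"
    by (rule reaches_step) (use Suc.prems[of n] assms(1,2) in \<open>simp add: astep_def\<close>)
  from reaches_trans[OF Suc.IH this] Suc.prems show ?case by simp
qed

lemma walk_left:
  assumes "q \<noteq> 1" "q \<noteq> 2" "\<And>j. j < n \<Longrightarrow> d q (tp (p - int j)) = (q, tp (p - int j), Lft)"
  shows "reaches (astep d) (q, p, tp) n (q, p - int n, tp)"
  using assms(3)
proof (induction n)
  case 0
  then show ?case by (simp add: reaches_refl)
next
  case (Suc n)
  have "reaches (astep d) (q, p - int n, tp) 1 (q, p - int (Suc n), tp)"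
    by (rule reaches_step) (use Suc.prems[of n] assms(1,2) in \<open>simp add: astep_def\<close>)
  from reaches_trans[OF Suc.IH this] Suc.prems show ?case by simp
qed

section \<open>Registers as tracks of a tape\<close>

text \<open>Cell \<open>p\<close> of the tape holds the number whose base 5 digits are the symbols at height \<open>p\<close> of
  the registers \<open>0..<R\<close>, so that a word over the input alphabet already represents a state in which
  only register 0 is occupied. The left end is marked at position -1 by the symbol \<open>5 ^ R\<close>.\<close>

definition cell :: "nat \<Rightarrow> regs \<Rightarrow> nat \<Rightarrow> nat" where
  "cell R s p = (\<Sum>r<R. nthb (rev (s r)) p * 5 ^ r)"

definition regs_tape :: "nat \<Rightarrow> regs \<Rightarrow> int \<Rightarrow> nat" where
  "regs_tape R s p = (if p = -1 then 5 ^ R else if p < 0 then 0 else cell R s (nat p))"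

definition digit :: "nat \<Rightarrow> nat \<Rightarrow> nat" where
  "digit r x = x div 5 ^ r mod 5"

text \<open>Splitting off the lowest digit writes the sum as \<open>d 0\<close> plus 5 times a
  shorter sum of the same kind, to which the induction hypothesis applies with shifted
  digits.\<close>

lemma digit_sum:
  assumes "\<And>r. d r < 5" "k < R"
  shows "digit k (\<Sum>r<R. d r * 5 ^ r) = d k"
  using assms
proof (induction R arbitrary: d k)
  case (Suc R)
  have eq: "(\<Sum>r<Suc R. d r * 5 ^ r) = d 0 + 5 * (\<Sum>r<R. d (Suc r) * 5 ^ r)"
    by (subst sum.lessThan_Suc_shift) (simp add: sum_distrib_left ac_simps)
  show ?case
  proof (cases k)
    case 0
    then show ?thesis unfolding eq using Suc.prems(1)[of 0] by (simp add: digit_def)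
  next
    case (Suc k')
    have "(d 0 + 5 * (\<Sum>r<R. d (Suc r) * 5 ^ r)) div 5 ^ k
        = (\<Sum>r<R. d (Suc r) * 5 ^ r) div 5 ^ k'"
      using Suc.prems(1)[of 0] by (simp add: Suc div_mult2_eq)
    then show ?thesis unfolding eq
      using Suc.IH[of "\<lambda>r. d (Suc r)" k'] Suc.prems Suc by (simp add: digit_def)
  qed
qed simp

lemma sum_digits_less:
  assumes "\<And>r. d r < 5"
  shows "(\<Sum>r<R. d r * 5 ^ r) < (5::nat) ^ R"
  using assms
proof (induction R)
  case (Suc R)
  have "d R * 5 ^ R \<le> 4 * 5 ^ R" using Suc.prems[of R] by (intro mult_right_mono) auto
  with Suc.IH[OF Suc.prems] have "(\<Sum>r<R. d r * 5 ^ r) + d R * 5 ^ R < 5 ^ R + 4 * 5 ^ R"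
    by (rule add_less_le_mono)
  then show ?case by simp
qed simp

lemma nthb_valid: "valid xs \<Longrightarrow> nthb xs i < 5"
  using nth_mem[of i xs] by (fastforce simp: nthb_def valid_def)

text \<open>This is how the machine finds the top of a register: the first zero digit on its
  track.\<close>

lemma nthb_valid_eq_0:
  assumes "valid xs"
  shows "nthb xs i = 0 \<longleftrightarrow> length xs \<le> i"
proof (cases "i < length xs")
  case True
  then have "1 \<le> xs ! i" using nth_mem[of i xs] assms by (auto simp: valid_def subset_iff)
  then show ?thesis using True by (auto simp: nthb_def)
qed (auto simp: nthb_def)

lemma digit_cell:
  assumes "\<And>r. valid (s r)" "r < R"
  shows "digit r (cell R s p) = nthb (rev (s r)) p"
  unfolding cell_def using assms by (intro digit_sum nthb_valid) auto

text \<open>Cell contents are thereby distinguishable from the left mark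
  \<open>5 ^ R\<close>.\<close>

lemma cell_less: "(\<And>r. valid (s r)) \<Longrightarrow> cell R s p < 5 ^ R"
  unfolding cell_def by (intro sum_digits_less nthb_valid) auto

lemma nthb_snoc: "nthb (xs @ [a]) p = (if p = length xs then a else nthb xs p)"
  by (auto simp: nthb_def nth_append)

lemma cell_push:
  assumes "r < R"
  shows "cell R (s(r := a # s r)) p = (if p = length (s r) then cell R s p + a * 5 ^ r else cell R s p)"
proof -
  have "cell R (s(r := a # s r)) p = nthb (rev (s r) @ [a]) p * 5 ^ r
      + (\<Sum>i\<in>{..<R} - {r}. nthb (rev (s i)) p * 5 ^ i)"
    unfolding cell_def by (subst sum.remove[of _ r]) (use assms in auto)
  moreover have "cell R s p = nthb (rev (s r)) p * 5 ^ r
      + (\<Sum>i\<in>{..<R} - {r}. nthb (rev (s i)) p * 5 ^ i)"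
    unfolding cell_def by (subst sum.remove[of _ r]) (use assms in auto)
  moreover have "nthb (rev (s r)) (length (s r)) = 0" by (simp add: nthb_def)
  ultimately show ?thesis by (auto simp: nthb_snoc)
qed

text \<open>Registers are stored bottom first, so that a push changes a single cell, the one at the
  height of the register.\<close>

lemma regs_tape_push:
  assumes "r < R"
  shows "regs_tape R (s(r := a # s r)) =
    (regs_tape R s)(int (length (s r)) := cell R s (length (s r)) + a * 5 ^ r)"
  using assms by (auto simp: regs_tape_def cell_push nat_eq_iff intro!: ext)

lemma regs_tape_pop:
  assumes "r < R" "s r = x # xs"
  shows "regs_tape R (s(r := xs)) =
    (regs_tape R s)(int (length xs) := cell R s (length xs) - x * 5 ^ r)"
proof -
  define s' where "s' = s(r := xs)"
  \<comment> \<open>The pop is treated as the inverse of pushing \<open>x\<close> onto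
    \<open>s'\<close>.\<close>
  have s: "s = s'(r := x # s' r)" using assms(2) by (auto simp: s'_def)
  have "regs_tape R s = (regs_tape R s')(int (length xs) := cell R s' (length xs) + x * 5 ^ r)"
    by (subst s, subst regs_tape_push) (use assms in \<open>auto simp: s'_def\<close>)
  moreover have "cell R s (length xs) = cell R s' (length xs) + x * 5 ^ r"
    by (subst s, subst cell_push) (use assms in \<open>auto simp: s'_def\<close>)
  moreover have "regs_tape R s' (int (length xs)) = cell R s' (length xs)"
    by (simp add: regs_tape_def)
  ultimately show ?thesis unfolding s'_def[symmetric] by auto
qed

text \<open>States 0, 1 and 2 are the initial and the halting states, and state 3 writes the left
  mark; the program states, five phases per instruction, start at 4.\<close>

definition code :: "nat \<Rightarrow> nat \<Rightarrow> nat" where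
  "code pc ph = 4 + 5 * pc + ph"

text \<open>Every instruction starts and ends with the head on the left mark. Phase 1 climbs to the end
  of the register, phase 3 acts on its top, and phases 2 and 4 return to the mark and jump to the
  next instruction and to the jump target, respectively.\<close>

definition act_delta :: "nat \<Rightarrow> nat \<Rightarrow> nat \<Rightarrow> instr \<Rightarrow> nat \<times> nat \<times> move" where
  "act_delta R pc x i = (case i of
     IPop r \<Rightarrow> if x = 5 ^ R then (code (Suc pc) 0, x, Stay)
               else (code pc 2, x - digit r x * 5 ^ r, Lft)
   | IBr r a t \<Rightarrow> (code pc (if (if x = 5 ^ R then 0 else digit r x) = a then 2 else 4), x, Stay)
   | _ \<Rightarrow> (2, x, Stay))"

text \<open>The truncation by \<open>min\<close> keeps the written symbol in the alphabet for every
  \<open>x\<close> up to \<open>5 ^ R\<close>. In a simulated run the new cell is below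
  \<open>5 ^ R\<close> and the truncation has no effect.\<close>

definition climb_delta :: "nat \<Rightarrow> nat \<Rightarrow> nat \<Rightarrow> instr \<Rightarrow> nat \<times> nat \<times> move" where
  "climb_delta R pc x i = (case i of
     IPush r a \<Rightarrow> if digit r x = 0 then (code pc 2, min (5 ^ R) (x + a * 5 ^ r), Lft)
                  else (code pc 1, x, Rgt)
   | IPop r \<Rightarrow> if digit r x = 0 then (code pc 3, x, Lft) else (code pc 1, x, Rgt)
   | IBr r a t \<Rightarrow> if digit r x = 0 then (code pc 3, x, Lft) else (code pc 1, x, Rgt)
   | _ \<Rightarrow> (2, x, Stay))"

definition jump_target :: "instr \<Rightarrow> nat" where
  "jump_target i = (case i of IBr r a t \<Rightarrow> t | IGoto t \<Rightarrow> t | _ \<Rightarrow> 0)"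

definition instr_delta :: "nat \<Rightarrow> nat \<Rightarrow> instr \<Rightarrow> nat \<Rightarrow> nat \<Rightarrow> nat \<times> nat \<times> move" where
  "instr_delta R pc i ph x =
    (if ph = 0 then (case i of IGoto t \<Rightarrow> (code t 0, x, Stay) | _ \<Rightarrow> (code pc 1, x, Rgt))
     else if ph = 1 then climb_delta R pc x i
     else if ph = 2 then (if x = 5 ^ R then (code (Suc pc) 0, x, Stay) else (code pc 2, x, Lft))
     else if ph = 3 then act_delta R pc x i
     else (if x = 5 ^ R then (code (jump_target i) 0, x, Stay) else (code pc 4, x, Lft)))"

lemma code_neq [simp]: "code pc ph \<noteq> 0" "code pc ph \<noteq> 1" "code pc ph \<noteq> Suc 0" "code pc ph \<noteq> 2"
    "code pc ph \<noteq> 3"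
  by (auto simp: code_def)

text \<open>An instruction is one climb from the mark to the top of a register and one descent, with
  a bounded number of extra steps; a branch on a register of height \<open>H\<close> takes
  \<open>2 * H + 4\<close>.\<close>

lemma simulate_instr:
  assumes d: "\<And>ph x. ph < 5 \<Longrightarrow> x \<le> 5 ^ R \<Longrightarrow> d (code pc ph) x = instr_delta R pc (P ! pc) ph x"
    and pc: "pc < length P" and ok: "instr_ok R (length P) (P ! pc)"
    and valid: "\<And>r. valid (s r)" and H: "\<And>r. length (s r) \<le> H"
    and st: "istep P (pc, s) = (pc', s')"
  shows "reaches (astep d) (code pc 0, -1, regs_tape R s) (2 * H + 4) (code pc' 0, -1, regs_tape R s')"
proof (cases "\<exists>t. P ! pc = IGoto t")
  case True
  then obtain t where t: "P ! pc = IGoto t" by blast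
  have "reaches (astep d) (code pc 0, -1, regs_tape R s) 1 (code pc' 0, -1, regs_tape R s')"
    by (rule reaches_step)
      (use st pc in \<open>auto simp: t istep_def astep_def d instr_delta_def regs_tape_def\<close>)
  then show ?thesis by (rule reaches_mono) simp
next
  case False
  define r where "r = (case P ! pc of IPush r a \<Rightarrow> r | IPop r \<Rightarrow> r | IBr r a t \<Rightarrow> r | IGoto t \<Rightarrow> 0)"
  have r: "r < R" using ok False by (cases "P ! pc") (auto simp: r_def instr_ok_def)
  define h where "h = length (s r)"
  define T where "T = regs_tape R s"
  have T_mark: "T (-1) = 5 ^ R" by (simp add: T_def regs_tape_def)
  have T_cell: "T (int p) = cell R s p" for p by (simp add: T_def regs_tape_def)
  have T_less: "T (int p) < 5 ^ R" for p
    unfolding T_cell using valid by (rule cell_less)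
  have T_le: "T (int p) \<le> 5 ^ R" for p using T_less[of p] by simp
  have dig: "digit r (T (int p)) = nthb (rev (s r)) p" for p
    unfolding T_cell using valid r by (rule digit_cell)
  have dig0: "digit r (T (int p)) = 0 \<longleftrightarrow> h \<le> p" for p
    unfolding dig using nthb_valid_eq_0[of "rev (s r)" p] valid[of r] by (simp add: h_def)
  have climb: "reaches (astep d) (code pc 0, -1, T) (1 + h) (code pc 1, int h, T)"
  proof (rule reaches_trans)
    show "reaches (astep d) (code pc 0, -1, T) 1 (code pc 1, 0, T)"
      by (rule reaches_step) (use False in \<open>cases "P ! pc",
          auto simp: astep_def d T_mark instr_delta_def\<close>)
    have "d (code pc 1) (T (0 + int j)) = (code pc 1, T (0 + int j), Rgt)" if "j < h" for j
    proof -
      have "digit r (T (int j)) \<noteq> 0" using that dig0[of j] by simp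
      then show ?thesis using False T_le[of j]
        by (cases "P ! pc") (auto simp: d instr_delta_def climb_delta_def r_def)
    qed
    from walk_right[of "code pc 1" h d T 0, OF _ _ this]
    show "reaches (astep d) (code pc 1, 0, T) h (code pc 1, int h, T)" by simp
  qed
  \<comment> \<open>The tape \<open>T'\<close> is arbitrary because push and pop alter it before the
    way back. The case \<open>p = -1\<close>, a head already on the mark, is needed for empty
    registers.\<close>
  have descend: "reaches (astep d) (code pc ph, p, T') (nat (p + 1) + 1) (code q 0, -1, T')"
    if p: "-1 \<le> p" and T': "\<And>j. T' (int j) < 5 ^ R" "T' (-1) = 5 ^ R"
      and ph: "ph = 2 \<and> q = Suc pc \<or> ph = 4 \<and> q = jump_target (P ! pc)"
    for T' p ph q
  proof (rule reaches_trans)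
    have "d (code pc ph) (T' (p - int j)) = (code pc ph, T' (p - int j), Lft)" if "j < nat (p + 1)" for j
    proof -
      have "p - int j = int (nat (p - int j))" using that by simp
      then have "T' (p - int j) < 5 ^ R" using T'(1) by metis
      then show ?thesis using ph by (auto simp: d instr_delta_def)
    qed
    from walk_left[of "code pc ph" "nat (p + 1)" d T' p, OF _ _ this]
    show "reaches (astep d) (code pc ph, p, T') (nat (p + 1)) (code pc ph, -1, T')"
      using p by simp
    show "reaches (astep d) (code pc ph, -1, T') 1 (code q 0, -1, T')"
      by (rule reaches_step) (use T'(2) ph in \<open>auto simp: astep_def d instr_delta_def fun_upd_idem_iff\<close>)
  qed
  have hH: "h \<le> H" using H by (simp add: h_def)
  note dh = dig0[of h, simplified]
  show ?thesis
  proof (cases "P ! pc")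
    case (IPush r' a)
    then have r': "r' = r" by (simp add: r_def)
    define T' where "T' = T(int h := cell R s h + a * 5 ^ r)"
    have s': "pc' = Suc pc" "s' = s(r := a # s r)" using st pc by (auto simp: istep_def IPush r')
    have T'_eq: "T' = regs_tape R s'" unfolding T'_def T_def s' h_def
      using regs_tape_push[OF r] by simp
    have "\<And>i. valid (s' i)" using ok valid by (auto simp: s' instr_ok_def IPush)
    then have T'_less: "T' (int j) < 5 ^ R" for j
      unfolding T'_eq regs_tape_def using cell_less by simp
    have T'_mark: "T' (-1) = 5 ^ R" by (simp add: T'_eq regs_tape_def)
    have "reaches (astep d) (code pc 1, int h, T) 1 (code pc 2, int h - 1, T')"
    proof (rule reaches_step)
      have "min (5 ^ R) (T (int h) + a * 5 ^ r) = cell R s h + a * 5 ^ r"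
        using T'_less[of h] by (simp add: T'_def T_cell)
      then show "astep d (code pc 1, int h, T) = (code pc 2, int h - 1, T')"
        using dh T_le[of h] by (simp add: astep_def d instr_delta_def climb_delta_def IPush r' T'_def)
    qed
    from reaches_trans[OF reaches_trans[OF climb this] descend[of "int h - 1" T' 2 "Suc pc"]]
    have "reaches (astep d) (code pc 0, -1, T) (1 + h + 1 + (nat (int h - 1 + 1) + 1)) (code (Suc pc) 0, -1, T')"
      using T'_less T'_mark by simp
    then show ?thesis unfolding T_def[symmetric] s'(1) T'_eq[symmetric]
      by (rule reaches_mono) (use hH in simp)
  next
    case (IPop r')
    then have r': "r' = r" by (simp add: r_def)
    have top: "reaches (astep d) (code pc 1, int h, T) 1 (code pc 3, int h - 1, T)"
      by (rule reaches_step)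
        (use dh T_le[of h] in \<open>simp add: astep_def d instr_delta_def climb_delta_def IPop r'\<close>)
    show ?thesis
    proof (cases "s r")
      case Nil
      then have h0: "h = 0" by (simp add: h_def)
      have s': "pc' = Suc pc" "s' = s" using st pc Nil by (auto simp: istep_def IPop r')
      \<comment> \<open>With an empty register the head is back on the mark in phase 3, and nothing
        is removed, in agreement with \<open>tl [] = []\<close>.\<close>
      have "reaches (astep d) (code pc 3, int h - 1, T) 1 (code (Suc pc) 0, -1, T)"
        by (rule reaches_step)
          (simp add: astep_def d instr_delta_def act_delta_def IPop r' h0 T_mark fun_upd_idem_iff)
      from reaches_trans[OF reaches_trans[OF climb top] this]
      show ?thesis unfolding T_def[symmetric] s' by (rule reaches_mono) (use hH in simp)
    next
      case (Cons x xs)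
      then have h: "h = Suc (length xs)" by (simp add: h_def)
      have s': "pc' = Suc pc" "s' = s(r := xs)" using st pc Cons by (auto simp: istep_def IPop r')
      define T' where "T' = T(int (length xs) := cell R s (length xs) - x * 5 ^ r)"
      have T'_eq: "T' = regs_tape R s'" unfolding T'_def T_def s'
        using regs_tape_pop[of r R s x xs, OF r Cons] by simp
      have "valid (s' i)" for i using valid[of i] valid[of r] Cons by (auto simp: s')
      then have T'_less: "T' (int j) < 5 ^ R" for j
        unfolding T'_eq regs_tape_def using cell_less by simp
      have T'_mark: "T' (-1) = 5 ^ R" by (simp add: T'_eq regs_tape_def)
      have "reaches (astep d) (code pc 3, int h - 1, T) 1 (code pc 2, int (length xs) - 1, T')"
      proof (rule reaches_step)
        have "digit r (T (int (length xs))) = x" unfolding dig Cons by (simp add: nthb_snoc)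
        then show "astep d (code pc 3, int h - 1, T) = (code pc 2, int (length xs) - 1, T')"
          using T_less[of "length xs"]
          by (simp add: astep_def d instr_delta_def act_delta_def IPop r' h T'_def T_cell)
      qed
      from reaches_trans[OF reaches_trans[OF reaches_trans[OF climb top] this]
          descend[of "int (length xs) - 1" T' 2 "Suc pc"]]
      have "reaches (astep d) (code pc 0, -1, T) (1 + h + 1 + 1 + (nat (int (length xs) - 1 + 1) + 1))
          (code (Suc pc) 0, -1, T')"
        using T'_less T'_mark by simp
      then show ?thesis unfolding T_def[symmetric] s'(1) T'_eq[symmetric]
        by (rule reaches_mono) (use hH h in simp)
    qed
  next
    case (IBr r' a t)
    then have r': "r' = r" by (simp add: r_def)
    have top: "reaches (astep d) (code pc 1, int h, T) 1 (code pc 3, int h - 1, T)"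
      by (rule reaches_step)
        (use dh T_le[of h] in \<open>simp add: astep_def d instr_delta_def climb_delta_def IBr r'\<close>)
    have s': "pc' = (if hd_blank (s r) = a then Suc pc else t)" "s' = s"
      using st pc by (auto simp: istep_def IBr r')
    define ph where "ph = (if hd_blank (s r) = a then 2 else 4 :: nat)"
    have "reaches (astep d) (code pc 3, int h - 1, T) 1 (code pc ph, int h - 1, T)"
    proof (rule reaches_step)
      \<comment> \<open>The head meets the mark exactly when the register is empty; the mark then
        counts as the blank \<open>hd_blank []\<close>.\<close>
      have "(if T (int h - 1) = 5 ^ R then 0 else digit r (T (int h - 1))) = hd_blank (s r)"
      proof (cases "s r")
        case Nil
        then show ?thesis by (simp add: h_def T_mark hd_blank_def)
      next
        case (Cons x xs)
        then have "digit r (T (int (length xs))) = x" unfolding dig by (simp add: nthb_snoc)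
        then show ?thesis using T_less[of "length xs"] Cons by (simp add: h_def hd_blank_def)
      qed
      moreover have "T (int h - 1) \<le> 5 ^ R"
        using T_mark T_le[of "h - 1"] by (cases h) auto
      ultimately show "astep d (code pc 3, int h - 1, T) = (code pc ph, int h - 1, T)"
        by (simp add: astep_def d instr_delta_def act_delta_def IBr r' ph_def)
    qed
    from reaches_trans[OF reaches_trans[OF reaches_trans[OF climb top] this]
        descend[of "int h - 1" T ph pc']]
    have "reaches (astep d) (code pc 0, -1, T) (1 + h + 1 + 1 + (nat (int h - 1 + 1) + 1)) (code pc' 0, -1, T)"
      using T_less T_mark by (simp add: ph_def s' jump_target_def IBr)
    then show ?thesis unfolding T_def[symmetric] s'(2) by (rule reaches_mono) (use hH in simp)
  next
    case (IGoto t)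
    then show ?thesis using False by simp
  qed
qed

definition input_regs :: "nat list \<Rightarrow> regs" where
  "input_regs x = (\<lambda>_. [])(0 := x)"

lemma istep_invariant:
  assumes "istep P (pc, s) = (pc', s')" "pc \<le> length P" "\<And>i. i \<in> set P \<Longrightarrow> instr_ok R (length P) i"
    "\<And>r. valid (s r)" "\<And>r. length (s r) \<le> H"
  shows "pc' \<le> length P \<and> (\<forall>r. valid (s' r)) \<and> (\<forall>r. length (s' r) \<le> Suc H)"
proof (cases "pc < length P")
  case True
  then have "instr_ok R (length P) (P ! pc)" using assms(3) by simp
  moreover have "length (s r) \<le> Suc H" "length (s r) - Suc 0 \<le> Suc H" for r
    using assms(5)[of r] by simp_all
  ultimately show ?thesis using assms True
    by (cases "P ! pc") (auto simp: istep_def instr_ok_def valid_tl split: if_splits)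
next
  case False
  moreover have "length (s r) \<le> Suc H" for r using assms(5)[of r] by simp
  ultimately show ?thesis using assms by (auto simp: istep_def)
qed

text \<open>Heights grow by at most one per instruction, so during \<open>k\<close> instructions
  they stay below \<open>H + k\<close>, and each instruction costs at most
  \<open>2 * (H + k) + 4\<close>.\<close>

lemma simulate_run:
  assumes d: "\<And>pc ph x. pc < length P \<Longrightarrow> ph < 5 \<Longrightarrow> x \<le> 5 ^ R \<Longrightarrow>
      d (code pc ph) x = instr_delta R pc (P ! pc) ph x"
    and ok: "\<And>i. i \<in> set P \<Longrightarrow> instr_ok R (length P) i"
    and "(istep P ^^ k) (pc, s) = (pc', s')" "pc \<le> length P"
    and "\<And>r. valid (s r)" "\<And>r. length (s r) \<le> H"
  shows "reaches (astep d) (code pc 0, -1, regs_tape R s) (k * (2 * (H + k) + 4))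
    (code pc' 0, -1, regs_tape R s')"
  using assms(3-)
proof (induction k arbitrary: pc s H)
  case 0
  then show ?case by (simp add: reaches_refl)
next
  case (Suc k)
  obtain pc1 s1 where st: "istep P (pc, s) = (pc1, s1)" by (cases "istep P (pc, s)")
  have inv: "pc1 \<le> length P \<and> (\<forall>r. valid (s1 r)) \<and> (\<forall>r. length (s1 r) \<le> Suc H)"
    using istep_invariant[OF st] ok Suc.prems by blast
  have "(istep P ^^ k) (pc1, s1) = (pc', s')"
    using Suc.prems(1) st by (simp add: funpow_swap1)
  then have "reaches (astep d) (code pc1 0, -1, regs_tape R s1) (k * (2 * (Suc H + k) + 4))
    (code pc' 0, -1, regs_tape R s')"
    using Suc.IH inv by blast
  moreover have "reaches (astep d) (code pc 0, -1, regs_tape R s) (2 * H + 4)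
    (code pc1 0, -1, regs_tape R s1)"
  proof (cases "pc < length P")
    case True
    then show ?thesis using simulate_instr[OF _ True _ _ _ st] d ok Suc.prems by simp
  next
    case False
    then have "pc1 = pc" "s1 = s" using st by (auto simp: istep_def)
    then show ?thesis using reaches_mono[OF reaches_refl] by simp
  qed
  ultimately have "reaches (astep d) (code pc 0, -1, regs_tape R s)
    (2 * H + 4 + k * (2 * (Suc H + k) + 4)) (code pc' 0, -1, regs_tape R s')"
    by (metis reaches_trans)
  then show ?case by (rule reaches_mono) simp
qed

section \<open>Halting and composition of a program with a machine\<close>

lemma astep_halted: "q = 1 \<or> q = 2 \<Longrightarrow> (astep d ^^ k) (q, x) = (q, x)"
  by (induction k) (auto simp: astep_def split: prod.splits)

text \<open>A halted configuration is a fixed point, which turns "within \<open>t\<close> steps"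
  into "after exactly \<open>t\<close> steps", the form that \<open>decides_within\<close> asks
  for.\<close>

lemma reaches_halted:
  assumes "reaches (astep d) c t (q, x)" "q = 1 \<or> q = 2"
  shows "(astep d ^^ t) c = (q, x)"
proof -
  obtain k where k: "k \<le> t" "(astep d ^^ k) c = (q, x)" using assms(1) by (auto simp: reaches_def)
  have "(astep d ^^ ((t - k) + k)) c = (q, x)"
    by (simp only: funpow_add o_apply k(2) astep_halted[OF assms(2)])
  then show ?thesis using k(1) by simp
qed

text \<open>The halting states are not shifted, so the verdict of the embedded machine is that of
  the composed one.\<close>

definition embed :: "nat \<Rightarrow> nat \<Rightarrow> nat" where
  "embed off q = (if q = 1 \<or> q = 2 then q else off + q)"

text \<open>The first two steps set the mark to the left of the input. When the program is finished
  the mark is erased, and since only register 0 is occupied then, the shifted machine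
  \<open>d\<close> starts on an ordinary input tape.\<close>

definition compose_delta :: "nat \<Rightarrow> instr list \<Rightarrow> delta \<Rightarrow> delta" where
  "compose_delta R P d q x =
    (if q = 0 then (3, x, Lft)
     else if q = 3 then (code 0 0, 5 ^ R, Stay)
     else if q < code (length P) 0 then instr_delta R ((q - 4) div 5) (P ! ((q - 4) div 5)) ((q - 4) mod 5) x
     else if q = code (length P) 0 then (code (length P) 1, 0, Rgt)
     else (case d (q - code (length P) 1) x of (q', a, mv) \<Rightarrow> (embed (code (length P) 1) q', a, mv)))"

text \<open>Truncation makes the closure conditions of \<open>wf_tm\<close> immediate for all states
  and symbols; values that are already in range do not change.\<close>

definition clamp :: "nat \<Rightarrow> nat \<Rightarrow> delta \<Rightarrow> delta" where
  "clamp Q S d q x = (case d q x of (q', a, mv) \<Rightarrow> (if q' < Q then q' else 2, if a < S then a else 0, mv))"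

lemma clamp_id: "fst (d q x) < Q \<Longrightarrow> fst (snd (d q x)) < S \<Longrightarrow> clamp Q S d q x = d q x"
  by (auto simp: clamp_def split: prod.splits)

lemma cell_input_regs:
  assumes "0 < R"
  shows "cell R (input_regs (rev w)) p = nthb w p"
proof -
  have "cell R (input_regs (rev w)) p = (\<Sum>r<R. if r = 0 then nthb w p else 0)"
    unfolding cell_def by (intro sum.cong) (auto simp: input_regs_def)
  then show ?thesis using assms by simp
qed

lemma regs_tape_input:
  "0 < R \<Longrightarrow> regs_tape R (input_regs (rev w)) = (input_tape w)(-1 := 5 ^ R)"
  by (auto simp: regs_tape_def input_tape_def cell_input_regs)

lemma instr_delta_bounds:
  assumes "pc < N" "instr_ok R N i" "x \<le> 5 ^ R"
  shows "fst (instr_delta R pc i ph x) \<le> code N 0" "fst (snd (instr_delta R pc i ph x)) \<le> 5 ^ R"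
proof -
  have c: "code pc 1 \<le> code N 0" "code pc 2 \<le> code N 0" "code pc 3 \<le> code N 0" "code pc 4 \<le> code N 0"
    "code (Suc pc) 0 \<le> code N 0"
    "code pc (Suc 0) \<le> code N 0" "2 \<le> code N 0" "t \<le> N \<Longrightarrow> code t 0 \<le> code N 0" for t
    using assms(1) by (auto simp: code_def)
  have m: "x - a \<le> 5 ^ R" for a using assms(3) by simp
  show "fst (instr_delta R pc i ph x) \<le> code N 0"
    using assms(2) by (cases i) (simp_all add: instr_delta_def climb_delta_def act_delta_def
        jump_target_def instr_ok_def c)
  show "fst (snd (instr_delta R pc i ph x)) \<le> 5 ^ R"
    using assms(2,3) m by (cases i) (simp_all add: instr_delta_def climb_delta_def act_delta_def
        jump_target_def instr_ok_def)
qed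

text \<open>The words are reversed because the first letter of the tape is the bottom of register 0.
  The summand 3 consists of two steps for setting the mark and one for erasing it.\<close>

lemma compose_machine:
  assumes c: "wf_com c" and M: "wf_tm M"
  shows "\<exists>M'. wf_tm M' \<and> (\<forall>w w' t T ans. valid w \<longrightarrow>
    exec c (input_regs (rev w)) t (input_regs (rev w')) \<longrightarrow> decides_within M w' ans T \<longrightarrow>
    decides_within M' w ans (3 + t * (2 * (length w + t) + 4) + T))"
proof -
  obtain Q S d where M_eq: "M = (Q, S, d)" by (cases M)
  have QS: "3 \<le> Q" "5 \<le> S" and dwf: "\<And>q a. q < Q \<Longrightarrow> a < S \<Longrightarrow> fst (d q a) < Q \<and> fst (snd (d q a)) < S"
    using M by (auto simp: wf_tm_def M_eq)
  define R where "R = Suc (regs_bound c)"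
  define P where "P = compile c 0"
  have ok: "instr_ok R (length P) i" if "i \<in> set P" for i
    using instr_ok_compile[OF c, of R 0 "length P" i] that by (simp add: P_def R_def)
  define off where "off = code (length P) 1"
  define Q' where "Q' = off + Q"
  define S' where "S' = max S (Suc (5 ^ R))"
  define d' where "d' = clamp Q' S' (compose_delta R P d)"
  have off: "3 < off" "off = Suc (code (length P) 0)" by (auto simp: off_def code_def)
  have wf: "wf_tm (Q', S', d')"
    using QS off by (auto simp: wf_tm_def Q'_def S'_def d'_def clamp_def split: prod.splits)
  have d'_instr: "d' (code pc ph) x = instr_delta R pc (P ! pc) ph x"
    if "pc < length P" "ph < 5" "x \<le> 5 ^ R" for pc ph x
  proof -
    have "(code pc ph - 4) div 5 = pc" "(code pc ph - 4) mod 5 = ph" "code pc ph < code (length P) 0"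
      using that by (auto simp: code_def)
    then have eq: "compose_delta R P d (code pc ph) x = instr_delta R pc (P ! pc) ph x"
      by (simp add: compose_delta_def)
    have "instr_ok R (length P) (P ! pc)" using ok that by simp
    from instr_delta_bounds[OF that(1) this that(3), of ph] show ?thesis
      unfolding d'_def by (subst clamp_id) (auto simp: eq Q'_def S'_def off)
  qed
  have d'_M: "d' (off + q) x = (embed off (fst (d q x)), snd (d q x))" if "q < Q" "x < S" for q x
  proof -
    have eq: "compose_delta R P d (off + q) x = (embed off (fst (d q x)), snd (d q x))"
      unfolding compose_delta_def off_def[symmetric] using off by (auto split: prod.splits)
    show ?thesis unfolding d'_def using dwf[OF that] QS off(1)
      by (subst clamp_id) (auto simp: eq Q'_def S'_def embed_def)
  qed
  \<comment> \<open>The bound on the tape symbols is part of the induction because \<open>d'\<close>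
    is known to follow \<open>d\<close> only on symbols below \<open>S\<close>.\<close>
  have run_M: "case (astep d ^^ k) (q, p, tp) of (q', p', tp') \<Rightarrow>
      (astep d' ^^ k) (embed off q, p, tp) = (embed off q', p', tp')"
    if "q < Q" "\<And>i. tp i < S" for k q p tp
    using that
  proof (induction k arbitrary: q p tp)
    case (Suc k)
    show ?case
    proof (cases "q = 1 \<or> q = 2")
      case True
      then have "embed off q = q" by (auto simp: embed_def)
      with True show ?thesis by (simp add: astep_halted del: funpow.simps)
    next
      case False
      obtain q1 a mv where dq: "d q (tp p) = (q1, a, mv)" by (cases "d q (tp p)")
      have "astep d (q, p, tp) = (q1, p + move_int mv, tp(p := a))"
        using False by (simp add: astep_def dq)
      moreover have "astep d' (embed off q, p, tp) = (embed off q1, p + move_int mv, tp(p := a))"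
        using False d'_M[of q "tp p"] Suc.prems off by (simp add: astep_def dq embed_def)
      moreover have "q1 < Q" "\<And>i. (tp(p := a)) i < S"
        using dwf[of q "tp p"] Suc.prems by (auto simp: dq)
      moreover note Suc.IH[OF this, of "p + move_int mv"]
      ultimately show ?thesis by (simp only: funpow_Suc_right o_apply)
    qed
  qed simp
  have "decides_within (Q', S', d') w ans (3 + t * (2 * (length w + t) + 4) + T)"
    if w: "valid w" and ex: "exec c (input_regs (rev w)) t (input_regs (rev w'))"
      and dec: "decides_within M w' ans T" for w w' t T ans
  proof -
    have vin: "valid (input_regs (rev w) r)" for r using w by (simp add: input_regs_def)
    have "valid (input_regs (rev w') 0)" by (rule exec_valid[OF ex c]) (use vin in blast)
    then have w': "valid w'" by (simp add: input_regs_def)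
    have R0: "0 < R" by (simp add: R_def)
    have "ireach P (0, input_regs (rev w)) t (0 + csize c, input_regs (rev w'))"
      by (rule compile_correct[OF ex]) (auto simp: P_def code_at_def)
    then obtain k where k: "k \<le> t"
        "(istep P ^^ k) (0, input_regs (rev w)) = (length P, input_regs (rev w'))"
      by (auto simp: reaches_def P_def)
    have "reaches (astep d') (code 0 0, -1, regs_tape R (input_regs (rev w)))
        (k * (2 * (length w + k) + 4)) (code (length P) 0, -1, regs_tape R (input_regs (rev w')))"
      by (rule simulate_run[OF d'_instr ok k(2)]) (use w in \<open>auto simp: input_regs_def\<close>)
    then have main: "reaches (astep d') (code 0 0, -1, regs_tape R (input_regs (rev w)))
        (t * (2 * (length w + t) + 4)) (code (length P) 0, -1, regs_tape R (input_regs (rev w')))"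
      by (rule reaches_mono) (use k(1) in \<open>intro mult_mono add_mono, auto\<close>)
    have s1: "reaches (astep d') (0, 0, input_tape w) 1 (3, -1, input_tape w)"
    proof (rule reaches_step)
      have "nthb w 0 < S'" using nthb_valid[OF w, of 0] QS by (simp add: S'_def)
      then have "d' 0 (input_tape w 0) = (3, input_tape w 0, Lft)"
        unfolding d'_def using off by (subst clamp_id) (auto simp: compose_delta_def input_tape_def Q'_def)
      then show "astep d' (0, 0, input_tape w) = (3, -1, input_tape w)"
        by (simp add: astep_def)
    qed
    have s2: "reaches (astep d') (3, -1, input_tape w) 1
        (code 0 0, -1, regs_tape R (input_regs (rev w)))"
    proof (rule reaches_step)
      have "code 0 0 < Q'" using off by (simp add: Q'_def off_def code_def)
      then have "d' 3 (input_tape w (-1)) = (code 0 0, 5 ^ R, Stay)"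
        unfolding d'_def by (subst clamp_id) (auto simp: compose_delta_def S'_def)
      then show "astep d' (3, -1, input_tape w) = (code 0 0, -1, regs_tape R (input_regs (rev w)))"
        by (simp add: astep_def regs_tape_input[OF R0])
    qed
    have s3: "reaches (astep d') (code (length P) 0, -1, regs_tape R (input_regs (rev w'))) 1
        (embed off 0, 0, input_tape w')"
    proof (rule reaches_step)
      have "d' (code (length P) 0) x = (off, 0, Rgt)" for x
        unfolding d'_def using QS by (subst clamp_id) (auto simp: compose_delta_def S'_def Q'_def off_def)
      then show "astep d' (code (length P) 0, -1, regs_tape R (input_regs (rev w'))) =
          (embed off 0, 0, input_tape w')"
        by (auto simp: astep_def regs_tape_input[OF R0] embed_def input_tape_def)
    qed
    obtain qf pf tf where f: "(astep d ^^ T) (0, 0, input_tape w') = (qf, pf, tf)"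
      by (cases "(astep d ^^ T) (0, 0, input_tape w')")
    have "input_tape w' i < S" for i
      using nthb_valid[OF w', of "nat i"] QS by (simp add: input_tape_def)
    then have "(astep d' ^^ T) (embed off 0, 0, input_tape w') = (embed off qf, pf, tf)"
      using run_M[of 0 "input_tape w'" T 0] QS by (simp add: f)
    then have s4: "reaches (astep d') (embed off 0, 0, input_tape w') T (embed off qf, pf, tf)"
      by (auto simp: reaches_def)
    note reaches_trans[OF reaches_trans[OF reaches_trans[OF reaches_trans[OF s1 s2] main] s3] s4]
    then have total: "reaches (astep d') (0, 0, input_tape w)
        (1 + 1 + t * (2 * (length w + t) + 4) + 1 + T) (embed off qf, pf, tf)" .
    have qf: "qf \<in> {1, 2}" "qf = 1 \<longleftrightarrow> ans"
      using dec f unfolding decides_within_def M_eq tm_state_run by auto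
    then have emb: "embed off qf = qf" by (auto simp: embed_def)
    from reaches_halted[OF total[unfolded emb]] qf
    have "(astep d' ^^ (3 + t * (2 * (length w + t) + 4) + T)) (0, 0, input_tape w) = (qf, pf, tf)"
      by (auto simp: numeral_3_eq_3)
    then show ?thesis unfolding decides_within_def tm_state_run using qf by auto
  qed
  with wf show ?thesis by blast
qed

section \<open>Polynomial-time functions\<close>

text \<open>The functions of interest map an arbitrary context to a word, and the context is accessible
  through a finite set \<open>V\<close> of words computed from it; \<open>vsize\<close> is the input size. Only contexts
  all of whose views are words over the alphabet 1..4 matter.\<close>

definition vsize :: "('a \<Rightarrow> nat list) set \<Rightarrow> 'a \<Rightarrow> nat" where
  "vsize V a = (\<Sum>v\<in>V. length (v a))"

definition vok :: "('a \<Rightarrow> nat list) set \<Rightarrow> 'a \<Rightarrow> bool" where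
  "vok V a \<longleftrightarrow> (\<forall>v\<in>V. valid (v a))"

definition poly_bounded :: "('a \<Rightarrow> nat list) set \<Rightarrow> ('a \<Rightarrow> nat) \<Rightarrow> bool" where
  "poly_bounded V B \<longleftrightarrow> (\<exists>C e. \<forall>a. vok V a \<longrightarrow> B a \<le> C * (1 + vsize V a) ^ e)"

lemma poly_bounded_mono:
  assumes "poly_bounded V B" "\<And>a. vok V a \<Longrightarrow> B' a \<le> B a"
  shows "poly_bounded V B'"
  using assms unfolding poly_bounded_def by (meson order_trans)

lemma poly_bounded_const: "poly_bounded V (\<lambda>_. k)"
  unfolding poly_bounded_def by (intro exI[of _ k] exI[of _ 0]) simp

lemma poly_bounded_vsize: "poly_bounded V (vsize V)"
  unfolding poly_bounded_def by (intro exI[of _ 1] exI[of _ 1]) simp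

lemma poly_bounded_add:
  assumes "poly_bounded V B1" "poly_bounded V B2"
  shows "poly_bounded V (\<lambda>a. B1 a + B2 a)"
proof -
  obtain C1 e1 C2 e2 where b: "\<And>a. vok V a \<Longrightarrow> B1 a \<le> C1 * (1 + vsize V a) ^ e1"
      "\<And>a. vok V a \<Longrightarrow> B2 a \<le> C2 * (1 + vsize V a) ^ e2"
    using assms unfolding poly_bounded_def by blast
  have "B1 a + B2 a \<le> (C1 + C2) * (1 + vsize V a) ^ (e1 + e2)" if "vok V a" for a
  proof -
    have "B1 a \<le> C1 * (1 + vsize V a) ^ (e1 + e2)"
      by (rule order_trans[OF b(1)[OF that]], intro mult_left_mono power_increasing) simp_all
    moreover have "B2 a \<le> C2 * (1 + vsize V a) ^ (e1 + e2)"
      by (rule order_trans[OF b(2)[OF that]], intro mult_left_mono power_increasing) simp_all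
    ultimately show ?thesis unfolding distrib_right by (rule add_mono)
  qed
  then show ?thesis unfolding poly_bounded_def by blast
qed

lemma poly_bounded_mult:
  assumes "poly_bounded V B1" "poly_bounded V B2"
  shows "poly_bounded V (\<lambda>a. B1 a * B2 a)"
proof -
  obtain C1 e1 C2 e2 where b: "\<And>a. vok V a \<Longrightarrow> B1 a \<le> C1 * (1 + vsize V a) ^ e1"
      "\<And>a. vok V a \<Longrightarrow> B2 a \<le> C2 * (1 + vsize V a) ^ e2"
    using assms unfolding poly_bounded_def by blast
  have "B1 a * B2 a \<le> (C1 * C2) * (1 + vsize V a) ^ (e1 + e2)" if "vok V a" for a
    using mult_mono[OF b(1)[OF that] b(2)[OF that]] by (simp add: power_add ac_simps)
  then show ?thesis unfolding poly_bounded_def by blast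
qed

lemma poly_bounded_power: "poly_bounded V B \<Longrightarrow> poly_bounded V (\<lambda>a. B a ^ e)"
proof (induction e)
  case (Suc e)
  from poly_bounded_mult[OF Suc.prems Suc.IH[OF Suc.prems]] show ?case unfolding power_Suc .
qed (simp add: poly_bounded_const)

lemmas poly_bounded_intros =
  poly_bounded_const poly_bounded_vsize poly_bounded_add poly_bounded_mult poly_bounded_power

text \<open>The program must work for every placement \<open>\<rho>\<close> of the views below
  \<open>m\<close>, may use the registers from \<open>m\<close> on as empty scratch space, and
  restores everything but register \<open>m\<close>. This stack discipline makes the closure
  properties compositional: a second result can be computed on top of the first.\<close>

definition PT :: "('a \<Rightarrow> nat list) set \<Rightarrow> ('a \<Rightarrow> nat list) \<Rightarrow> bool" where
  "PT V f \<longleftrightarrow> finite V \<and> (\<forall>\<rho> m. (\<forall>v\<in>V. \<rho> v < m) \<longrightarrow>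
     (\<exists>c T. wf_com c \<and> poly_bounded V T \<and>
       (\<forall>a s. vok V a \<longrightarrow> (\<forall>v\<in>V. s (\<rho> v) = v a) \<longrightarrow> (\<forall>i\<ge>m. s i = []) \<longrightarrow>
          exec c s (T a) (s(m := f a)))))"

lemma PT_finite: "PT V f \<Longrightarrow> finite V"
  by (simp add: PT_def)

lemma PT_E:
  assumes "PT V f" "\<And>v. v \<in> V \<Longrightarrow> \<rho> v < m"
  obtains c T where "wf_com c" "poly_bounded V T"
    "\<And>a s. vok V a \<Longrightarrow> (\<And>v. v \<in> V \<Longrightarrow> s (\<rho> v) = v a) \<Longrightarrow> (\<And>i. m \<le> i \<Longrightarrow> s i = [])
       \<Longrightarrow> exec c s (T a) (s(m := f a))"
proof -
  obtain c T where "wf_com c" "poly_bounded V T"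
    "\<forall>a s. vok V a \<longrightarrow> (\<forall>v\<in>V. s (\<rho> v) = v a) \<longrightarrow> (\<forall>i\<ge>m. s i = []) \<longrightarrow>
          exec c s (T a) (s(m := f a))"
    using assms unfolding PT_def by (elim conjE allE[of _ \<rho>] allE[of _ m]) blast
  then show ?thesis using that[of c T] by simp
qed

lemma PT_I:
  assumes "finite V" and
    "\<And>\<rho> m. (\<And>v. v \<in> V \<Longrightarrow> \<rho> v < m) \<Longrightarrow> \<exists>c T. wf_com c \<and> poly_bounded V T \<and>
       (\<forall>a s. vok V a \<longrightarrow> (\<forall>v\<in>V. s (\<rho> v) = v a) \<longrightarrow> (\<forall>i\<ge>m. s i = []) \<longrightarrow>
          exec c s (T a) (s(m := f a)))"
  shows "PT V f"
  unfolding PT_def using assms by simp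

text \<open>An injective placement of the finitely many views yields a concrete initial state;
  running the program there bounds the length of the result by its time and shows that only valid
  letters are written.\<close>

lemma PT_result:
  assumes "PT V f"
  shows "poly_bounded V (\<lambda>a. length (f a))" "vok V a \<Longrightarrow> valid (f a)"
proof -
  obtain \<rho> :: "('a \<Rightarrow> nat list) \<Rightarrow> nat" where inj: "inj_on \<rho> V"
    using finite_imp_inj_to_nat_seg[OF PT_finite[OF assms]] by blast
  obtain m where m: "\<And>v. v \<in> V \<Longrightarrow> \<rho> v < m"
    using PT_finite[OF assms] finite_nat_set_iff_bounded[of "\<rho> ` V"] by auto
  define s where "s a i = (if i \<in> \<rho> ` V then (inv_into V \<rho> i) a else [])" for a i
  obtain c T where c: "wf_com c" and T: "poly_bounded V T"
    and ex: "\<And>a s. vok V a \<Longrightarrow> (\<And>v. v \<in> V \<Longrightarrow> s (\<rho> v) = v a) \<Longrightarrow> (\<And>i. m \<le> i \<Longrightarrow> s i = [])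
       \<Longrightarrow> exec c s (T a) (s(m := f a))"
    using PT_E[where \<rho> = \<rho> and m = m, OF assms m] by blast
  have ex: "exec c (s a) (T a) ((s a)(m := f a))" if "vok V a" for a
    by (rule ex[OF that]) (use inj m in \<open>force simp: s_def\<close>)+
  have sm: "s a m = []" for a using m by (force simp: s_def)
  show "poly_bounded V (\<lambda>a. length (f a))"
    by (rule poly_bounded_mono[OF T]) (use exec_length[OF ex, of _ m] sm in simp)
  assume a: "vok V a"
  have "valid (s a i)" for i using a inj by (auto simp: s_def vok_def)
  from exec_valid[OF ex[OF a] c, of m] this show "valid (f a)" by simp
qed

lemmas PT_length = PT_result(1)
lemmas PT_valid = PT_result(2)

section \<open>Programs that clear, move and copy registers\<close>

fun ccase :: "nat \<Rightarrow> (nat \<Rightarrow> com) \<Rightarrow> com" where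
  "ccase r f = CIf r 1 (f 1) (CIf r 2 (f 2) (CIf r 3 (f 3) (f 4)))"

declare ccase.simps [simp del]

text \<open>A push has a constant letter, so transferring the top symbol takes a case distinction.
  Letter 4 is what remains after three tests, each of cost 2.\<close>

lemma exec_ccase:
  assumes "hd_blank (s r) = x" "1 \<le> x" "x \<le> 4" "exec (f x) s t s'"
  shows "exec (ccase r f) s (t + 6) s'"
proof -
  consider "x = 1" | "x = 2" | "x = 3" | "x = 4" using assms(2,3) by linarith
  then show ?thesis
  proof cases
    case 1
    then have "exec (ccase r f) s (t + 2) s'"
      unfolding ccase.simps using assms by (intro exec.IfT) auto
    then show ?thesis by (rule exec.Slack) simp
  next
    case 2
    then have "exec (ccase r f) s (t + 2 + 2) s'"
      unfolding ccase.simps using assms by (intro exec.IfT exec.IfF) auto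
    then show ?thesis by (rule exec.Slack) simp
  next
    case 3
    then have "exec (ccase r f) s (t + 2 + 2 + 2) s'"
      unfolding ccase.simps using assms by (intro exec.IfT exec.IfF) auto
    then show ?thesis by (rule exec.Slack) simp
  next
    case 4
    then have "exec (ccase r f) s (t + 2 + 2 + 2) s'"
      unfolding ccase.simps using assms by (intro exec.IfF) auto
    then show ?thesis by (rule exec.Slack) simp
  qed
qed

lemma wf_ccase: "(\<And>x. 1 \<le> x \<Longrightarrow> x \<le> 4 \<Longrightarrow> wf_com (f x)) \<Longrightarrow> wf_com (ccase r f)"
  by (simp add: ccase.simps)

definition clear :: "nat \<Rightarrow> com" where
  "clear r = CWhile r 0 (CPop r)"

definition move_rev :: "nat \<Rightarrow> nat \<Rightarrow> com" where
  "move_rev r q = CWhile r 0 (ccase r (\<lambda>x. CPush q x ;; CPop r))"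

text \<open>Registers are read destructively; unloading into two of them at once is the way to
  copy.\<close>

definition move_rev2 :: "nat \<Rightarrow> nat \<Rightarrow> nat \<Rightarrow> com" where
  "move_rev2 r p q = CWhile r 0 (ccase r (\<lambda>x. CPush p x ;; CPush q x ;; CPop r))"

definition replace :: "nat \<Rightarrow> nat \<Rightarrow> nat \<Rightarrow> com" where
  "replace p q z = clear p ;; move_rev q z ;; move_rev z p"

lemma wf_macros [simp]: "wf_com (clear r)" "wf_com (move_rev r q)" "wf_com (move_rev2 r p q)"
    "wf_com (replace p q z)"
  by (auto simp: clear_def move_rev_def move_rev2_def replace_def intro!: wf_ccase)

lemma exec_clear:
  assumes "valid (s r)"
  shows "exec (clear r) s (3 * length (s r) + 2) (s(r := []))"
  using assms
proof (induction "s r" arbitrary: s)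
  case Nil
  have e: "exec (clear r) s 2 s" unfolding clear_def
    by (rule exec.WhileF) (simp add: Nil.hyps[symmetric] hd_blank_def)
  have eq: "s(r := []) = s" by (simp add: fun_upd_idem_iff Nil.hyps[symmetric])
  show ?case unfolding eq by (rule exec.Slack[OF e]) simp
next
  case (Cons x xs)
  define s1 where "s1 = s(r := tl (s r))"
  have xs: "s1 r = xs" using Cons.hyps(2)[symmetric] by (simp add: s1_def)
  have "exec (clear r) s1 (3 * length xs + 2) (s1(r := []))"
    using Cons.hyps(1)[of s1] xs Cons.prems Cons.hyps(2)[symmetric] by simp
  moreover have "exec (CPop r) s 1 s1" unfolding s1_def by (rule exec.Pop)
  ultimately have e: "exec (clear r) s (1 + (3 * length xs + 2) + 2) (s1(r := []))"
    unfolding clear_def using Cons.prems Cons.hyps(2)[symmetric]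
    by (intro exec.WhileT) (auto simp: hd_blank_def)
  have eq: "s1(r := []) = s(r := [])" by (simp add: s1_def)
  show ?case by (rule exec.Slack[OF e[unfolded eq]]) (simp add: Cons.hyps(2)[symmetric])
qed

lemma exec_move_rev2:
  assumes "valid (s r)" "r \<noteq> p" "r \<noteq> q" "p \<noteq> q"
  shows "exec (move_rev2 r p q) s (11 * length (s r) + 2)
    (s(r := [], p := rev (s r) @ s p, q := rev (s r) @ s q))"
  using assms(1)
proof (induction "s r" arbitrary: s)
  case Nil
  have e: "exec (move_rev2 r p q) s 2 s" unfolding move_rev2_def
    by (rule exec.WhileF) (simp add: Nil.hyps[symmetric] hd_blank_def)
  have eq: "s(r := [], p := rev (s r) @ s p, q := rev (s r) @ s q) = s"
    using Nil.hyps[symmetric] by (auto simp: fun_eq_iff)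
  show ?case unfolding eq by (rule exec.Slack[OF e]) simp
next
  case (Cons x xs)
  define s1 where "s1 = s(p := x # s p, q := x # s q, r := xs)"
  have s1: "s1 r = xs" "s1 p = x # s p" "s1 q = x # s q"
    using assms(2-4) by (auto simp: s1_def)
  have x: "1 \<le> x" "x \<le> 4" "valid xs" using Cons.prems Cons.hyps(2)[symmetric] by auto
  have ih: "exec (move_rev2 r p q) s1 (11 * length xs + 2)
      (s1(r := [], p := rev xs @ x # s p, q := rev xs @ x # s q))"
    using Cons.hyps(1)[of s1] s1 x by simp
  have "exec (CPush p x ;; CPush q x ;; CPop r) s (1 + (1 + 1)) s1"
  proof (intro exec.Seq)
    show "exec (CPush p x) s 1 (s(p := x # s p))" by (rule exec.Push)
    show "exec (CPush q x) (s(p := x # s p)) 1 (s(p := x # s p, q := x # s q))"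
      using exec.Push[of q x "s(p := x # s p)"] assms(4) by simp
    show "exec (CPop r) (s(p := x # s p, q := x # s q)) 1 s1"
      using exec.Pop[of r "s(p := x # s p, q := x # s q)"] assms(2,3) Cons.hyps(2)[symmetric]
      by (simp add: s1_def)
  qed
  from exec_ccase[of s r x "\<lambda>x. CPush p x ;; CPush q x ;; CPop r", OF _ x(1,2) this]
  have "exec (ccase r (\<lambda>x. CPush p x ;; CPush q x ;; CPop r)) s (1 + (1 + 1) + 6) s1"
    by (simp add: Cons.hyps(2)[symmetric] hd_blank_def)
  from exec.WhileT[OF _ this ih[unfolded move_rev2_def]]
  have e: "exec (move_rev2 r p q) s (1 + (1 + 1) + 6 + (11 * length xs + 2) + 2)
      (s1(r := [], p := rev xs @ x # s p, q := rev xs @ x # s q))"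
    using x(1) by (simp add: Cons.hyps(2)[symmetric] hd_blank_def move_rev2_def)
  have eq: "s1(r := [], p := rev xs @ x # s p, q := rev xs @ x # s q) =
      s(r := [], p := rev (s r) @ s p, q := rev (s r) @ s q)"
    using assms(2-4) by (auto simp: s1_def fun_eq_iff Cons.hyps(2)[symmetric])
  show ?case by (rule exec.Slack[OF e[unfolded eq]]) (simp add: Cons.hyps(2)[symmetric])
qed

lemma exec_move_rev:
  assumes "valid (s r)" "r \<noteq> q"
  shows "exec (move_rev r q) s (10 * length (s r) + 2) (s(r := [], q := rev (s r) @ s q))"
  using assms(1)
proof (induction "s r" arbitrary: s)
  case Nil
  have e: "exec (move_rev r q) s 2 s" unfolding move_rev_def
    by (rule exec.WhileF) (simp add: Nil.hyps[symmetric] hd_blank_def)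
  have eq: "s(r := [], q := rev (s r) @ s q) = s"
    using Nil.hyps[symmetric] by (auto simp: fun_eq_iff)
  show ?case unfolding eq by (rule exec.Slack[OF e]) simp
next
  case (Cons x xs)
  define s1 where "s1 = s(q := x # s q, r := xs)"
  have s1: "s1 r = xs" "s1 q = x # s q" using assms(2) by (auto simp: s1_def)
  have x: "1 \<le> x" "x \<le> 4" "valid xs" using Cons.prems Cons.hyps(2)[symmetric] by auto
  have ih: "exec (move_rev r q) s1 (10 * length xs + 2) (s1(r := [], q := rev xs @ x # s q))"
    using Cons.hyps(1)[of s1] s1 x by simp
  have "exec (CPush q x ;; CPop r) s (1 + 1) s1"
  proof (intro exec.Seq)
    show "exec (CPush q x) s 1 (s(q := x # s q))" by (rule exec.Push)
    show "exec (CPop r) (s(q := x # s q)) 1 s1"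
      using exec.Pop[of r "s(q := x # s q)"] assms(2) Cons.hyps(2)[symmetric] by (simp add: s1_def)
  qed
  from exec_ccase[of s r x "\<lambda>x. CPush q x ;; CPop r", OF _ x(1,2) this]
  have "exec (ccase r (\<lambda>x. CPush q x ;; CPop r)) s (1 + 1 + 6) s1"
    by (simp add: Cons.hyps(2)[symmetric] hd_blank_def)
  from exec.WhileT[OF _ this ih[unfolded move_rev_def]]
  have e: "exec (move_rev r q) s (1 + 1 + 6 + (10 * length xs + 2) + 2)
      (s1(r := [], q := rev xs @ x # s q))"
    using x(1) by (simp add: Cons.hyps(2)[symmetric] hd_blank_def move_rev_def)
  have eq: "s1(r := [], q := rev xs @ x # s q) = s(r := [], q := rev (s r) @ s q)"
    using assms(2) by (auto simp: s1_def fun_eq_iff Cons.hyps(2)[symmetric])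
  show ?case by (rule exec.Slack[OF e[unfolded eq]]) (simp add: Cons.hyps(2)[symmetric])
qed

lemma exec_replace:
  assumes "valid (s p)" "valid (s q)" "s z = []" "p \<noteq> q" "p \<noteq> z" "q \<noteq> z"
  shows "exec (replace p q z) s (3 * length (s p) + 20 * length (s q) + 6) (s(p := s q, q := []))"
proof -
  define s1 where "s1 = s(p := [])"
  define s2 where "s2 = s1(q := [], z := rev (s q))"
  have "exec (clear p) s (3 * length (s p) + 2) s1"
    unfolding s1_def using assms by (intro exec_clear)
  moreover have "exec (move_rev q z) s1 (10 * length (s q) + 2) s2"
    using exec_move_rev[of s1 q z] assms by (simp add: s1_def s2_def)
  moreover have "exec (move_rev z p) s2 (10 * length (s q) + 2) (s2(z := [], p := s q))"
    using exec_move_rev[of s2 z p] assms by (simp add: s1_def s2_def)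
  ultimately have ex: "exec (replace p q z) s
      (3 * length (s p) + 2 + (10 * length (s q) + 2 + (10 * length (s q) + 2))) (s2(z := [], p := s q))"
    unfolding replace_def by (intro exec.Seq)
  have eq: "s2(z := [], p := s q) = s(p := s q, q := [])"
    using assms by (auto simp: s1_def s2_def fun_eq_iff)
  show ?thesis by (rule exec.Slack[OF ex[unfolded eq]]) simp
qed

section \<open>Closure properties of polynomial-time word functions\<close>

lemma PT_var:
  assumes "finite V" "f \<in> V"
  shows "PT V f"
proof (rule PT_I[OF assms(1)])
  fix \<rho> :: "('a \<Rightarrow> nat list) \<Rightarrow> nat" and m
  assume m: "\<And>v. v \<in> V \<Longrightarrow> \<rho> v < m"
  define i where "i = \<rho> f"
  have i: "i < m" using m assms(2) by (simp add: i_def)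
  show "\<exists>c T. wf_com c \<and> poly_bounded V T \<and>
       (\<forall>a s. vok V a \<longrightarrow> (\<forall>v\<in>V. s (\<rho> v) = v a) \<longrightarrow> (\<forall>i\<ge>m. s i = []) \<longrightarrow>
          exec c s (T a) (s(m := f a)))"
  proof (intro exI conjI allI impI)
    \<comment> \<open>The view is moved to register \<open>m + 1\<close> and from there both back to
      its place and to \<open>m\<close>; the two reversals cancel.\<close>
    show "wf_com (move_rev i (Suc m) ;; move_rev2 (Suc m) i m)" by simp
    show "poly_bounded V (\<lambda>a. 21 * vsize V a + 4)" by (intro poly_bounded_intros)
    fix a s
    assume a: "vok V a" and s: "\<forall>v\<in>V. s (\<rho> v) = v a" "\<forall>i\<ge>m. s i = []"
    have si: "s i = f a" using s assms(2) by (simp add: i_def)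
    have v: "valid (f a)" using a assms(2) by (auto simp: vok_def)
    have "exec (move_rev i (Suc m)) s (10 * length (f a) + 2) (s(i := [], Suc m := rev (f a)))"
      using exec_move_rev[of s i "Suc m"] si s(2) i v by simp
    moreover have "exec (move_rev2 (Suc m) i m) (s(i := [], Suc m := rev (f a)))
        (11 * length (f a) + 2) (s(m := f a))"
    proof -
      have "s(i := [], Suc m := [], i := f a, m := f a) = s(m := f a)"
        using si s(2) i by (auto simp: fun_eq_iff)
      then show ?thesis using exec_move_rev2[of "s(i := [], Suc m := rev (f a))" "Suc m" i m] v i s(2)
        by simp
    qed
    ultimately have "exec (move_rev i (Suc m) ;; move_rev2 (Suc m) i m) s
        (10 * length (f a) + 2 + (11 * length (f a) + 2)) (s(m := f a))"
      by (rule exec.Seq)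
    moreover have "length (f a) \<le> vsize V a"
      unfolding vsize_def using assms by (intro member_le_sum) auto
    ultimately show "exec (move_rev i (Suc m) ;; move_rev2 (Suc m) i m) s (21 * vsize V a + 4) (s(m := f a))"
      by (elim exec.Slack) simp
  qed
qed

lemma PT_Nil:
  assumes "finite V"
  shows "PT V (\<lambda>_. [])"
proof (rule PT_I[OF assms(1)], intro exI conjI allI impI)
  show "wf_com CSkip" by simp
  show "poly_bounded V (\<lambda>_. 0)" by (intro poly_bounded_intros)
  fix \<rho> :: "('a \<Rightarrow> nat list) \<Rightarrow> nat" and m :: nat and a and s :: regs
  assume "\<forall>i\<ge>m. s i = []"
  then have "s m = []" by simp
  then have "s(m := []) = s" by (simp add: fun_upd_idem_iff)
  then show "exec CSkip s 0 (s(m := []))" by (simp add: exec.Skip)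
qed

lemma PT_Cons:
  assumes f: "PT V f" and k: "1 \<le> k" "k \<le> 4"
  shows "PT V (\<lambda>a. k # f a)"
proof (rule PT_I[OF PT_finite[OF f]])
  fix \<rho> :: "('a \<Rightarrow> nat list) \<Rightarrow> nat" and m
  assume m: "\<And>v. v \<in> V \<Longrightarrow> \<rho> v < m"
  obtain c T where c: "wf_com c" and T: "poly_bounded V T"
    and ex: "\<And>a s. vok V a \<Longrightarrow> (\<And>v. v \<in> V \<Longrightarrow> s (\<rho> v) = v a) \<Longrightarrow> (\<And>i. m \<le> i \<Longrightarrow> s i = [])
       \<Longrightarrow> exec c s (T a) (s(m := f a))"
    using PT_E[where \<rho> = \<rho> and m = m, OF f m] by blast
  show "\<exists>c T. wf_com c \<and> poly_bounded V T \<and>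
       (\<forall>a s. vok V a \<longrightarrow> (\<forall>v\<in>V. s (\<rho> v) = v a) \<longrightarrow> (\<forall>i\<ge>m. s i = []) \<longrightarrow>
          exec c s (T a) (s(m := k # f a)))"
  proof (intro exI conjI allI impI)
    show "wf_com (c ;; CPush m k)" using c k by simp
    show "poly_bounded V (\<lambda>a. T a + 1)" by (intro poly_bounded_intros T)
    fix a s
    assume "vok V a" "\<forall>v\<in>V. s (\<rho> v) = v a" "\<forall>i\<ge>m. s i = []"
    then have "exec c s (T a) (s(m := f a))" using ex by blast
    moreover have "exec (CPush m k) (s(m := f a)) 1 (s(m := k # f a))"
      using exec.Push[of m k "s(m := f a)"] by simp
    ultimately show "exec (c ;; CPush m k) s (T a + 1) (s(m := k # f a))" by (rule exec.Seq)
  qed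
qed

lemma PT_tl:
  assumes f: "PT V f"
  shows "PT V (\<lambda>a. tl (f a))"
proof (rule PT_I[OF PT_finite[OF f]])
  fix \<rho> :: "('a \<Rightarrow> nat list) \<Rightarrow> nat" and m
  assume m: "\<And>v. v \<in> V \<Longrightarrow> \<rho> v < m"
  obtain c T where c: "wf_com c" and T: "poly_bounded V T"
    and ex: "\<And>a s. vok V a \<Longrightarrow> (\<And>v. v \<in> V \<Longrightarrow> s (\<rho> v) = v a) \<Longrightarrow> (\<And>i. m \<le> i \<Longrightarrow> s i = [])
       \<Longrightarrow> exec c s (T a) (s(m := f a))"
    using PT_E[where \<rho> = \<rho> and m = m, OF f m] by blast
  show "\<exists>c T. wf_com c \<and> poly_bounded V T \<and>
       (\<forall>a s. vok V a \<longrightarrow> (\<forall>v\<in>V. s (\<rho> v) = v a) \<longrightarrow> (\<forall>i\<ge>m. s i = []) \<longrightarrow>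
          exec c s (T a) (s(m := tl (f a))))"
  proof (intro exI conjI allI impI)
    show "wf_com (c ;; CPop m)" using c by simp
    show "poly_bounded V (\<lambda>a. T a + 1)" by (intro poly_bounded_intros T)
    fix a s
    assume "vok V a" "\<forall>v\<in>V. s (\<rho> v) = v a" "\<forall>i\<ge>m. s i = []"
    then have "exec c s (T a) (s(m := f a))" using ex by blast
    moreover have "exec (CPop m) (s(m := f a)) 1 (s(m := tl (f a)))"
      using exec.Pop[of m "s(m := f a)"] by simp
    ultimately show "exec (c ;; CPop m) s (T a + 1) (s(m := tl (f a)))" by (rule exec.Seq)
  qed
qed

lemma PT_if:
  assumes f: "PT V f" and g: "PT V g" and h: "PT V h"
  shows "PT V (\<lambda>a. if hd_blank (f a) = k then g a else h a)"
proof (rule PT_I[OF PT_finite[OF f]])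
  fix \<rho> :: "('a \<Rightarrow> nat list) \<Rightarrow> nat" and m
  assume m: "\<And>v. v \<in> V \<Longrightarrow> \<rho> v < m"
  obtain c T where c: "wf_com c" and T: "poly_bounded V T"
    and ex: "\<And>a s. vok V a \<Longrightarrow> (\<And>v. v \<in> V \<Longrightarrow> s (\<rho> v) = v a) \<Longrightarrow> (\<And>i. m \<le> i \<Longrightarrow> s i = [])
       \<Longrightarrow> exec c s (T a) (s(m := f a))"
    using PT_E[where \<rho> = \<rho> and m = m, OF f m] by blast
  obtain c1 T1 where c1: "wf_com c1" and T1: "poly_bounded V T1"
    and ex1: "\<And>a s. vok V a \<Longrightarrow> (\<And>v. v \<in> V \<Longrightarrow> s (\<rho> v) = v a) \<Longrightarrow> (\<And>i. m \<le> i \<Longrightarrow> s i = [])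
       \<Longrightarrow> exec c1 s (T1 a) (s(m := g a))"
    using PT_E[where \<rho> = \<rho> and m = m, OF g m] by blast
  obtain c2 T2 where c2: "wf_com c2" and T2: "poly_bounded V T2"
    and ex2: "\<And>a s. vok V a \<Longrightarrow> (\<And>v. v \<in> V \<Longrightarrow> s (\<rho> v) = v a) \<Longrightarrow> (\<And>i. m \<le> i \<Longrightarrow> s i = [])
       \<Longrightarrow> exec c2 s (T2 a) (s(m := h a))"
    using PT_E[where \<rho> = \<rho> and m = m, OF h m] by blast
  show "\<exists>c T. wf_com c \<and> poly_bounded V T \<and>
       (\<forall>a s. vok V a \<longrightarrow> (\<forall>v\<in>V. s (\<rho> v) = v a) \<longrightarrow> (\<forall>i\<ge>m. s i = []) \<longrightarrow>
          exec c s (T a) (s(m := if hd_blank (f a) = k then g a else h a)))"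
  proof (intro exI conjI allI impI)
    \<comment> \<open>The tested word is cleared first, since both branches expect register
      \<open>m\<close> to be empty.\<close>
    show "wf_com (c ;; CIf m k (clear m ;; c1) (clear m ;; c2))" using c c1 c2 by simp
    show "poly_bounded V (\<lambda>a. T a + (3 * length (f a) + 2 + (T1 a + T2 a) + 2))"
      by (intro poly_bounded_intros T T1 T2 PT_length f)
    fix a s
    assume a: "vok V a" "\<forall>v\<in>V. s (\<rho> v) = v a" "\<forall>i\<ge>m. s i = []"
    have e: "exec c s (T a) (s(m := f a))" using ex a by blast
    have "s m = []" using a(3) by simp
    then have "s(m := []) = s" by (simp add: fun_upd_idem_iff)
    then have cl: "exec (clear m) (s(m := f a)) (3 * length (f a) + 2) s"
      using exec_clear[of "s(m := f a)" m] PT_valid[OF f a(1)] by simp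
    have "exec (CIf m k (clear m ;; c1) (clear m ;; c2)) (s(m := f a))
        (3 * length (f a) + 2 + (T1 a + T2 a) + 2) (s(m := if hd_blank (f a) = k then g a else h a))"
    proof (cases "hd_blank (f a) = k")
      case True
      have "exec (CIf m k (clear m ;; c1) (clear m ;; c2)) (s(m := f a))
        (3 * length (f a) + 2 + T1 a + 2) (s(m := g a))"
        by (rule exec.IfT, use True in simp, rule exec.Seq[OF cl], use ex1 a in blast)
      from exec.Slack[OF this] True show ?thesis by simp
    next
      case False
      have "exec (CIf m k (clear m ;; c1) (clear m ;; c2)) (s(m := f a))
        (3 * length (f a) + 2 + T2 a + 2) (s(m := h a))"
        by (rule exec.IfF, use False in simp, rule exec.Seq[OF cl], use ex2 a in blast)
      from exec.Slack[OF this] False show ?thesis by simp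
    qed
    with e show "exec (c ;; CIf m k (clear m ;; c1) (clear m ;; c2)) s
        (T a + (3 * length (f a) + 2 + (T1 a + T2 a) + 2))
        (s(m := if hd_blank (f a) = k then g a else h a))"
      by (rule exec.Seq)
  qed
qed

text \<open>The step sees the whole remaining suffix and not just a letter: its length encodes the
  position, which allows indexing into a second word, and its tail gives access to a block that
  starts there.\<close>

fun foldsuf :: "(nat list \<Rightarrow> 'b \<Rightarrow> 'b) \<Rightarrow> nat list \<Rightarrow> 'b \<Rightarrow> 'b" where
  "foldsuf g [] acc = acc"
| "foldsuf g (x # xs) acc = foldsuf g xs (g (x # xs) acc)"

text \<open>Views of the loop body of \<open>foldsuf\<close>: those of the context, the current suffix, and the
  accumulator.\<close>

definition loop_views :: "('a \<Rightarrow> nat list) set \<Rightarrow> ('a \<times> nat list \<times> nat list \<Rightarrow> nat list) set" where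
  "loop_views V = (\<lambda>v p. v (fst p)) ` V \<union> {\<lambda>p. fst (snd p), \<lambda>p. snd (snd p)}"

lemma vok_loop_views: "vok (loop_views V) (a, u, acc) \<longleftrightarrow> vok V a \<and> valid u \<and> valid acc"
  by (auto simp: vok_def loop_views_def)

lemma inj_lift: "inj_on (\<lambda>v (p :: 'a \<times> 'b). v (fst p)) V"
proof (rule inj_onI)
  fix v w :: "'a \<Rightarrow> 'c" assume eq: "(\<lambda>p :: 'a \<times> 'b. v (fst p)) = (\<lambda>p. w (fst p))"
  show "v = w"
  proof
    fix a
    show "v a = w a" using fun_cong[OF eq, of "(a, undefined)"] by simp
  qed
qed

lemma vsize_lift: "vsize ((\<lambda>v p. v (fst p)) ` V) p = vsize V (fst p)"
  unfolding vsize_def by (subst sum.reindex[OF inj_lift]) simp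

text \<open>As the second part is only an upper bound, coincidences between views do not have to be
  ruled out.\<close>

lemma vsize_loop_views:
  assumes "finite V"
  shows "vsize V (fst p) \<le> vsize (loop_views V) p"
    "vsize (loop_views V) p \<le> vsize V (fst p) + length (fst (snd p)) + length (snd (snd p))"
proof -
  let ?A = "(\<lambda>v p. v (fst p)) ` V :: ('a \<times> nat list \<times> nat list \<Rightarrow> nat list) set"
  let ?B = "{\<lambda>p. fst (snd p), \<lambda>p. snd (snd p)} :: ('a \<times> nat list \<times> nat list \<Rightarrow> nat list) set"
  have "vsize ?A p \<le> vsize (loop_views V) p"
    unfolding vsize_def loop_views_def using assms by (intro sum_mono2) auto
  then show "vsize V (fst p) \<le> vsize (loop_views V) p" by (simp add: vsize_lift)
  have "vsize (loop_views V) p \<le> vsize ?A p + vsize ?B p"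
    unfolding vsize_def loop_views_def using assms by (subst sum.union_inter[symmetric]) auto
  also have "vsize ?B p \<le> length (fst (snd p)) + length (snd (snd p))"
    unfolding vsize_def
    by (cases "(\<lambda>p :: 'a \<times> nat list \<times> nat list. fst (snd p)) = (\<lambda>p. snd (snd p))") auto
  finally show "vsize (loop_views V) p \<le> vsize V (fst p) + length (fst (snd p)) + length (snd (snd p))"
    by (simp add: vsize_lift)
qed

text \<open>The same program serves, because it leaves the registers of the suffix and of the
  accumulator unchanged.\<close>

lemma PT_lift:
  assumes f: "PT V f"
  shows "PT (loop_views V) (\<lambda>p. f (fst p))"
proof (rule PT_I)
  show "finite (loop_views V)" using PT_finite[OF f] by (simp add: loop_views_def)
  fix \<rho> :: "('a \<times> nat list \<times> nat list \<Rightarrow> nat list) \<Rightarrow> nat" and m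
  assume m: "\<And>v. v \<in> loop_views V \<Longrightarrow> \<rho> v < m"
  define \<rho>' where "\<rho>' v = \<rho> (\<lambda>p. v (fst p))" for v
  have m': "\<And>v. v \<in> V \<Longrightarrow> \<rho>' v < m" using m by (auto simp: \<rho>'_def loop_views_def)
  obtain c T where c: "wf_com c" and T: "poly_bounded V T"
    and ex: "\<And>a s. vok V a \<Longrightarrow> (\<And>v. v \<in> V \<Longrightarrow> s (\<rho>' v) = v a) \<Longrightarrow> (\<And>i. m \<le> i \<Longrightarrow> s i = [])
       \<Longrightarrow> exec c s (T a) (s(m := f a))"
    using PT_E[where \<rho> = \<rho>' and m = m, OF f m'] by blast
  show "\<exists>c T. wf_com c \<and> poly_bounded (loop_views V) T \<and>
       (\<forall>a s. vok (loop_views V) a \<longrightarrow> (\<forall>v\<in>loop_views V. s (\<rho> v) = v a) \<longrightarrow> (\<forall>i\<ge>m. s i = []) \<longrightarrow>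
          exec c s (T a) (s(m := f (fst a))))"
  proof (intro exI conjI allI impI)
    show "wf_com c" by (rule c)
    obtain C e where Ce: "\<And>a. vok V a \<Longrightarrow> T a \<le> C * (1 + vsize V a) ^ e"
      using T unfolding poly_bounded_def by blast
    show "poly_bounded (loop_views V) (\<lambda>p. T (fst p))"
    proof (rule poly_bounded_mono)
      show "poly_bounded (loop_views V) (\<lambda>p. C * (1 + vsize (loop_views V) p) ^ e)"
        by (intro poly_bounded_intros)
      fix p assume "vok (loop_views V) p"
      then have "T (fst p) \<le> C * (1 + vsize V (fst p)) ^ e"
        using Ce by (cases p) (auto simp: vok_loop_views)
      also have "\<dots> \<le> C * (1 + vsize (loop_views V) p) ^ e"
        by (intro mult_left_mono power_mono add_left_mono vsize_loop_views PT_finite[OF f]) auto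
      finally show "T (fst p) \<le> C * (1 + vsize (loop_views V) p) ^ e" .
    qed
    fix p s
    assume "vok (loop_views V) p" "\<forall>v\<in>loop_views V. s (\<rho> v) = v p" "\<forall>i\<ge>m. s i = []"
    then show "exec c s (T (fst p)) (s(m := f (fst p)))"
      by (intro ex) (auto simp: \<rho>'_def loop_views_def vok_def)
  qed
qed

lemma PT_suffix: "finite V \<Longrightarrow> PT (loop_views V) (\<lambda>p. fst (snd p))"
  by (rule PT_var) (auto simp: loop_views_def)

lemma PT_acc: "finite V \<Longrightarrow> PT (loop_views V) (\<lambda>p. snd (snd p))"
  by (rule PT_var) (auto simp: loop_views_def)

text \<open>The growth per round is additive and its bound \<open>G a\<close> does not depend on the
  accumulator. Hence the accumulator stays polynomial over the whole loop; a mere polynomial bound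
  on each step would permit repeated squaring.\<close>

lemma PT_foldsuf:
  assumes l: "PT V l" and i: "PT V init"
    and st: "PT (loop_views V) (\<lambda>p. step (fst p) (fst (snd p)) (snd (snd p)))"
    and G: "poly_bounded V G"
    and growth: "\<And>a u acc. vok V a \<Longrightarrow> valid u \<Longrightarrow> valid acc \<Longrightarrow> length u \<le> length (l a) \<Longrightarrow>
      length (step a u acc) \<le> length acc + G a"
  shows "PT V (\<lambda>a. foldsuf (step a) (l a) (init a))"
proof (rule PT_I)
  show fin: "finite V" by (rule PT_finite[OF l])
  fix \<rho> :: "('a \<Rightarrow> nat list) \<Rightarrow> nat" and m
  assume m: "\<And>v. v \<in> V \<Longrightarrow> \<rho> v < m"
  obtain ci Ti where ci: "wf_com ci" and Ti: "poly_bounded V Ti"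
    and exi: "\<And>a s. vok V a \<Longrightarrow> (\<And>v. v \<in> V \<Longrightarrow> s (\<rho> v) = v a) \<Longrightarrow> (\<And>i. m \<le> i \<Longrightarrow> s i = [])
       \<Longrightarrow> exec ci s (Ti a) (s(m := init a))"
    using PT_E[where \<rho> = \<rho> and m = m, OF i m] by blast
  have m1: "\<And>v. v \<in> V \<Longrightarrow> \<rho> v < Suc m" using m less_SucI by blast
  obtain cl Tl where cl: "wf_com cl" and Tl: "poly_bounded V Tl"
    and exl: "\<And>a s. vok V a \<Longrightarrow> (\<And>v. v \<in> V \<Longrightarrow> s (\<rho> v) = v a) \<Longrightarrow> (\<And>i. Suc m \<le> i \<Longrightarrow> s i = [])
       \<Longrightarrow> exec cl s (Tl a) (s(Suc m := l a))"
    using PT_E[where \<rho> = \<rho> and m = "Suc m", OF l m1] by blast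
  \<comment> \<open>Register \<open>m\<close> holds the accumulator and \<open>m + 1\<close> the
    suffix; the lifted views stay where \<open>\<rho>\<close> put them. The step delivers its result
    in \<open>m + 2\<close>, and \<open>m + 3\<close> is scratch space for
    \<open>replace\<close>.\<close>
  define \<rho>' :: "('a \<times> nat list \<times> nat list \<Rightarrow> nat list) \<Rightarrow> nat" where
    "\<rho>' w = (if w = (\<lambda>p. snd (snd p)) then m else if w = (\<lambda>p. fst (snd p)) then Suc m
       else \<rho> (SOME v. v \<in> V \<and> w = (\<lambda>p. v (fst p))))" for w
  have \<rho>': "w = (\<lambda>p. snd (snd p)) \<and> \<rho>' w = m \<or> w = (\<lambda>p. fst (snd p)) \<and> \<rho>' w = Suc m \<or>
      (\<exists>v\<in>V. w = (\<lambda>p. v (fst p)) \<and> \<rho>' w = \<rho> v)" if "w \<in> loop_views V" for w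
  proof (cases "w = (\<lambda>p. snd (snd p)) \<or> w = (\<lambda>p. fst (snd p))")
    case True
    then show ?thesis unfolding \<rho>'_def by metis
  next
    case False
    then obtain v where "v \<in> V \<and> w = (\<lambda>p. v (fst p))" using \<open>w \<in> loop_views V\<close> by (auto simp: loop_views_def)
    then have "(SOME v. v \<in> V \<and> w = (\<lambda>p. v (fst p))) \<in> V \<and>
        w = (\<lambda>p. (SOME v. v \<in> V \<and> w = (\<lambda>p. v (fst p))) (fst p))"
      by (rule someI[where P = "\<lambda>v. v \<in> V \<and> w = (\<lambda>p. v (fst p))"])
    then show ?thesis unfolding \<rho>'_def using False by auto
  qed
  have m2: "\<And>w. w \<in> loop_views V \<Longrightarrow> \<rho>' w < m + 2" using \<rho>' m by fastforce
  obtain cs Ts where cs: "wf_com cs" and Ts: "poly_bounded (loop_views V) Ts"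
    and exs: "\<And>p s. vok (loop_views V) p \<Longrightarrow> (\<And>w. w \<in> loop_views V \<Longrightarrow> s (\<rho>' w) = w p) \<Longrightarrow> (\<And>i. m + 2 \<le> i \<Longrightarrow> s i = [])
       \<Longrightarrow> exec cs s (Ts p) (s(m + 2 := step (fst p) (fst (snd p)) (snd (snd p))))"
    using PT_E[where \<rho> = \<rho>' and m = "m + 2", OF st m2] by blast
  obtain C e where Ce: "\<And>p. vok (loop_views V) p \<Longrightarrow> Ts p \<le> C * (1 + vsize (loop_views V) p) ^ e"
    using Ts unfolding poly_bounded_def by blast
  \<comment> \<open>\<open>A\<close> bounds all accumulators, \<open>K\<close> the time of one step,
    and \<open>Bt\<close> that of one loop body. The coefficient 23 is 3 for clearing the old
    accumulator plus 20 for moving the new one twice.\<close>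
  define A where "A a = length (init a) + length (l a) * G a" for a
  define K where "K a = C * (1 + (vsize V a + length (l a) + A a)) ^ e" for a
  define Bt where "Bt a = K a + (23 * A a + 6 + 1)" for a
  define body where "body = cs ;; replace m (m + 2) (m + 3) ;; CPop (Suc m)"
  define loop where "loop = CWhile (Suc m) 0 body"
  have bd_A: "poly_bounded V A" unfolding A_def by (intro poly_bounded_intros PT_length i l G)
  have bd_Bt: "poly_bounded V Bt" unfolding Bt_def K_def
    by (intro poly_bounded_intros PT_length l bd_A)
  \<comment> \<open>The invariant on \<open>length acc\<close> reserves a growth of
    \<open>G a\<close> for each round that is still to come.\<close>
  have ex_loop: "exec loop s (length u * (Bt a + 2) + 2) (s(m := foldsuf (step a) u acc, Suc m := []))"
    if a: "vok V a" and u: "length u \<le> length (l a)" "valid u" "valid acc"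
      and len: "length acc + length u * G a \<le> A a"
      and s: "s m = acc" "s (Suc m) = u" "\<And>v. v \<in> V \<Longrightarrow> s (\<rho> v) = v a" "\<And>i. m + 2 \<le> i \<Longrightarrow> s i = []"
    for a u acc s
    using u len s
  proof (induction u arbitrary: acc s)
    case Nil
    have eq: "s(m := foldsuf (step a) [] acc, Suc m := []) = s"
      using Nil.prems by (auto simp: fun_eq_iff)
    have "exec loop s 2 s"
      unfolding loop_def by (rule exec.WhileF) (use Nil.prems in \<open>simp add: hd_blank_def\<close>)
    then show ?case unfolding eq by (rule exec.Slack) simp
  next
    case (Cons x xs)
    define new where "new = step a (x # xs) acc"
    have vp: "vok (loop_views V) (a, x # xs, acc)" using a Cons.prems by (simp add: vok_loop_views)
    have v_new: "valid new" using PT_valid[OF st vp] by (simp add: new_def)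
    have len_new: "length new \<le> length acc + G a"
      unfolding new_def by (rule growth) (use a Cons.prems in auto)
    then have len': "length new + length xs * G a \<le> A a" using Cons.prems(4) by simp
    define s1 where "s1 = s(m + 2 := new)"
    have "s (\<rho>' w) = w (a, x # xs, acc)" if "w \<in> loop_views V" for w
      using \<rho>'[OF that] Cons.prems(5-7) by auto
    then have e1: "exec cs s (Ts (a, x # xs, acc)) s1"
      using exs[OF vp] Cons.prems(8) unfolding s1_def new_def by simp
    have "Ts (a, x # xs, acc) \<le> C * (1 + vsize (loop_views V) (a, x # xs, acc)) ^ e" by (rule Ce[OF vp])
    also have "\<dots> \<le> K a"
    proof -
      have "vsize (loop_views V) (a, x # xs, acc) \<le> vsize V a + length (x # xs) + length acc"
        using vsize_loop_views(2)[OF fin, of "(a, x # xs, acc)"] by simp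
      also have "\<dots> \<le> vsize V a + length (l a) + A a"
        using Cons.prems(1,4) by (intro add_mono) auto
      finally show ?thesis unfolding K_def by (intro mult_left_mono power_mono add_left_mono) auto
    qed
    finally have time1: "Ts (a, x # xs, acc) \<le> K a" .
    have "exec (replace m (m + 2) (m + 3)) s1 (3 * length acc + 20 * length new + 6)
        (s1(m := new, m + 2 := []))"
      using exec_replace[of s1 m "m + 2" "m + 3"] v_new Cons.prems by (simp add: s1_def)
    then have e2: "exec (replace m (m + 2) (m + 3)) s1 (23 * A a + 6) (s1(m := new, m + 2 := []))"
      by (rule exec.Slack) (use Cons.prems(4) len' in simp)
    define s2 where "s2 = s(m := new, Suc m := xs)"
    have "exec (CPop (Suc m)) (s1(m := new, m + 2 := [])) 1
        (s1(m := new, m + 2 := [], Suc m := xs))"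
      using exec.Pop[of "Suc m" "s1(m := new, m + 2 := [])"] Cons.prems(6) by (simp add: s1_def)
    moreover have "s1(m := new, m + 2 := [], Suc m := xs) = s2"
      using Cons.prems(8) by (auto simp: s1_def s2_def fun_eq_iff)
    ultimately have e3: "exec (CPop (Suc m)) (s1(m := new, m + 2 := [])) 1 s2" by simp
    have "exec body s (K a + (23 * A a + 6 + 1)) s2"
      unfolding body_def
      by (rule exec.Seq[OF exec.Slack[OF e1 time1] exec.Seq[OF e2 e3]])
    then have eb: "exec body s (Bt a) s2" by (simp add: Bt_def)
    have "s2 (\<rho> v) = v a" if "v \<in> V" for v
      using Cons.prems(7)[OF that] m[OF that] by (auto simp: s2_def)
    then have "exec loop s2 (length xs * (Bt a + 2) + 2)
        (s2(m := foldsuf (step a) xs new, Suc m := []))"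
      using Cons.prems v_new len' by (intro Cons.IH) (auto simp: s2_def)
    from exec.WhileT[OF _ eb this[unfolded loop_def]]
    have "exec loop s (Bt a + (length xs * (Bt a + 2) + 2) + 2) (s2(m := foldsuf (step a) xs new, Suc m := []))"
      using Cons.prems(2,6) by (simp add: hd_blank_def loop_def)
    moreover have "s2(m := foldsuf (step a) xs new, Suc m := []) =
        s(m := foldsuf (step a) (x # xs) acc, Suc m := [])"
      by (auto simp: s2_def fun_eq_iff new_def)
    ultimately have "exec loop s (Bt a + (length xs * (Bt a + 2) + 2) + 2)
        (s(m := foldsuf (step a) (x # xs) acc, Suc m := []))" by simp
    then show ?case by (rule exec.Slack) simp
  qed
  show "\<exists>c T. wf_com c \<and> poly_bounded V T \<and>
       (\<forall>a s. vok V a \<longrightarrow> (\<forall>v\<in>V. s (\<rho> v) = v a) \<longrightarrow> (\<forall>i\<ge>m. s i = []) \<longrightarrow>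
          exec c s (T a) (s(m := foldsuf (step a) (l a) (init a))))"
  proof (intro exI conjI allI impI)
    show "wf_com (ci ;; cl ;; loop)" using ci cl cs by (simp add: loop_def body_def)
    show "poly_bounded V (\<lambda>a. Ti a + (Tl a + (length (l a) * (Bt a + 2) + 2)))"
      by (intro poly_bounded_intros Ti Tl bd_Bt PT_length l)
    fix a s
    assume a: "vok V a" "\<forall>v\<in>V. s (\<rho> v) = v a" "\<forall>i\<ge>m. s i = []"
    define s1 where "s1 = s(m := init a)"
    have \<rho>: "\<rho> v \<noteq> m" "\<rho> v \<noteq> Suc m" if "v \<in> V" for v using m[OF that] by auto
    have e1: "exec ci s (Ti a) s1" unfolding s1_def using exi a by blast
    have e2: "exec cl s1 (Tl a) (s1(Suc m := l a))"
      by (rule exl) (use a \<rho> in \<open>auto simp: s1_def\<close>)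
    have "exec loop (s1(Suc m := l a)) (length (l a) * (Bt a + 2) + 2)
      ((s1(Suc m := l a))(m := foldsuf (step a) (l a) (init a), Suc m := []))"
      using a \<rho> PT_valid[OF l a(1)] PT_valid[OF i a(1)]
      by (intro ex_loop) (auto simp: s1_def A_def)
    moreover have "(s1(Suc m := l a))(m := foldsuf (step a) (l a) (init a), Suc m := []) =
        s(m := foldsuf (step a) (l a) (init a))"
      using a(3) by (auto simp: s1_def fun_eq_iff)
    ultimately have e3: "exec loop (s1(Suc m := l a)) (length (l a) * (Bt a + 2) + 2)
        (s(m := foldsuf (step a) (l a) (init a)))" by simp
    show "exec (ci ;; cl ;; loop) s (Ti a + (Tl a + (length (l a) * (Bt a + 2) + 2)))
        (s(m := foldsuf (step a) (l a) (init a)))"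
      by (rule exec.Seq[OF e1 exec.Seq[OF e2 e3]])
  qed
qed

lemma PT_cong:
  assumes "PT V f" "\<And>a. vok V a \<Longrightarrow> g a = f a"
  shows "PT V g"
  using assms unfolding PT_def by simp

lemma finite_loop_views [simp]: "finite V \<Longrightarrow> finite (loop_views V)"
  by (simp add: loop_views_def)

definition push_hd :: "nat list \<Rightarrow> nat list \<Rightarrow> nat list" where
  "push_hd u acc = (if hd_blank u = 1 then 1 # acc else if hd_blank u = 2 then 2 # acc
     else if hd_blank u = 3 then 3 # acc else 4 # acc)"

lemma foldsuf_push_hd: "valid u \<Longrightarrow> foldsuf push_hd u acc = rev u @ acc"
  by (induction u arbitrary: acc) (auto simp: push_hd_def hd_blank_def)

lemma PT_rev_append:
  assumes f: "PT V f" and g: "PT V g"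
  shows "PT V (\<lambda>a. rev (f a) @ g a)"
proof (rule PT_cong)
  have fin: "finite V" by (rule PT_finite[OF f])
  show "PT V (\<lambda>a. foldsuf push_hd (f a) (g a))"
  proof (rule PT_foldsuf[OF f g, where step = "\<lambda>_. push_hd" and G = "\<lambda>_. 1"])
    show "PT (loop_views V) (\<lambda>p. push_hd (fst (snd p)) (snd (snd p)))"
      unfolding push_hd_def by (intro PT_if PT_Cons PT_suffix PT_acc fin) auto
  qed (auto simp: push_hd_def poly_bounded_const)
  fix a assume "vok V a"
  then show "rev (f a) @ g a = foldsuf push_hd (f a) (g a)"
    using foldsuf_push_hd PT_valid[OF f] by simp
qed

lemma PT_rev: "PT V f \<Longrightarrow> PT V (\<lambda>a. rev (f a))"
  using PT_rev_append[of V f "\<lambda>_. []"] PT_Nil[of V] PT_finite[of V f] by simp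

lemma PT_append: "PT V f \<Longrightarrow> PT V g \<Longrightarrow> PT V (\<lambda>a. f a @ g a)"
  using PT_rev_append[of V "\<lambda>a. rev (f a)" g] PT_rev[of V f] by simp

lemma foldsuf_tl: "foldsuf (\<lambda>_ acc. tl acc) u xs = drop (length u) xs"
  by (induction u arbitrary: xs) (auto simp: drop_Suc)

text \<open>The word \<open>f a\<close> acts as a unary counter, so this is also subtraction of
  lengths.\<close>

lemma PT_drop:
  assumes f: "PT V f" and g: "PT V g"
  shows "PT V (\<lambda>a. drop (length (f a)) (g a))"
proof -
  have fin: "finite V" by (rule PT_finite[OF f])
  have "PT V (\<lambda>a. foldsuf (\<lambda>_ acc. tl acc) (f a) (g a))"
    by (rule PT_foldsuf[OF f g, where step = "\<lambda>_ _ acc. tl acc" and G = "\<lambda>_. 0"])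
      (auto intro!: PT_tl PT_acc fin poly_bounded_const)
  then show ?thesis by (simp add: foldsuf_tl)
qed

text \<open>A loop with a fixed number of rounds replaces the search: once \<open>c\<close> is on
  top the accumulator no longer changes, and \<open>length acc \<le> length u\<close> provides
  enough rounds. Since \<open>c \<noteq> 0\<close>, a top equal to \<open>c\<close> is a genuine
  letter and not the end of the word.\<close>

lemma foldsuf_dropWhile:
  assumes "c \<noteq> 0" "length acc \<le> length u"
  shows "foldsuf (\<lambda>_ acc. if hd_blank acc = c then acc else tl acc) u acc
    = dropWhile (\<lambda>x. x \<noteq> c) acc"
  using assms(2)
proof (induction u arbitrary: acc)
  case (Cons x xs)
  show ?case
  proof (cases "hd_blank acc = c")
    case True
    then obtain ys where acc: "acc = c # ys" using assms(1) by (cases acc) (auto simp: hd_blank_def)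
    have "foldsuf (\<lambda>_ acc. if hd_blank acc = c then acc else tl acc) us (c # ys) = c # ys" for us
      by (induction us) (auto simp: hd_blank_def)
    then show ?thesis by (simp add: acc hd_blank_def)
  next
    case False
    then show ?thesis using Cons.IH[of "tl acc"] Cons.prems assms(1)
      by (cases acc) (auto simp: hd_blank_def)
  qed
qed simp

lemma PT_dropWhile:
  assumes f: "PT V f" and c: "c \<noteq> 0"
  shows "PT V (\<lambda>a. dropWhile (\<lambda>x. x \<noteq> c) (f a))"
proof -
  have fin: "finite V" by (rule PT_finite[OF f])
  have "PT V (\<lambda>a. foldsuf (\<lambda>_ acc. if hd_blank acc = c then acc else tl acc) (f a) (f a))"
    by (rule PT_foldsuf[OF f f, where step = "\<lambda>_ _ acc. if hd_blank acc = c then acc else tl acc"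
          and G = "\<lambda>_. 0"])
      (auto intro!: PT_if PT_tl PT_acc fin poly_bounded_const)
  then show ?thesis by (simp add: foldsuf_dropWhile[OF c])
qed

text \<open>Expresses the prefix by functions already known to be computable, so that no further
  loop is required.\<close>

lemma takeWhile_eq_drop: "takeWhile P xs = rev (drop (length (dropWhile P xs)) (rev xs))"
proof -
  have "rev xs = rev (dropWhile P xs) @ rev (takeWhile P xs)"
    by (metis rev_append takeWhile_dropWhile_id)
  then show ?thesis by simp
qed

lemma PT_takeWhile:
  assumes f: "PT V f" and c: "c \<noteq> 0"
  shows "PT V (\<lambda>a. takeWhile (\<lambda>x. x \<noteq> c) (f a))"
  unfolding takeWhile_eq_drop by (intro PT_rev PT_drop PT_dropWhile f c)

fun concat_suf :: "(nat list \<Rightarrow> nat list) \<Rightarrow> nat list \<Rightarrow> nat list" where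
  "concat_suf q [] = []"
| "concat_suf q (x # xs) = q (x # xs) @ concat_suf q xs"

lemma foldsuf_append: "foldsuf (\<lambda>u acc. acc @ q u) xs acc = acc @ concat_suf q xs"
  by (induction xs arbitrary: acc) auto

lemma concat_suf_eq: "concat_suf q xs = concat (map (\<lambda>i. q (drop i xs)) [0..<length xs])"
proof (induction xs)
  case (Cons x xs)
  have "[0..<length (x # xs)] = 0 # map Suc [0..<length xs]"
    unfolding length_Cons map_Suc_upt by (rule upt_conv_Cons) simp
  then have "map (\<lambda>i. q (drop i (x # xs))) [0..<length (x # xs)]
      = q (x # xs) # map (\<lambda>i. q (drop i xs)) [0..<length xs]" by simp
  then show ?case using Cons.IH by (simp only: concat.simps concat_suf.simps)
qed simp

text \<open>The appended piece is polynomially long and independent of the accumulator, which is the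
  additive growth required by \<open>PT_foldsuf\<close>.\<close>

lemma PT_concat_suf:
  assumes l: "PT V l" and q: "PT (loop_views V) (\<lambda>p. q (fst p) (fst (snd p)))"
  shows "PT V (\<lambda>a. concat_suf (q a) (l a))"
proof -
  have fin: "finite V" by (rule PT_finite[OF l])
  obtain C e where Ce: "\<And>p. vok (loop_views V) p \<Longrightarrow>
      length (q (fst p) (fst (snd p))) \<le> C * (1 + vsize (loop_views V) p) ^ e"
    using PT_length[OF q] unfolding poly_bounded_def by blast
  have "PT V (\<lambda>a. foldsuf (\<lambda>u acc. acc @ q a u) (l a) [])"
  proof (rule PT_foldsuf[OF l PT_Nil[OF fin], where step = "\<lambda>a u acc. acc @ q a u"
          and G = "\<lambda>a. C * (1 + (vsize V a + length (l a))) ^ e"])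
    show "PT (loop_views V) (\<lambda>p. snd (snd p) @ q (fst p) (fst (snd p)))"
      by (intro PT_append PT_acc fin q)
    show "poly_bounded V (\<lambda>a. C * (1 + (vsize V a + length (l a))) ^ e)"
      by (intro poly_bounded_intros PT_length l)
    fix a u acc
    assume a: "vok V a" "valid u" "length u \<le> length (l a)"
    \<comment> \<open>As \<open>q\<close> ignores the accumulator, its length bound may be evaluated
      at an empty one.\<close>
    have "length (q a u) \<le> C * (1 + vsize (loop_views V) (a, u, [])) ^ e"
      using Ce[of "(a, u, [])"] a by (simp add: vok_loop_views)
    also have "\<dots> \<le> C * (1 + (vsize V a + length (l a))) ^ e"
      using vsize_loop_views(2)[OF fin, of "(a, u, [])"] a
      by (intro mult_left_mono power_mono add_left_mono) auto
    finally show "length (acc @ q a u) \<le> length acc + C * (1 + (vsize V a + length (l a))) ^ e"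
      by simp
  qed
  then show ?thesis by (simp add: foldsuf_append)
qed

section \<open>Bit vectors and lists of blocks\<close>

text \<open>For \<open>u = drop i x\<close> the word \<open>drop (length u) x\<close> has length
  \<open>i\<close>, so the value is \<open>drop i y\<close>, whose head is the symbol of
  \<open>y\<close> at the current position of \<open>x\<close>.\<close>

definition sym_at :: "nat list \<Rightarrow> nat list \<Rightarrow> nat list \<Rightarrow> nat list" where
  "sym_at x u y = drop (length (drop (length u) x)) y"

definition vor :: "nat list \<Rightarrow> nat list \<Rightarrow> nat list" where
  "vor x y = concat_suf (\<lambda>u. if hd_blank u = 2 then [2] else
     if hd_blank (sym_at x u y) = 2 then [2] else [1]) x"

text \<open>Truth values are words of ones, with the empty word for false; they are tested by
  comparing the top with 1.\<close>

definition meets :: "nat list \<Rightarrow> nat list \<Rightarrow> nat list" where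
  "meets x y = concat_suf (\<lambda>u. if hd_blank u = 2 then
     if hd_blank (sym_at x u y) = 2 then [1] else [] else []) x"

definition vcompl :: "nat list \<Rightarrow> nat list" where
  "vcompl x = concat_suf (\<lambda>u. if hd_blank u = 2 then [1] else [2]) x"

text \<open>The additional 3 in front makes each block directly follow a separator; the last
  separator, followed by nothing, starts no block.\<close>

definition concat_blocks :: "(nat list \<Rightarrow> nat list) \<Rightarrow> nat list \<Rightarrow> nat list" where
  "concat_blocks q l = concat_suf (\<lambda>u. if hd_blank u = 3 then if hd_blank (tl u) = 0 then []
     else q (takeWhile (\<lambda>x. x \<noteq> 3) (tl u)) else []) (3 # l)"

definition fold_blocks :: "(nat list \<Rightarrow> nat list \<Rightarrow> nat list) \<Rightarrow> nat list \<Rightarrow> nat list \<Rightarrow> nat list" where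
  "fold_blocks g l = foldsuf (\<lambda>u acc. if hd_blank u = 3 then if hd_blank (tl u) = 0 then acc
     else g (takeWhile (\<lambda>x. x \<noteq> 3) (tl u)) acc else acc) (3 # l)"

lemma PT_vor:
  assumes x: "PT V x" and y: "PT V y"
  shows "PT V (\<lambda>a. vor (x a) (y a))"
  unfolding vor_def sym_at_def
  by (intro PT_concat_suf PT_if PT_drop PT_suffix PT_Cons PT_Nil finite_loop_views
      PT_lift[OF x] PT_lift[OF y] x PT_finite[OF x]) auto

lemma PT_meets:
  assumes x: "PT V x" and y: "PT V y"
  shows "PT V (\<lambda>a. meets (x a) (y a))"
  unfolding meets_def sym_at_def
  by (intro PT_concat_suf PT_if PT_drop PT_suffix PT_Cons PT_Nil finite_loop_views
      PT_lift[OF x] PT_lift[OF y] x PT_finite[OF x]) auto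

lemma PT_vcompl:
  assumes x: "PT V x"
  shows "PT V (\<lambda>a. vcompl (x a))"
  unfolding vcompl_def
  by (intro PT_concat_suf PT_if PT_suffix PT_Cons PT_Nil finite_loop_views x PT_finite[OF x]) auto

lemma PT_concat_blocks:
  assumes l: "PT V l" and q: "\<And>h. PT (loop_views V) h \<Longrightarrow> PT (loop_views V) (\<lambda>p. q (fst p) (h p))"
  shows "PT V (\<lambda>a. concat_blocks (q a) (l a))"
  unfolding concat_blocks_def
  by (intro PT_concat_suf PT_if PT_tl PT_takeWhile q PT_suffix PT_Cons PT_Nil finite_loop_views
      l PT_finite[OF l]) auto

lemma PT_fold_blocks:
  assumes l: "PT V l" and i: "PT V init"
    and g: "\<And>h. PT (loop_views V) h \<Longrightarrow> PT (loop_views V) (\<lambda>p. g (fst p) (h p) (snd (snd p)))"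
    and len: "\<And>a y acc. length (g a y acc) \<le> length acc"
  shows "PT V (\<lambda>a. fold_blocks (g a) (l a) (init a))"
  unfolding fold_blocks_def
proof (rule PT_foldsuf[where G = "\<lambda>_. 0"])
  have fin: "finite V" by (rule PT_finite[OF l])
  show "PT V (\<lambda>a. 3 # l a)" by (rule PT_Cons[OF l]) auto
  show "PT (loop_views V) (\<lambda>p. if hd_blank (fst (snd p)) = 3 then if hd_blank (tl (fst (snd p))) = 0
      then snd (snd p) else g (fst p) (takeWhile (\<lambda>x. x \<noteq> 3) (tl (fst (snd p)))) (snd (snd p))
      else snd (snd p))"
    by (intro PT_if PT_tl PT_takeWhile g PT_suffix PT_acc fin) auto
qed (auto simp: len i poly_bounded_const)

lemma foldsuf_length:
  assumes "\<And>u acc. length (g u acc) = length acc"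
  shows "length (foldsuf g l acc) = length acc"
  by (induction l arbitrary: acc) (auto simp: assms)

lemma hd_blank_drop: "hd_blank (drop i xs) = nthb xs i"
  by (simp add: hd_blank_nthb)

lemma sym_at_drop: "i \<le> length x \<Longrightarrow> hd_blank (sym_at x (drop i x) y) = nthb y i"
  by (simp add: sym_at_def hd_blank_drop)

lemma concat_map_singleton: "concat (map (\<lambda>i. [f i]) xs) = map f xs"
  by (induction xs) auto

lemma vor_eq: "vor x y = map (\<lambda>i. if nthb x i = 2 \<or> nthb y i = 2 then 2 else 1) [0..<length x]"
proof -
  have "vor x y = concat (map (\<lambda>i. [if nthb x i = 2 \<or> nthb y i = 2 then 2 else 1]) [0..<length x])"
    unfolding vor_def concat_suf_eq
    by (intro arg_cong[where f = concat] map_cong) (auto simp: hd_blank_drop sym_at_drop)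
  then show ?thesis by (simp only: concat_map_singleton)
qed

lemma vcompl_eq: "vcompl x = map (\<lambda>i. if nthb x i = 2 then 1 else 2) [0..<length x]"
proof -
  have "vcompl x = concat (map (\<lambda>i. [if nthb x i = 2 then 1 else 2]) [0..<length x])"
    unfolding vcompl_def concat_suf_eq
    by (intro arg_cong[where f = concat] map_cong) (auto simp: hd_blank_drop)
  then show ?thesis by (simp only: concat_map_singleton)
qed

lemma hd_blank_eq_1:
  assumes "set xs \<subseteq> {1}"
  shows "hd_blank xs = 1 \<longleftrightarrow> xs \<noteq> []"
  using assms by (cases xs) (auto simp: hd_blank_def)

lemma hd_blank_concat_suf:
  assumes "\<And>u. set (q u) \<subseteq> {1}"
  shows "hd_blank (concat_suf q x) = 1 \<longleftrightarrow> (\<exists>i<length x. q (drop i x) \<noteq> [])"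
proof -
  have "set (concat_suf q x) \<subseteq> {1}" using assms unfolding concat_suf_eq by fastforce
  from hd_blank_eq_1[OF this] show ?thesis by (auto simp: concat_suf_eq)
qed

lemma meets_iff:
  "hd_blank (meets x y) = 1 \<longleftrightarrow> (\<exists>i<length x. nthb x i = 2 \<and> nthb y i = 2)"
proof -
  let ?q = "\<lambda>u. if hd_blank u = 2 then if hd_blank (sym_at x u y) = 2 then [1] else [] else []"
  have "?q (drop i x) \<noteq> [] \<longleftrightarrow> nthb x i = 2 \<and> nthb y i = 2" if "i < length x" for i
    using that by (simp add: hd_blank_drop sym_at_drop)
  moreover have "set (?q u) \<subseteq> {1}" for u by (cases "hd_blank u = 2"; cases "hd_blank (sym_at x u y) = 2") auto
  ultimately show ?thesis unfolding meets_def using hd_blank_concat_suf[of ?q x] by blast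
qed

lemma concat_suf_skip:
  assumes "3 \<notin> set w"
  shows "concat_suf (\<lambda>u. if hd_blank u = 3 then h u else []) (w @ l) =
    concat_suf (\<lambda>u. if hd_blank u = 3 then h u else []) l"
  using assms by (induction w) (auto simp: hd_blank_def)

lemma foldsuf_skip:
  assumes "3 \<notin> set w"
  shows "foldsuf (\<lambda>u acc. if hd_blank u = 3 then h u acc else acc) (w @ l) acc =
    foldsuf (\<lambda>u acc. if hd_blank u = 3 then h u acc else acc) l acc"
  using assms by (induction w) (auto simp: hd_blank_def)

definition join_blocks :: "nat list list \<Rightarrow> nat list" where
  "join_blocks ws = concat (map (\<lambda>w. w @ [3]) ws)"

lemma block_hd:
  assumes "0 \<notin> set w"
  shows "hd_blank (w @ 3 # l) \<noteq> 0"
  using assms by (cases w) (auto simp: hd_blank_def)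

lemma concat_blocks_join:
  assumes "\<And>w. w \<in> set ws \<Longrightarrow> 0 \<notin> set w \<and> 3 \<notin> set w"
  shows "concat_blocks q (join_blocks ws) = concat (map q ws)"
  using assms
proof (induction ws)
  case Nil
  then show ?case by (simp add: join_blocks_def concat_blocks_def hd_blank_def)
next
  case (Cons w ws)
  have w: "0 \<notin> set w" "3 \<notin> set w" using Cons.prems by auto
  have tw: "takeWhile (\<lambda>x. x \<noteq> 3) (w @ 3 # l) = w" for l :: "nat list"
    using w(2) by (induction w) auto
  have "concat_blocks q (w @ 3 # join_blocks ws) = q w @ concat_blocks q (join_blocks ws)"
    unfolding concat_blocks_def
    by (subst concat_suf.simps(2), subst concat_suf_skip[OF w(2)])
      (simp add: hd_blank_def[of "3 # _"] block_hd[OF w(1)] tw)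
  then show ?case using Cons by (simp add: join_blocks_def)
qed

lemma fold_blocks_join:
  assumes "\<And>w. w \<in> set ws \<Longrightarrow> 0 \<notin> set w \<and> 3 \<notin> set w"
  shows "fold_blocks g (join_blocks ws) acc = fold g ws acc"
  using assms
proof (induction ws arbitrary: acc)
  case Nil
  then show ?case by (simp add: join_blocks_def fold_blocks_def hd_blank_def)
next
  case (Cons w ws)
  have w: "0 \<notin> set w" "3 \<notin> set w" using Cons.prems by auto
  have tw: "takeWhile (\<lambda>x. x \<noteq> 3) (w @ 3 # l) = w" for l :: "nat list"
    using w(2) by (induction w) auto
  have "fold_blocks g (w @ 3 # join_blocks ws) acc = fold_blocks g (join_blocks ws) (g w acc)"
    unfolding fold_blocks_def
    by (subst foldsuf.simps(2), subst foldsuf_skip[OF w(2)])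
      (simp add: hd_blank_def[of "3 # _"] block_hd[OF w(1)] tw)
  then show ?case using Cons by (simp add: join_blocks_def)
qed

section \<open>The reduction on words\<close>

declare One_nat_def [simp del]

text \<open>For \<open>U\<close> the encoding of the empty set, an element \<open>i\<close> is passed around as the suffix
  \<open>drop i U\<close>; its unit vector is then obtained by \<open>unit_vec\<close>.\<close>

definition unit_vec :: "nat list \<Rightarrow> nat list \<Rightarrow> nat list" where
  "unit_vec U u = drop (length u) U @ 2 # tl u"

text \<open>A block \<open>y\<close> is the vector of the premise followed by that of the
  conclusion. Dropping \<open>length R\<close> letters isolates the conclusion, while
  \<open>vor R y\<close> reads only as many letters as \<open>R\<close> has, that is, the
  premise.\<close>

definition close_step :: "nat list \<Rightarrow> nat list \<Rightarrow> nat list" where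
  "close_step y R = (if hd_blank (meets R (drop (length R) y)) = 1 then vor R y else R)"

text \<open>The outer fold uses \<open>U\<close>, of length \<open>n\<close>, merely to count the
  rounds.\<close>

definition preds_vec :: "nat list \<Rightarrow> nat list \<Rightarrow> nat list \<Rightarrow> nat list" where
  "preds_vec bs U u = foldsuf (\<lambda>_ R. fold_blocks close_step bs R) U (unit_vec U u)"

definition reach_flag :: "nat list \<Rightarrow> nat list \<Rightarrow> nat list \<Rightarrow> nat list \<Rightarrow> nat list" where
  "reach_flag bs U u v = meets (unit_vec U u) (preds_vec bs U v)"

text \<open>The suffixes of \<open>tl u\<close> stand for the elements larger than the one given by
  \<open>u\<close>, so the largest element of a component is never flagged.\<close>

definition redundant_flag :: "nat list \<Rightarrow> nat list \<Rightarrow> nat list \<Rightarrow> nat list" where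
  "redundant_flag bs U u = concat_suf (\<lambda>v. if hd_blank (reach_flag bs U u v) = 1 then
     if hd_blank (reach_flag bs U v u) = 1 then [1] else [] else []) (tl u)"

definition redundant_vec :: "nat list \<Rightarrow> nat list \<Rightarrow> nat list" where
  "redundant_vec bs U = concat_suf (\<lambda>u. if hd_blank (redundant_flag bs U u) = 1 then [2] else [1]) U"

text \<open>The 1 appended to each vector says that the new element \<open>n\<close> is
  absent.\<close>

definition arcs_word :: "nat list \<Rightarrow> nat list \<Rightarrow> nat list" where
  "arcs_word bs U = concat_suf (\<lambda>u. if hd_blank (redundant_flag bs U u) = 1
     then U @ 1 # unit_vec U u @ [1, 3]
     else concat_suf (\<lambda>v. if hd_blank (reach_flag bs U u v) = 1 then
       if hd_blank (reach_flag bs U v u) = 1 then [] else unit_vec U u @ 1 # unit_vec U v @ [1, 3]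
       else []) U) U"

definition marked_word :: "nat list \<Rightarrow> nat list \<Rightarrow> nat list" where
  "marked_word bs U = concat_suf (\<lambda>u. vor (redundant_vec bs U) (vcompl (preds_vec bs U u)) @ [2, 3]) U"

text \<open>The new ground set size is \<open>1 # U\<close> in unary. In the blocks made from
  \<open>bm\<close>, \<open>U @ [2]\<close> is the unit vector of the new element, which is the
  conclusion.\<close>

definition reduce_parts :: "nat list \<Rightarrow> nat list \<Rightarrow> nat list \<Rightarrow> nat list \<Rightarrow> nat list" where
  "reduce_parts U bs bp bm =
     (1 # U) @ 4 # (arcs_word bs U @ concat_blocks (\<lambda>B. B @ 1 # U @ [2, 3]) bm) @
     4 # (marked_word bs U @ concat_blocks (\<lambda>B. vor B (redundant_vec bs U) @ [1, 3]) bp)"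

definition before4 :: "nat list \<Rightarrow> nat list" where
  "before4 w = takeWhile (\<lambda>x. x \<noteq> 4) w"

definition after4 :: "nat list \<Rightarrow> nat list" where
  "after4 w = tl (dropWhile (\<lambda>x. x \<noteq> 4) w)"

definition reduce :: "nat list \<Rightarrow> nat list" where
  "reduce w = reduce_parts (before4 w) (before4 (after4 w)) (before4 (after4 (after4 w)))
     (after4 (after4 (after4 w)))"

lemma length_vor [simp]: "length (vor x y) = length x"
  by (simp add: vor_eq)

lemma length_close_step [simp]: "length (close_step y R) = length R"
  by (simp add: close_step_def)

lemma length_fold_blocks:
  assumes "\<And>y R. length (g y R) = length R"
  shows "length (fold_blocks g l R) = length R"
  unfolding fold_blocks_def by (rule foldsuf_length) (simp add: assms)

lemma PT_unit_vec: "PT V U \<Longrightarrow> PT V u \<Longrightarrow> PT V (\<lambda>a. unit_vec (U a) (u a))"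
  unfolding unit_vec_def by (intro PT_append PT_drop PT_Cons PT_tl) auto

lemma PT_close_step: "PT V y \<Longrightarrow> PT V R \<Longrightarrow> PT V (\<lambda>a. close_step (y a) (R a))"
  unfolding close_step_def by (intro PT_if PT_meets PT_drop PT_vor)

lemma PT_preds_vec:
  assumes bs: "PT V bs" and U: "PT V U" and u: "PT V u"
  shows "PT V (\<lambda>a. preds_vec (bs a) (U a) (u a))"
  unfolding preds_vec_def
proof (rule PT_foldsuf[OF U, where G = "\<lambda>_. 0"])
  have fin: "finite V" by (rule PT_finite[OF bs])
  show "PT V (\<lambda>a. unit_vec (U a) (u a))" by (intro PT_unit_vec U u)
  show "PT (loop_views V) (\<lambda>p. fold_blocks close_step (bs (fst p)) (snd (snd p)))"
  proof (rule PT_fold_blocks[OF PT_lift[OF bs] PT_acc[OF fin]])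
    fix h assume "PT (loop_views (loop_views V)) h"
    then show "PT (loop_views (loop_views V)) (\<lambda>p. close_step (h p) (snd (snd p)))"
      by (intro PT_close_step PT_acc finite_loop_views fin)
  qed simp
qed (simp_all add: poly_bounded_const length_fold_blocks)

lemma PT_reach_flag:
  assumes "PT V bs" "PT V U" "PT V u" "PT V v"
  shows "PT V (\<lambda>a. reach_flag (bs a) (U a) (u a) (v a))"
  unfolding reach_flag_def by (intro PT_meets PT_unit_vec PT_preds_vec assms)

lemma PT_redundant_flag:
  assumes bs: "PT V bs" and U: "PT V U" and u: "PT V u"
  shows "PT V (\<lambda>a. redundant_flag (bs a) (U a) (u a))"
  unfolding redundant_flag_def
  by (intro PT_concat_suf PT_if PT_reach_flag PT_Cons PT_Nil PT_tl PT_suffix u finite_loop_views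
      PT_finite[OF bs] PT_lift[OF bs] PT_lift[OF U] PT_lift[OF u]) auto

lemma PT_redundant_vec:
  assumes bs: "PT V bs" and U: "PT V U"
  shows "PT V (\<lambda>a. redundant_vec (bs a) (U a))"
  unfolding redundant_vec_def
  by (intro PT_concat_suf PT_if PT_redundant_flag PT_Cons PT_Nil PT_suffix U finite_loop_views
      PT_finite[OF bs] PT_lift[OF bs] PT_lift[OF U]) auto

lemma PT_arcs_word:
  assumes bs: "PT V bs" and U: "PT V U"
  shows "PT V (\<lambda>a. arcs_word (bs a) (U a))"
proof -
  have fin: "finite V" by (rule PT_finite[OF bs])
  note lifted = PT_lift[OF bs] PT_lift[OF U] PT_suffix[OF fin]
  show ?thesis
    unfolding arcs_word_def
    by (intro PT_concat_suf PT_if PT_redundant_flag PT_reach_flag PT_append PT_unit_vec PT_Cons PT_Nil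
        PT_suffix U finite_loop_views fin lifted lifted[THEN PT_lift]) auto
qed

lemma PT_marked_word:
  assumes bs: "PT V bs" and U: "PT V U"
  shows "PT V (\<lambda>a. marked_word (bs a) (U a))"
  unfolding marked_word_def
  by (intro PT_concat_suf PT_append PT_vor PT_vcompl PT_redundant_vec PT_preds_vec PT_Cons PT_Nil
      PT_suffix U finite_loop_views PT_finite[OF bs] PT_lift[OF bs] PT_lift[OF U]) auto

lemma PT_reduce_parts:
  assumes U: "PT V U" and bs: "PT V bs" and bp: "PT V bp" and bm: "PT V bm"
  shows "PT V (\<lambda>a. reduce_parts (U a) (bs a) (bp a) (bm a))"
  unfolding reduce_parts_def
  by (intro PT_append PT_Cons PT_Nil PT_arcs_word PT_marked_word PT_concat_blocks PT_vor
      PT_redundant_vec assms finite_loop_views PT_finite[OF U] PT_lift[OF U] PT_lift[OF bs]) auto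

lemma PT_reduce: "PT {\<lambda>w. w} reduce"
proof -
  have w: "PT {\<lambda>w. w} (\<lambda>w. w)" by (rule PT_var) auto
  have b: "PT V f \<Longrightarrow> PT V (\<lambda>a. before4 (f a))" for V and f :: "nat list \<Rightarrow> nat list"
    unfolding before4_def by (rule PT_takeWhile) auto
  have a: "PT V f \<Longrightarrow> PT V (\<lambda>a. after4 (f a))" for V and f :: "nat list \<Rightarrow> nat list"
    unfolding after4_def by (intro PT_tl PT_dropWhile) auto
  have "PT {\<lambda>w. w} (\<lambda>w. reduce w)"
    unfolding reduce_def by (intro PT_reduce_parts a b w)
  then show ?thesis .
qed

section \<open>The reduction on sets\<close>

definition pass :: "impl list \<Rightarrow> nat set \<Rightarrow> nat set" where
  "pass \<Sigma> = fold (\<lambda>(A, b) R. if b \<in> R then R \<union> A else R) \<Sigma>"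

text \<open>\<open>preds n \<Sigma> x\<close> is the set of elements from which \<open>x\<close> is reachable in the implication graph;
  \<open>redundant n \<Sigma>\<close> contains all but the largest element of each strongly connected component.\<close>

definition preds :: "nat \<Rightarrow> impl list \<Rightarrow> nat \<Rightarrow> nat set" where
  "preds n \<Sigma> x = (pass \<Sigma> ^^ n) {x}"

definition redundant :: "nat \<Rightarrow> impl list \<Rightarrow> nat set" where
  "redundant n \<Sigma> = {i. i < n \<and> (\<exists>j. i < j \<and> j < n \<and> i \<in> preds n \<Sigma> j \<and> j \<in> preds n \<Sigma> i)}"

text \<open>All strictly reachable pairs are listed and not just the original arcs, because a path
  may lead through redundant elements, which no longer occur in any premise of these
  implications.\<close>

definition arcs :: "nat \<Rightarrow> impl list \<Rightarrow> impl list" where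
  "arcs n \<Sigma> = concat (map (\<lambda>i. if i \<in> redundant n \<Sigma> then [({}, i)] else
     concat (map (\<lambda>j. if i \<in> preds n \<Sigma> j \<and> j \<notin> preds n \<Sigma> i then [({i}, j)] else []) [0..<n])) [0..<n])"

definition red_base :: "nat \<Rightarrow> impl list \<Rightarrow> nat set list \<Rightarrow> impl list" where
  "red_base n \<Sigma> Bm = arcs n \<Sigma> @ map (\<lambda>B. (B, n)) Bm"

definition red_sets :: "nat \<Rightarrow> impl list \<Rightarrow> nat set list \<Rightarrow> nat set list" where
  "red_sets n \<Sigma> Bp = map (\<lambda>i. insert n (redundant n \<Sigma> \<union> ({0..<n} - preds n \<Sigma> i))) [0..<n] @
     map (\<lambda>B. B \<union> redundant n \<Sigma>) Bp"

section \<open>Word functions on characteristic vectors as set operations\<close>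

lemma enc_set_basic [simp]:
  "length (enc_set n S) = n"
  "nthb (enc_set n S) i = (if i < n then if i \<in> S then 2 else 1 else 0)"
  by (auto simp: enc_set_def nthb_def)

lemma enc_set_cong: "(\<And>i. i < n \<Longrightarrow> i \<in> S \<longleftrightarrow> i \<in> T) \<Longrightarrow> enc_set n S = enc_set n T"
  by (simp add: enc_set_def)

lemma set_enc_set: "set (enc_set n S) \<subseteq> {1, 2}"
  by (auto simp: enc_set_def)

lemma nthb_append: "nthb (xs @ ys) i = (if i < length xs then nthb xs i else nthb ys (i - length xs))"
  by (auto simp: nthb_def nth_append)

lemma vor_enc_set: "vor (enc_set n S) y = enc_set n {i. i \<in> S \<or> nthb y i = 2}"
  unfolding vor_eq enc_set_def[of n "{i. i \<in> S \<or> nthb y i = 2}"] by auto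

lemma vcompl_enc_set: "vcompl (enc_set n S) = enc_set n ({0..<n} - S)"
  unfolding vcompl_eq enc_set_def[of n "{0..<n} - S"] by auto

lemma meets_enc_set:
  "hd_blank (meets (enc_set n S) (enc_set n T)) = 1 \<longleftrightarrow> (\<exists>i<n. i \<in> S \<and> i \<in> T)"
  unfolding meets_iff by (auto split: if_splits)

lemma enc_set_empty: "enc_set n {} = replicate n 1"
  by (simp add: enc_set_def map_replicate_const)

text \<open>The prefix \<open>drop (length u) U\<close> consists of \<open>i\<close> ones, as
  \<open>U\<close> is constant; thus the 2 lands in position \<open>i\<close>.\<close>

lemma unit_vec_enc:
  assumes "i < n"
  shows "unit_vec (enc_set n {}) (drop i (enc_set n {})) = enc_set n {i}"
proof (rule nth_equalityI)
  show "length (unit_vec (enc_set n {}) (drop i (enc_set n {}))) = length (enc_set n {i})"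
    using assms by (simp add: unit_vec_def)
  fix k assume "k < length (unit_vec (enc_set n {}) (drop i (enc_set n {})))"
  then have "k < n" using assms by (simp add: unit_vec_def)
  then show "unit_vec (enc_set n {}) (drop i (enc_set n {})) ! k = enc_set n {i} ! k"
    using assms unfolding unit_vec_def enc_set_empty
    by (auto simp: enc_set_def nth_append nth_Cons nth_tl split: nat.splits)
qed

definition enc_impl :: "nat \<Rightarrow> impl \<Rightarrow> nat list" where
  "enc_impl n e = enc_set n (fst e) @ enc_set n {snd e}"

lemma enc_base_join: "enc_base n \<Sigma> = join_blocks (map (enc_impl n) \<Sigma>)"
  by (induction \<Sigma>) (auto simp: enc_base_def join_blocks_def enc_impl_def)

lemma enc_sets_join: "enc_sets n Ss = join_blocks (map (enc_set n) Ss)"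
  by (simp add: enc_sets_def join_blocks_def comp_def)

lemma close_step_enc:
  assumes "b < n"
  shows "close_step (enc_impl n (A, b)) (enc_set n R) = enc_set n (if b \<in> R then R \<union> A else R)"
proof -
  have "hd_blank (meets (enc_set n R) (enc_set n {b})) = 1 \<longleftrightarrow> b \<in> R"
    unfolding meets_enc_set using assms by auto
  moreover have "vor (enc_set n R) (enc_impl n (A, b)) = enc_set n (R \<union> A)"
    unfolding vor_enc_set by (rule enc_set_cong) (auto simp: enc_impl_def nthb_append)
  ultimately show ?thesis by (simp add: close_step_def enc_impl_def)
qed

lemma fold_blocks_enc:
  assumes "\<And>A b. (A, b) \<in> set \<Sigma> \<Longrightarrow> b < n"
  shows "fold_blocks close_step (enc_base n \<Sigma>) (enc_set n R) = enc_set n (pass \<Sigma> R)"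
proof -
  have "fold_blocks close_step (enc_base n \<Sigma>) (enc_set n R)
      = fold close_step (map (enc_impl n) \<Sigma>) (enc_set n R)"
    unfolding enc_base_join
    by (rule fold_blocks_join) (use set_enc_set[of n] in \<open>fastforce simp: enc_impl_def\<close>)
  also have "\<dots> = enc_set n (pass \<Sigma> R)"
    using assms
  proof (induction \<Sigma> arbitrary: R)
    case (Cons e \<Sigma>)
    obtain A b where e: "e = (A, b)" by (cases e)
    have "b < n" using Cons.prems[of A b] by (simp add: e)
    moreover have "fold close_step (map (enc_impl n) \<Sigma>) (enc_set n R') = enc_set n (pass \<Sigma> R')" for R'
      by (rule Cons.IH) (use Cons.prems in auto)
    ultimately show ?case by (simp add: e pass_def close_step_enc)
  qed (simp add: pass_def)
  finally show ?thesis .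
qed

lemma preds_vec_enc:
  assumes "\<And>A b. (A, b) \<in> set \<Sigma> \<Longrightarrow> b < n" "i < n"
  shows "preds_vec (enc_base n \<Sigma>) (enc_set n {}) (drop i (enc_set n {})) = enc_set n (preds n \<Sigma> i)"
proof -
  have "foldsuf (\<lambda>_ R. fold_blocks close_step (enc_base n \<Sigma>) R) xs (enc_set n R)
      = enc_set n ((pass \<Sigma> ^^ length xs) R)" for xs R
    by (induction xs arbitrary: R) (auto simp: fold_blocks_enc[OF assms(1)] funpow_swap1)
  then show ?thesis unfolding preds_vec_def unit_vec_enc[OF assms(2)] by (simp add: preds_def)
qed

lemma reach_flag_enc:
  assumes "\<And>A b. (A, b) \<in> set \<Sigma> \<Longrightarrow> b < n" "i < n" "j < n"
  shows "hd_blank (reach_flag (enc_base n \<Sigma>) (enc_set n {}) (drop i (enc_set n {}))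
      (drop j (enc_set n {}))) = 1 \<longleftrightarrow> i \<in> preds n \<Sigma> j"
proof -
  have "preds_vec (enc_base n \<Sigma>) (enc_set n {}) (drop j (enc_set n {})) = enc_set n (preds n \<Sigma> j)"
    by (rule preds_vec_enc) (use assms in auto)
  then show ?thesis
    unfolding reach_flag_def unit_vec_enc[OF assms(2)] using assms(2) by (simp add: meets_enc_set)
qed

lemma redundant_flag_enc:
  assumes \<Sigma>: "\<And>A b. (A, b) \<in> set \<Sigma> \<Longrightarrow> b < n" and i: "i < n"
  shows "hd_blank (redundant_flag (enc_base n \<Sigma>) (enc_set n {}) (drop i (enc_set n {}))) = 1
    \<longleftrightarrow> i \<in> redundant n \<Sigma>"
proof -
  let ?U = "enc_set n {}"
  let ?r = "\<lambda>u v. hd_blank (reach_flag (enc_base n \<Sigma>) ?U u v) = 1"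
  let ?q = "\<lambda>v. if ?r (drop i ?U) v then if ?r v (drop i ?U) then [1 :: nat] else [] else []"
  have tl: "tl (drop i ?U) = drop (Suc i) ?U" by (simp add: drop_Suc tl_drop)
  have "set (?q v) \<subseteq> {1}" for v by (cases "?r (drop i ?U) v"; cases "?r v (drop i ?U)") auto
  \<comment> \<open>Dropping \<open>k\<close> letters of the tail gives the suffix that encodes
    element \<open>Suc i + k\<close>.\<close>
  from hd_blank_concat_suf[where q = ?q, OF this]
  have "hd_blank (redundant_flag (enc_base n \<Sigma>) ?U (drop i ?U)) = 1
      \<longleftrightarrow> (\<exists>k < n - Suc i. ?q (drop (Suc i + k) ?U) \<noteq> [])"
    unfolding redundant_flag_def tl by (simp add: add.commute)
  also have "\<dots> \<longleftrightarrow> (\<exists>k < n - Suc i. i \<in> preds n \<Sigma> (Suc i + k) \<and> Suc i + k \<in> preds n \<Sigma> i)"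
  proof -
    have "?q (drop (Suc i + k) ?U) \<noteq> [] \<longleftrightarrow> i \<in> preds n \<Sigma> (Suc i + k) \<and> Suc i + k \<in> preds n \<Sigma> i"
      if "k < n - Suc i" for k
    proof -
      have k: "Suc i + k < n" using that by simp
      show ?thesis using reach_flag_enc[OF \<Sigma> i k] reach_flag_enc[OF \<Sigma> k i] by simp
    qed
    then show ?thesis by blast
  qed
  also have "\<dots> \<longleftrightarrow> i \<in> redundant n \<Sigma>"
  proof
    assume "i \<in> redundant n \<Sigma>"
    then obtain j where "i < j" "j < n" "i \<in> preds n \<Sigma> j" "j \<in> preds n \<Sigma> i"
      by (auto simp: redundant_def)
    then show "\<exists>k < n - Suc i. i \<in> preds n \<Sigma> (Suc i + k) \<and> Suc i + k \<in> preds n \<Sigma> i"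
      by (intro exI[of _ "j - Suc i"]) auto
  next
    assume "\<exists>k < n - Suc i. i \<in> preds n \<Sigma> (Suc i + k) \<and> Suc i + k \<in> preds n \<Sigma> i"
    then obtain k where "k < n - Suc i" "i \<in> preds n \<Sigma> (Suc i + k)" "Suc i + k \<in> preds n \<Sigma> i"
      by blast
    then show "i \<in> redundant n \<Sigma>"
      unfolding redundant_def using i by (intro CollectI conjI exI[of _ "Suc i + k"]) auto
  qed
  finally show ?thesis .
qed

lemma redundant_vec_enc:
  assumes "\<And>A b. (A, b) \<in> set \<Sigma> \<Longrightarrow> b < n"
  shows "redundant_vec (enc_base n \<Sigma>) (enc_set n {}) = enc_set n (redundant n \<Sigma>)"
proof -
  have "redundant_vec (enc_base n \<Sigma>) (enc_set n {}) =
      concat (map (\<lambda>i. [if i \<in> redundant n \<Sigma> then 2 else 1]) [0..<n])"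
    unfolding redundant_vec_def concat_suf_eq
    by (intro arg_cong[where f = concat] map_cong) (simp_all add: redundant_flag_enc[OF assms])
  then show ?thesis unfolding concat_map_singleton enc_set_def .
qed

lemma enc_set_Suc: "enc_set (Suc n) S = enc_set n S @ [if n \<in> S then 2 else 1]"
  by (simp add: enc_set_def)

lemma enc_base_simps:
  "enc_base n [] = []"
  "enc_base n ((A, b) # \<Sigma>) = enc_set n A @ enc_set n {b} @ 3 # enc_base n \<Sigma>"
  "enc_base n (\<Sigma>1 @ \<Sigma>2) = enc_base n \<Sigma>1 @ enc_base n \<Sigma>2"
  by (auto simp: enc_base_def)

lemma enc_base_concat: "enc_base n (concat Ls) = concat (map (enc_base n) Ls)"
  by (induction Ls) (auto simp: enc_base_simps)

lemma arcs_word_enc: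
  assumes \<Sigma>: "\<And>A b. (A, b) \<in> set \<Sigma> \<Longrightarrow> b < n"
  shows "arcs_word (enc_base n \<Sigma>) (enc_set n {}) = enc_base (Suc n) (arcs n \<Sigma>)"
  unfolding arcs_word_def arcs_def concat_suf_eq enc_base_concat map_map
proof (intro arg_cong[where f = concat] map_cong, goal_cases)
  case (2 i)
  then have i: "i < n" by simp
  show ?case
  proof (cases "i \<in> redundant n \<Sigma>")
    case True
    then show ?thesis using i redundant_flag_enc[OF \<Sigma> i]
      by (simp add: unit_vec_enc enc_base_simps enc_set_Suc)
  next
    case False
    have "concat (map (\<lambda>j. if hd_blank (reach_flag (enc_base n \<Sigma>) (enc_set n {}) (drop i (enc_set n {}))
          (drop j (enc_set n {}))) = 1 then
        if hd_blank (reach_flag (enc_base n \<Sigma>) (enc_set n {}) (drop j (enc_set n {})) (drop i (enc_set n {}))) = 1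
        then [] else unit_vec (enc_set n {}) (drop i (enc_set n {})) @ 1 #
          unit_vec (enc_set n {}) (drop j (enc_set n {})) @ [1, 3] else []) [0..<n])
      = enc_base (Suc n) (concat (map (\<lambda>j. if i \<in> preds n \<Sigma> j \<and> j \<notin> preds n \<Sigma> i then [({i}, j)] else []) [0..<n]))"
      unfolding enc_base_concat map_map
      by (intro arg_cong[where f = concat] map_cong)
        (use i in \<open>auto simp: reach_flag_enc[OF \<Sigma>] unit_vec_enc enc_base_simps enc_set_Suc\<close>)
    then show ?thesis using False redundant_flag_enc[OF \<Sigma> i] by simp
  qed
qed simp

lemma marked_word_enc:
  assumes \<Sigma>: "\<And>A b. (A, b) \<in> set \<Sigma> \<Longrightarrow> b < n"
  shows "marked_word (enc_base n \<Sigma>) (enc_set n {}) = enc_sets (Suc n)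
    (map (\<lambda>i. insert n (redundant n \<Sigma> \<union> ({0..<n} - preds n \<Sigma> i))) [0..<n])"
  unfolding marked_word_def concat_suf_eq enc_sets_def map_map
proof (intro arg_cong[where f = concat] map_cong, goal_cases)
  case (2 i)
  then have i: "i < n" by simp
  have "vor (enc_set n (redundant n \<Sigma>)) (vcompl (enc_set n (preds n \<Sigma> i))) =
      enc_set n (insert n (redundant n \<Sigma> \<union> ({0..<n} - preds n \<Sigma> i)))"
    unfolding vcompl_enc_set vor_enc_set by (rule enc_set_cong) auto
  then show ?case using i by (simp add: redundant_vec_enc[OF \<Sigma>] preds_vec_enc[OF \<Sigma>] enc_set_Suc)
qed simp

lemma concat_blocks_sets:
  "concat_blocks q (enc_sets n Bs) = concat (map (\<lambda>B. q (enc_set n B)) Bs)"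
proof -
  have "concat_blocks q (enc_sets n Bs) = concat (map q (map (enc_set n) Bs))"
    unfolding enc_sets_join
    by (rule concat_blocks_join) (use set_enc_set[of n] in fastforce)
  then show ?thesis by (simp add: comp_def)
qed

text \<open>Symbol 4 does not occur inside a section, so the input splits correctly. The members of
  both antichains avoid \<open>n\<close>, which justifies the bit 1 appended to them.\<close>

lemma reduce_enc:
  assumes "dual_instance n \<Sigma> Bp Bm"
  shows "reduce (enc_dual n \<Sigma> Bp Bm) = enc_cmi (Suc n) (red_base n \<Sigma> Bm) (red_sets n \<Sigma> Bp)"
proof -
  have \<Sigma>: "\<And>A b. (A, b) \<in> set \<Sigma> \<Longrightarrow> b < n"
    using assms by (auto simp: dual_instance_def wf_base_def)
  have B: "B \<in> set Bp \<or> B \<in> set Bm \<Longrightarrow> n \<notin> B" for B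
    using assms by (fastforce simp: dual_instance_def is_antichain_of_def closed_sets_def)
  have no4: "4 \<notin> set (enc_set n S)" for S using set_enc_set[of n S] by fastforce
  then have no4': "4 \<notin> set (enc_base n \<Sigma>)" "4 \<notin> set (enc_sets n Bs)" for Bs
    by (auto simp: enc_base_def enc_sets_def)
  have split4: "before4 (xs @ 4 # ys) = xs" "after4 (xs @ 4 # ys) = ys" if "4 \<notin> set xs" for xs ys
    using that by (induction xs) (auto simp: before4_def after4_def)
  have "concat_blocks (\<lambda>B. B @ 1 # enc_set n {} @ [2, 3]) (enc_sets n Bm) =
      enc_base (Suc n) (map (\<lambda>B. (B, n)) Bm)"
    unfolding concat_blocks_sets enc_base_def map_map
    using B enc_set_cong[of n "{n}" "{}"]
    by (intro arg_cong[where f = concat] map_cong) (auto simp: enc_set_Suc)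
  moreover have "concat_blocks (\<lambda>B. vor B (redundant_vec (enc_base n \<Sigma>) (enc_set n {})) @ [1, 3]) (enc_sets n Bp) =
      enc_sets (Suc n) (map (\<lambda>B. B \<union> redundant n \<Sigma>) Bp)"
    unfolding concat_blocks_sets enc_sets_def[of "Suc n"] map_map vor_enc_set
  proof (intro arg_cong[where f = concat] map_cong, goal_cases)
    case (2 B)
    have "enc_set n {i. i \<in> B \<or> nthb (enc_set n (redundant n \<Sigma>)) i = 2} = enc_set n (B \<union> redundant n \<Sigma>)"
      by (rule enc_set_cong) auto
    moreover have "n \<notin> redundant n \<Sigma>" by (simp add: redundant_def)
    ultimately show ?case using B[of B] 2
      by (simp add: enc_set_Suc redundant_vec_enc[OF \<Sigma>] del: enc_set_basic(2))
  qed simp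
  moreover have "replicate (Suc n) 1 = 1 # enc_set n {}" by (simp add: enc_set_empty)
  moreover have "enc_sets (Suc n) (Ss @ Ts) = enc_sets (Suc n) Ss @ enc_sets (Suc n) Ts" for Ss Ts
    by (simp add: enc_sets_def)
  ultimately have "reduce_parts (enc_set n {}) (enc_base n \<Sigma>) (enc_sets n Bp) (enc_sets n Bm) =
      enc_cmi (Suc n) (red_base n \<Sigma> Bm) (red_sets n \<Sigma> Bp)"
    unfolding reduce_parts_def enc_cmi_def red_base_def red_sets_def
    by (simp add: arcs_word_enc[OF \<Sigma>] marked_word_enc[OF \<Sigma>] enc_base_simps del: replicate_Suc)
  moreover have "enc_dual n \<Sigma> Bp Bm =
      enc_set n {} @ 4 # enc_base n \<Sigma> @ 4 # enc_sets n Bp @ 4 # enc_sets n Bm"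
    by (simp add: enc_dual_def enc_set_empty)
  ultimately show ?thesis unfolding reduce_def by (simp add: split4 no4 no4')
qed

lemma valid_enc_dual: "valid (enc_dual n \<Sigma> Bp Bm)"
proof -
  have enc: "valid (enc_set n S)" for S using set_enc_set[of n S] by (fastforce simp: valid_def)
  have "valid (enc_base n \<Sigma>)"
    by (induction \<Sigma>) (auto simp: enc_base_def enc)
  moreover have "valid (enc_sets n Bs)" for Bs
    by (induction Bs) (auto simp: enc_sets_def enc)
  moreover have "valid (replicate n 1)" by (auto simp: valid_def)
  ultimately show ?thesis by (simp add: enc_dual_def)
qed

section \<open>Correctness of the reduction\<close>

lemma pass_simps [simp]:
  "pass [] R = R" "pass ((A, b) # \<Sigma>) R = pass \<Sigma> (if b \<in> R then R \<union> A else R)"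
  by (auto simp: pass_def)

lemma pass_increasing: "R \<subseteq> pass \<Sigma> R"
proof (induction \<Sigma> arbitrary: R)
  case (Cons e \<Sigma>)
  obtain A b where e: "e = (A, b)" by (cases e)
  show ?case using Cons.IH[of "if b \<in> R then R \<union> A else R"] by (auto simp: e split: if_splits)
qed simp

text \<open>Each implication can only enlarge the set, so a sweep without net effect changes nothing
  at any implication in between.\<close>

lemma pass_fixed:
  assumes "pass \<Sigma> R = R" "(A, b) \<in> set \<Sigma>" "b \<in> R"
  shows "A \<subseteq> R"
  using assms(1,2)
proof (induction \<Sigma>)
  case (Cons e \<Sigma>)
  obtain A' b' where e: "e = (A', b')" by (cases e)
  define R' where "R' = (if b' \<in> R then R \<union> A' else R)"
  have "R' \<subseteq> R" using pass_increasing[of R' \<Sigma>] Cons.prems(1) by (simp add: e R'_def)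
  then have "R' = R" by (auto simp: R'_def split: if_splits)
  then show ?case using Cons \<open>b \<in> R\<close> by (auto simp: e R'_def split: if_splits)
qed simp

text \<open>Serves as the induction principle for reachability: the iterates stay inside every
  backward closed set that contains the start.\<close>

lemma pass_power_subset:
  assumes "\<And>A b. (A, b) \<in> set \<Sigma> \<Longrightarrow> b \<in> T \<Longrightarrow> A \<subseteq> T" "R \<subseteq> T"
  shows "(pass \<Sigma> ^^ k) R \<subseteq> T"
proof -
  have "pass \<Sigma> R \<subseteq> T" if "R \<subseteq> T" for R
    using assms(1) that
  proof (induction \<Sigma> arbitrary: R)
    case (Cons e \<Sigma>)
    obtain A b where e: "e = (A, b)" by (cases e)
    have "(if b \<in> R then R \<union> A else R) \<subseteq> T" using Cons.prems(1)[of A b] Cons.prems(2) by (auto simp: e)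
    moreover have "\<And>A b. (A, b) \<in> set \<Sigma> \<Longrightarrow> b \<in> T \<Longrightarrow> A \<subseteq> T"
      using Cons.prems(1) by (meson list.set_intros(2))
    ultimately show ?case using Cons.IH by (simp add: e)
  qed simp
  then show ?thesis by (induction k) (auto simp: assms(2))
qed

text \<open>Until the sweeps stabilise each of them adds an element, starting from a
  singleton.\<close>

lemma pass_power_card:
  assumes "\<And>k. finite ((pass \<Sigma> ^^ k) {x})"
  shows "pass \<Sigma> ((pass \<Sigma> ^^ k) {x}) = (pass \<Sigma> ^^ k) {x} \<or> Suc k \<le> card ((pass \<Sigma> ^^ k) {x})"
proof (induction k)
  case (Suc k)
  show ?case
  proof (cases "pass \<Sigma> ((pass \<Sigma> ^^ k) {x}) = (pass \<Sigma> ^^ k) {x}")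
    case False
    then have "(pass \<Sigma> ^^ k) {x} \<subset> (pass \<Sigma> ^^ Suc k) {x}" using pass_increasing by auto
    then have "card ((pass \<Sigma> ^^ k) {x}) < card ((pass \<Sigma> ^^ Suc k) {x})"
      using assms[of "Suc k"] by (rule psubset_card_mono[rotated])
    then show ?thesis using Suc.IH False by simp
  qed simp
qed simp

lemma is_closed_append: "is_closed (\<Sigma>1 @ \<Sigma>2) S \<longleftrightarrow> is_closed \<Sigma>1 S \<and> is_closed \<Sigma>2 S"
  by (auto simp: is_closed_def)

lemma closed_sets_Int:
  "C \<in> closed_sets n \<Sigma> \<Longrightarrow> D \<in> closed_sets n \<Sigma> \<Longrightarrow> C \<inter> D \<in> closed_sets n \<Sigma>"
  by (auto simp: closed_sets_def is_closed_def)

lemma finite_closed_sets: "finite (closed_sets n \<Sigma>)"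
  by (rule finite_subset[of _ "Pow {0..<n}"]) (auto simp: closed_sets_def)

lemma closed_sets_D: "C \<in> closed_sets n \<Sigma> \<Longrightarrow> x \<in> C \<Longrightarrow> x < n"
  by (auto simp: closed_sets_def)

lemma meet_irreducible_D:
  "M \<in> meet_irreducibles n \<Sigma> \<Longrightarrow> C \<in> closed_sets n \<Sigma> \<Longrightarrow> D \<in> closed_sets n \<Sigma> \<Longrightarrow>
    M = C \<inter> D \<Longrightarrow> C = M \<or> D = M"
  unfolding meet_irreducibles_def by blast

text \<open>The definition speaks of two sets; induction over a finite nonempty family extends it,
  since the partial intersections remain closed.\<close>

lemma meet_irreducible_Inter:
  assumes "finite F" "F \<noteq> {}" "F \<subseteq> closed_sets n \<Sigma>" "M = \<Inter>F" "M \<in> meet_irreducibles n \<Sigma>"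
  shows "M \<in> F"
  using assms
proof (induction rule: finite_ne_induct)
  case (insert C F)
  define D where "D = \<Inter>F"
  have "D \<in> closed_sets n \<Sigma>"
    using insert.hyps(1,2) insert.prems(1) unfolding D_def
    by (induction rule: finite_ne_induct) (auto intro: closed_sets_Int)
  moreover have "C \<in> closed_sets n \<Sigma>" using insert.prems(1) by simp
  moreover have "M = C \<inter> D" using insert.prems(2) by (simp add: D_def)
  ultimately have "C = M \<or> D = M"
    using meet_irreducible_D[OF insert.prems(3)] by simp
  then show ?case
  proof
    assume "D = M"
    then have "M \<in> F"
      using insert.IH insert.prems by (simp add: D_def)
    then show ?thesis by simp
  qed simp
qed simp

section \<open>Reachability and closed sets for premises of size one\<close>

locale unit_base =
  fixes n :: nat and \<Sigma> :: "impl list"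
  assumes wf: "wf_base n \<Sigma>" and unit: "unit_premises \<Sigma>"
begin

abbreviation P :: "nat \<Rightarrow> nat set" where "P \<equiv> preds n \<Sigma>"
abbreviation N :: "nat set" where "N \<equiv> redundant n \<Sigma>"
abbreviation CL :: "nat set set" where "CL \<equiv> closed_sets n \<Sigma>"

lemma implD:
  assumes "(A, b) \<in> set \<Sigma>"
  shows "b < n" "A \<subseteq> {0..<n}" "\<exists>a. A = {a}"
proof -
  show "b < n" "A \<subseteq> {0..<n}" using assms wf by (auto simp: wf_base_def)
  have "card A = 1" using assms unit by (auto simp: unit_premises_def)
  then show "\<exists>a. A = {a}" by (auto elim: card_1_singletonE)
qed

lemma P_subset_closed:
  "(\<And>A b. (A, b) \<in> set \<Sigma> \<Longrightarrow> b \<in> T \<Longrightarrow> A \<subseteq> T) \<Longrightarrow> x \<in> T \<Longrightarrow> P x \<subseteq> T"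
  unfolding preds_def by (rule pass_power_subset) auto

lemma P_refl: "x \<in> P x"
proof -
  have "x \<in> (pass \<Sigma> ^^ k) {x}" for k
    by (induction k) (use pass_increasing in auto)
  then show ?thesis by (simp add: preds_def)
qed

lemma P_less:
  assumes "x < n" "y \<in> P x"
  shows "y < n"
proof -
  have "P x \<subseteq> {0..<n}" by (rule P_subset_closed) (use implD assms in auto)
  then show ?thesis using assms(2) by auto
qed

text \<open>Without stabilisation after \<open>n\<close> sweeps \<open>P x\<close> would have more
  than \<open>n\<close> elements, although it lies in the ground set.\<close>

lemma P_backward:
  assumes "x < n" "(A, b) \<in> set \<Sigma>" "b \<in> P x"
  shows "A \<subseteq> P x"
proof (rule pass_fixed[OF _ assms(2,3)])
  have sub: "(pass \<Sigma> ^^ k) {x} \<subseteq> {0..<n}" for k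
    by (rule pass_power_subset) (use implD assms in auto)
  have "pass \<Sigma> (P x) = P x \<or> Suc n \<le> card (P x)"
    unfolding preds_def by (rule pass_power_card) (rule finite_subset[OF sub], simp)
  moreover have "card (P x) \<le> n"
    using card_mono[OF _ sub[of n]] by (simp add: preds_def)
  ultimately show "pass \<Sigma> (P x) = P x" by simp
qed

lemma P_trans: "x < n \<Longrightarrow> y \<in> P x \<Longrightarrow> z \<in> P y \<Longrightarrow> z \<in> P x"
  using P_subset_closed[of "P x" y] P_backward by blast

text \<open>As premises are singletons, the complement of a closed set is closed under backward
  steps and contains \<open>P x\<close> along with \<open>x\<close>. Together with
  \<open>closed_I\<close> this identifies the closed sets with the up-sets of reachability.\<close>

lemma closed_up:
  assumes "C \<in> CL" "y \<in> C" "y \<in> P x"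
  shows "x \<in> C"
proof (rule ccontr)
  assume "x \<notin> C"
  then have "P x \<subseteq> - C"
    by (intro P_subset_closed) (use assms(1) implD in \<open>fastforce simp: closed_sets_def is_closed_def\<close>)+
  then show False using assms by auto
qed

lemma closed_I:
  assumes "C \<subseteq> {0..<n}" "\<And>x y. x < n \<Longrightarrow> y \<in> C \<Longrightarrow> y \<in> P x \<Longrightarrow> x \<in> C"
  shows "C \<in> CL"
  unfolding closed_sets_def is_closed_def
proof (intro CollectI conjI assms(1) ballI, clarify)
  fix A b assume ab: "(A, b) \<in> set \<Sigma>" "b \<notin> C" "A \<subseteq> C"
  obtain a where a: "A = {a}" using implD(3)[OF ab(1)] by blast
  have "a \<in> P b" using P_backward[OF implD(1)[OF ab(1)] ab(1) P_refl] a by simp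
  then show False using assms(2)[of b a] implD(1)[OF ab(1)] ab a by auto
qed

lemma compl_P_closed: "x < n \<Longrightarrow> {0..<n} - P x \<in> CL"
  by (rule closed_I) (use P_trans in auto)

lemma N_less: "x \<in> N \<Longrightarrow> x < n"
  by (simp add: redundant_def)

text \<open>The witness is the largest element of the strongly connected component of
  \<open>v\<close>; a larger \<open>j\<close> making it redundant would belong to the same
  component.\<close>

lemma representative:
  assumes "v < n"
  obtains r where "r < n" "r \<notin> N" "r \<in> P v" "v \<in> P r"
proof -
  define S where "S = {y. y < n \<and> y \<in> P v \<and> v \<in> P y}"
  have S: "finite S" "v \<in> S" using assms P_refl by (auto simp: S_def)
  define r where "r = Max S"
  have r: "r \<in> S" unfolding r_def by (rule Max_in) (use S in auto)
  have "r \<notin> N"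
  proof
    assume "r \<in> N"
    then obtain j where j: "r < j" "j < n" "r \<in> P j" "j \<in> P r" by (auto simp: redundant_def)
    have rv: "r \<in> P v" "v \<in> P r" using r by (auto simp: S_def)
    have "j \<in> S" unfolding S_def
      using j(2) P_trans[OF assms rv(1) j(4)] P_trans[OF j(2,3) rv(2)] by simp
    then have "j \<le> r" unfolding r_def by (rule Max_ge[OF S(1)])
    then show False using j(1) by simp
  qed
  then show ?thesis using r that by (auto simp: S_def)
qed

text \<open>A closed set contains a component entirely or not at all, so it is determined by its
  elements outside \<open>N\<close>, where each component keeps a representative.\<close>

lemma closed_embedding:
  assumes "C \<in> CL" "D \<in> CL" "C \<union> N \<subseteq> D \<union> N"
  shows "C \<subseteq> D"
proof
  fix v assume v: "v \<in> C"
  then obtain r where r: "r \<notin> N" "r \<in> P v" "v \<in> P r"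
    using representative closed_sets_D[OF assms(1)] by metis
  have "r \<in> C" by (rule closed_up[OF assms(1) v r(3)])
  then have "r \<in> D" using assms(3) r(1) by auto
  then show "v \<in> D" by (rule closed_up[OF assms(2) _ r(2)])
qed

lemma set_arcs:
  "set (arcs n \<Sigma>) = {({}, i) |i. i \<in> N} \<union>
     {({i}, j) |i j. i < n \<and> j < n \<and> i \<notin> N \<and> i \<in> P j \<and> j \<notin> P i}"
  using N_less by (auto simp: arcs_def split: if_splits)

lemma is_closed_arcs:
  "is_closed (arcs n \<Sigma>) T \<longleftrightarrow> N \<subseteq> T \<and>
     (\<forall>i j. i < n \<longrightarrow> j < n \<longrightarrow> i \<notin> N \<longrightarrow> i \<in> P j \<longrightarrow> j \<notin> P i \<longrightarrow> i \<in> T \<longrightarrow> j \<in> T)"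
  unfolding is_closed_def set_arcs by blast

lemma closed_arcs_iff:
  assumes "T \<subseteq> {0..<n}"
  shows "is_closed (arcs n \<Sigma>) T \<longleftrightarrow> (\<exists>C\<in>CL. T = C \<union> N)"
proof
  assume cl: "is_closed (arcs n \<Sigma>) T"
  \<comment> \<open>\<open>C\<close> is the up-set generated by the part of \<open>T\<close> outside
    \<open>N\<close>.\<close>
  define C where "C = {v. v < n \<and> (\<exists>x \<in> T - N. x \<in> P v)}"
  have "C \<in> CL"
  proof (rule closed_I)
    fix x y assume "x < n" "y \<in> C" "y \<in> P x"
    then show "x \<in> C" using P_trans[of x y] unfolding C_def by blast
  qed (auto simp: C_def)
  moreover have "T \<subseteq> C \<union> N" using assms P_refl by (auto simp: C_def)
  moreover have "v \<in> T" if v: "v \<in> C" for v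
  proof (rule ccontr)
    assume nv: "v \<notin> T"
    obtain x where x: "x \<in> T" "x \<notin> N" "x \<in> P v" "v < n" using v by (auto simp: C_def)
    have nN: "v \<notin> N" using cl nv by (auto simp: is_closed_arcs)
    \<comment> \<open>If \<open>v\<close> did not reach \<open>x\<close>, the arc from
      \<open>x\<close> to \<open>v\<close> would put \<open>v\<close> into \<open>T\<close>. So both
      lie in one component, and the smaller of the two would be redundant, while neither is in
      \<open>N\<close>.\<close>
    have "v \<in> P x" using cl x assms nv by (fastforce simp: is_closed_arcs)
    moreover have "x \<noteq> v" "x < n" using x nv assms by auto
    ultimately show False using x nN by (cases "x < v") (auto simp: redundant_def)
  qed
  ultimately show "\<exists>C\<in>CL. T = C \<union> N" using cl by (auto simp: is_closed_arcs)
next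
  assume "\<exists>C\<in>CL. T = C \<union> N"
  then show "is_closed (arcs n \<Sigma>) T" unfolding is_closed_arcs using closed_up by blast
qed

text \<open>A set containing \<open>n\<close> satisfies all the implications with conclusion
  \<open>n\<close>, so every old closed set survives with \<open>n\<close>. Without \<open>n\<close>
  it survives only if it is above no \<open>B\<close> in \<open>Bm\<close>.\<close>

lemma closed_red_base:
  assumes "set Bm \<subseteq> CL"
  shows "T \<in> closed_sets (Suc n) (red_base n \<Sigma> Bm) \<longleftrightarrow>
    (\<exists>C\<in>CL. T = insert n (C \<union> N) \<or> T = C \<union> N \<and> (\<forall>B\<in>set Bm. \<not> B \<subseteq> C))"
proof -
  have arcs_n: "is_closed (arcs n \<Sigma>) T \<longleftrightarrow> is_closed (arcs n \<Sigma>) (T - {n})"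
    using N_less by (force simp: is_closed_arcs)
  \<comment> \<open>Adding \<open>N\<close> creates no new inclusions, because \<open>B\<close> is
    itself closed and the embedding reflects the order.\<close>
  have sub: "B \<subseteq> C \<union> N \<longleftrightarrow> B \<subseteq> C" if "B \<in> set Bm" "C \<in> CL" for B C
    using closed_embedding[of B C] that assms by auto
  have n: "n \<notin> C \<union> N" if "C \<in> CL" for C
    using closed_sets_D[OF that] N_less by auto
  have Bn: "is_closed (map (\<lambda>B. (B, n)) Bm) T \<longleftrightarrow> n \<in> T \<or> (\<forall>B\<in>set Bm. \<not> B \<subseteq> T)"
    by (auto simp: is_closed_def)
  have "T \<in> closed_sets (Suc n) (red_base n \<Sigma> Bm) \<longleftrightarrow> T - {n} \<subseteq> {0..<n} \<and>
      is_closed (arcs n \<Sigma>) (T - {n}) \<and> (n \<in> T \<or> (\<forall>B\<in>set Bm. \<not> B \<subseteq> T))"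
  proof -
    have "T \<subseteq> {0..<Suc n} \<longleftrightarrow> T - {n} \<subseteq> {0..<n}" by (auto simp: subset_iff less_Suc_eq)
    then show ?thesis unfolding closed_sets_def red_base_def is_closed_append mem_Collect_eq
      using arcs_n Bn by blast
  qed
  also have "\<dots> \<longleftrightarrow> (\<exists>C\<in>CL. T - {n} = C \<union> N) \<and> (n \<in> T \<or> (\<forall>B\<in>set Bm. \<not> B \<subseteq> T))"
  proof -
    have "C \<union> N \<subseteq> {0..<n}" if "C \<in> CL" for C
      using closed_sets_D[OF that] N_less by auto
    then show ?thesis using closed_arcs_iff[of "T - {n}"] by metis
  qed
  also have "\<dots> \<longleftrightarrow> (\<exists>C\<in>CL. T = insert n (C \<union> N) \<or> T = C \<union> N \<and> (\<forall>B\<in>set Bm. \<not> B \<subseteq> C))"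
  proof (cases "n \<in> T")
    case True
    then have "T - {n} = S \<longleftrightarrow> T = insert n S" if "n \<notin> S" for S using that by auto
    then show ?thesis using n True by (metis UnI1 insertI1)
  next
    case False
    then have "T - {n} = T" by simp
    then show ?thesis using n False sub by (metis insertI1)
  qed
  finally show ?thesis .
qed

section \<open>Meet-irreducibles of the extended base and equivalence of the answers\<close>

definition maxima :: "nat set set \<Rightarrow> nat set set" where
  "maxima \<B> = {C \<in> CL - up_set n \<Sigma> \<B>. \<forall>D \<in> CL - up_set n \<Sigma> \<B>. C \<subseteq> D \<longrightarrow> D = C}"

lemma not_up: "C \<in> CL \<Longrightarrow> C \<notin> up_set n \<Sigma> \<B> \<longleftrightarrow> (\<forall>B\<in>\<B>. \<not> B \<subseteq> C)"
  by (auto simp: up_set_def)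

lemma N_fresh: "C \<in> CL \<Longrightarrow> n \<notin> C \<union> N"
  using closed_sets_D N_less by blast

lemma meet_irreducibles_red_base:
  assumes Bm: "set Bm \<subseteq> CL"
  shows "meet_irreducibles (Suc n) (red_base n \<Sigma> Bm) =
    (\<lambda>i. insert n (N \<union> ({0..<n} - P i))) ` {0..<n} \<union> (\<lambda>C. C \<union> N) ` maxima (set Bm)"
    (is "?MI = ?A \<union> ?B")
proof
  note closed_iff = closed_red_base[OF Bm]
  show "?A \<union> ?B \<subseteq> ?MI"
  proof
    fix M assume "M \<in> ?A \<union> ?B"
    then show "M \<in> ?MI"
    proof
      assume "M \<in> ?A"
      then obtain i where i: "i < n" and M: "M = insert n (({0..<n} - P i) \<union> N)"
        by (auto simp: Un_commute)
      \<comment> \<open>The element common to all proper closed supersets of \<open>M\<close> must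
        be a representative, since \<open>i\<close> itself may belong to \<open>N\<close> and hence
        to \<open>M\<close>.\<close>
      obtain r where r: "r < n" "r \<notin> N" "r \<in> P i" "i \<in> P r" using representative[OF i] .
      have rM: "r \<notin> M" using r by (simp add: M)
      have above: "r \<in> C" if C: "C \<in> closed_sets (Suc n) (red_base n \<Sigma> Bm)" "M \<subseteq> C" "C \<noteq> M" for C
      proof -
        have "n \<in> C" using C(2) M by auto
        then obtain D where D: "D \<in> CL" "C = insert n (D \<union> N)"
          using C(1) N_fresh unfolding closed_iff by metis
        have "({0..<n} - P i) \<union> N \<subseteq> D \<union> N"
          using C(2) N_fresh[OF compl_P_closed[OF i]] unfolding M D(2) by blast
        then have sub: "{0..<n} - P i \<subseteq> D"
          by (rule closed_embedding[OF compl_P_closed[OF i] D(1)])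
        \<comment> \<open>A closed set strictly above the complement of \<open>P i\<close> contains
          some element that reaches \<open>i\<close>, and therefore \<open>i\<close> and
          \<open>r\<close>.\<close>
        have "\<exists>y\<in>D. y \<in> P i"
        proof (rule ccontr)
          assume "\<not> (\<exists>y\<in>D. y \<in> P i)"
          then have "D = {0..<n} - P i" using sub closed_sets_D[OF D(1)] by auto
          then show False using C(3) by (simp add: M D(2))
        qed
        then have "i \<in> D" using closed_up[OF D(1)] by blast
        then have "r \<in> D" using closed_up[OF D(1) _ r(4)] by blast
        then show ?thesis by (simp add: D(2))
      qed
      show "M \<in> ?MI"
        unfolding meet_irreducibles_def
      proof (intro CollectI conjI ballI impI)
        show "M \<in> closed_sets (Suc n) (red_base n \<Sigma> Bm)"
          unfolding closed_iff using compl_P_closed[OF i] M by blast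
        show "M \<noteq> {0..<Suc n}" using rM r(1) by auto
        fix C1 C2
        assume C: "C1 \<in> closed_sets (Suc n) (red_base n \<Sigma> Bm)" "C2 \<in> closed_sets (Suc n) (red_base n \<Sigma> Bm)"
          and eq: "M = C1 \<inter> C2"
        show "C1 = M \<or> C2 = M"
        proof (rule ccontr)
          assume "\<not> (C1 = M \<or> C2 = M)"
          then have "r \<in> C1 \<inter> C2" using above C eq by auto
          then show False using rM eq by simp
        qed
      qed
    next
      assume "M \<in> ?B"
      then obtain C where C: "C \<in> maxima (set Bm)" and M: "M = C \<union> N" by auto
      have CL: "C \<in> CL" "C \<notin> up_set n \<Sigma> (set Bm)" using C by (auto simp: maxima_def)
      have nM: "n \<notin> M" using N_fresh[OF CL(1)] by (simp add: M)
      \<comment> \<open>By maximality of \<open>C\<close>, every proper closed superset of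
        \<open>M\<close> contains \<open>n\<close>. If \<open>M\<close> is an intersection of two
        closed sets, one of them lacks \<open>n\<close> and so equals \<open>M\<close>.\<close>
      have above: "D = M" if D: "D \<in> closed_sets (Suc n) (red_base n \<Sigma> Bm)" "M \<subseteq> D" "n \<notin> D" for D
      proof -
        obtain E where E: "E \<in> CL" "D = E \<union> N" "\<forall>B\<in>set Bm. \<not> B \<subseteq> E"
          using D(1,3) unfolding closed_iff by blast
        have "C \<subseteq> E" using closed_embedding[OF CL(1) E(1)] D(2) by (simp add: M E(2))
        then have "E = C" using C E not_up[OF E(1)] by (auto simp: maxima_def)
        then show ?thesis by (simp add: M E(2))
      qed
      show "M \<in> ?MI"
        unfolding meet_irreducibles_def
      proof (intro CollectI conjI ballI impI)
        show "M \<in> closed_sets (Suc n) (red_base n \<Sigma> Bm)"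
          unfolding closed_iff using CL not_up[OF CL(1)] M by blast
        show "M \<noteq> {0..<Suc n}" using nM by auto
        fix C1 C2
        assume "C1 \<in> closed_sets (Suc n) (red_base n \<Sigma> Bm)" "C2 \<in> closed_sets (Suc n) (red_base n \<Sigma> Bm)"
          "M = C1 \<inter> C2"
        then show "C1 = M \<or> C2 = M" using above nM by (metis Int_iff inf_le1 inf_le2)
      qed
    qed
  qed
  show "?MI \<subseteq> ?A \<union> ?B"
  proof
    fix M assume MI: "M \<in> ?MI"
    then have "M \<in> closed_sets (Suc n) (red_base n \<Sigma> Bm)" and full: "M \<noteq> {0..<Suc n}"
      by (auto simp: meet_irreducibles_def)
    then obtain C where C: "C \<in> CL"
      and cases: "M = insert n (C \<union> N) \<or> M = C \<union> N \<and> (\<forall>B\<in>set Bm. \<not> B \<subseteq> C)"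
      unfolding closed_iff by blast
    from cases show "M \<in> ?A \<union> ?B"
    proof
      assume M: "M = insert n (C \<union> N)"
      \<comment> \<open>An up-set \<open>C\<close> is the intersection of the complements of
        \<open>P i\<close> over all \<open>i\<close> outside it. There is such an \<open>i\<close>
        because \<open>M\<close> is not the full ground set.\<close>
      define F where "F = (\<lambda>i. insert n (N \<union> ({0..<n} - P i))) ` ({0..<n} - C)"
      have "{0..<n} - C \<noteq> {}"
      proof
        assume "{0..<n} - C = {}"
        then have "M = {0..<Suc n}" using closed_sets_D[OF C] N_less unfolding M
          by (auto simp: less_Suc_eq)
        with full show False by simp
      qed
      then have F: "finite F" "F \<noteq> {}" by (auto simp: F_def)
      have "F \<subseteq> closed_sets (Suc n) (red_base n \<Sigma> Bm)"
      proof
        fix T assume "T \<in> F"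
        then obtain i where "i < n" "T = insert n (({0..<n} - P i) \<union> N)"
          by (auto simp: F_def Un_commute)
        then show "T \<in> closed_sets (Suc n) (red_base n \<Sigma> Bm)"
          unfolding closed_iff using compl_P_closed by blast
      qed
      moreover have "\<Inter>F = M"
      proof
        show "\<Inter>F \<subseteq> M"
        proof
          fix y assume y: "y \<in> \<Inter>F"
          obtain i where "i \<in> {0..<n} - C" using \<open>{0..<n} - C \<noteq> {}\<close> by blast
          then have "y \<in> insert n (N \<union> ({0..<n} - P i))" using y unfolding F_def by blast
          then have "y = n \<or> y \<in> N \<or> y < n" by auto
          moreover have "y \<in> C \<union> N" if "y < n"
          proof (rule ccontr)
            assume "y \<notin> C \<union> N"
            then have "y \<in> {0..<n} - C" using that by simp
            then have "y \<in> insert n (N \<union> ({0..<n} - P y))" using y unfolding F_def by blast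
            then show False using P_refl \<open>y \<notin> C \<union> N\<close> that by auto
          qed
          ultimately show "y \<in> M" using N_less by (auto simp: M)
        qed
        show "M \<subseteq> \<Inter>F"
          using closed_up[OF C] closed_sets_D[OF C] by (auto simp: F_def M)
      qed
      ultimately have "M \<in> F" using meet_irreducible_Inter[OF F _ _ MI] by simp
      then show ?thesis by (auto simp: F_def)
    next
      assume M: "M = C \<union> N \<and> (\<forall>B\<in>set Bm. \<not> B \<subseteq> C)"
      have "C \<in> maxima (set Bm)"
        unfolding maxima_def
      proof (intro CollectI conjI ballI impI)
        show "C \<in> CL - up_set n \<Sigma> (set Bm)" using C M not_up[OF C] by simp
        fix D assume D: "D \<in> CL - up_set n \<Sigma> (set Bm)" "C \<subseteq> D"
        have DC: "D \<in> CL" "\<forall>B\<in>set Bm. \<not> B \<subseteq> D"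
          using D(1) not_up[of D "set Bm"] by auto
        have cl: "insert n (C \<union> N) \<in> closed_sets (Suc n) (red_base n \<Sigma> Bm)"
          "D \<union> N \<in> closed_sets (Suc n) (red_base n \<Sigma> Bm)"
          unfolding closed_iff by (rule bexI[OF _ C], simp) (rule bexI[OF _ DC(1)], use DC(2) in simp)
        \<comment> \<open>As \<open>n\<close> is not in \<open>M\<close>, the first factor differs
          from \<open>M\<close>; irreducibility then makes the second one equal to \<open>M\<close>,
          so no \<open>D\<close> is properly larger than \<open>C\<close>.\<close>
        have "M = insert n (C \<union> N) \<inter> (D \<union> N)"
          using M D(2) N_fresh[OF DC(1)] by auto
        then have "insert n (C \<union> N) = M \<or> D \<union> N = M"
          by (rule meet_irreducible_D[OF MI cl])
        then have "D \<union> N = C \<union> N" using M N_fresh[OF C] by auto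
        then show "D = C" using closed_embedding[OF DC(1) C] D(2) by auto
      qed
      then show ?thesis using M by auto
    qed
  qed
qed

text \<open>Duality means that the down-set of \<open>Bp\<close> is the complement of the up-set of
  \<open>Bm\<close>. An antichain consists of the maximal elements of its down-set, and by
  finiteness every element of the complement lies below a maximal one.\<close>

lemma dual_answer_iff_maxima:
  assumes "is_antichain_of n \<Sigma> Bp"
  shows "dual_answer n \<Sigma> Bp Bm \<longleftrightarrow> set Bp = maxima (set Bm)"
proof
  let ?up = "up_set n \<Sigma> (set Bm)" and ?down = "down_set n \<Sigma> (set Bp)"
  have Bp: "set Bp \<subseteq> CL" and anti: "\<And>B1 B2. B1 \<in> set Bp \<Longrightarrow> B2 \<in> set Bp \<Longrightarrow> B1 \<subseteq> B2 \<Longrightarrow> B1 = B2"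
    using assms by (auto simp: is_antichain_of_def)
  {
    assume "dual_answer n \<Sigma> Bp Bm"
    then have disj: "?down \<inter> ?up = {}" and un: "?down \<union> ?up = CL" by (auto simp: dual_answer_def)
    have low: "B \<in> CL - ?up" if "B \<in> set Bp" for B
      using that Bp disj by (auto simp: down_set_def)
    have below: "\<exists>B\<in>set Bp. C \<subseteq> B" if "C \<in> CL - ?up" for C
      using that un by (auto simp: down_set_def)
    show "set Bp = maxima (set Bm)"
    proof
      show "set Bp \<subseteq> maxima (set Bm)"
      proof
        fix C assume C: "C \<in> set Bp"
        have "D = C" if D: "D \<in> CL - ?up" "C \<subseteq> D" for D
        proof -
          obtain B where B: "B \<in> set Bp" "D \<subseteq> B" using below[OF D(1)] by blast
          then have "C = B" using anti[OF C B(1)] D(2) by simp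
          then show ?thesis using B(2) D(2) by simp
        qed
        then show "C \<in> maxima (set Bm)" unfolding maxima_def using low[OF C] by simp
      qed
      show "maxima (set Bm) \<subseteq> set Bp"
      proof
        fix C assume C: "C \<in> maxima (set Bm)"
        then obtain B where B: "B \<in> set Bp" "C \<subseteq> B" using below[of C] by (auto simp: maxima_def)
        then have "B = C" using C low[OF B(1)] by (simp add: maxima_def)
        then show "C \<in> set Bp" using B(1) by simp
      qed
    qed
  }
  assume eq: "set Bp = maxima (set Bm)"
  have "C \<in> ?down" if C: "C \<in> CL" "C \<notin> ?up" for C
  proof -
    have "finite (CL - ?up)" using finite_closed_sets by simp
    then obtain D where "D \<in> CL - ?up" "C \<subseteq> D" "\<forall>E \<in> CL - ?up. D \<subseteq> E \<longrightarrow> D = E"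
      using finite_has_maximal2[of "CL - ?up" C] C by auto
    then have "D \<in> set Bp" unfolding eq maxima_def by blast
    then show ?thesis using C \<open>C \<subseteq> D\<close> by (auto simp: down_set_def)
  qed
  moreover have "?down \<inter> ?up = {}"
  proof (rule equals0I)
    fix C assume "C \<in> ?down \<inter> ?up"
    then obtain B B' where B: "B \<in> set Bp" "C \<subseteq> B" "B' \<in> set Bm" "B' \<subseteq> C"
      by (auto simp: down_set_def up_set_def)
    then have "B \<in> CL" "B \<notin> ?up" by (auto simp: eq maxima_def)
    then show False using not_up[of B "set Bm"] B by auto
  qed
  moreover have "?down \<subseteq> CL" "?up \<subseteq> CL" by (auto simp: down_set_def up_set_def)
  ultimately show "dual_answer n \<Sigma> Bp Bm" unfolding dual_answer_def by blast
qed

text \<open>The listed sets with \<open>n\<close> occur on both sides and are disjoint from those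
  without \<open>n\<close>, so they cancel; injectivity of adding \<open>N\<close> does the
  rest.\<close>

lemma red_answer:
  assumes Bp: "is_antichain_of n \<Sigma> Bp" and Bm: "is_antichain_of n \<Sigma> Bm"
  shows "cmi_answer (Suc n) (red_base n \<Sigma> Bm) (red_sets n \<Sigma> Bp) \<longleftrightarrow> dual_answer n \<Sigma> Bp Bm"
proof -
  let ?A = "(\<lambda>i. insert n (N \<union> ({0..<n} - P i))) ` {0..<n}" and ?f = "\<lambda>C. C \<union> N"
  have sub: "set Bp \<subseteq> CL" "set Bm \<subseteq> CL" "maxima (set Bm) \<subseteq> CL"
    using assms by (auto simp: is_antichain_of_def maxima_def)
  have fresh: "?A \<inter> ?f ` S = {}" if "S \<subseteq> CL" for S using N_fresh that by fastforce
  have inj: "inj_on ?f CL"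
    using closed_embedding by (intro inj_onI) (metis subset_antisym order_refl)
  have "set (red_sets n \<Sigma> Bp) = ?A \<union> ?f ` set Bp" by (simp add: red_sets_def)
  then have "cmi_answer (Suc n) (red_base n \<Sigma> Bm) (red_sets n \<Sigma> Bp)
      \<longleftrightarrow> ?A \<union> ?f ` set Bp = ?A \<union> ?f ` maxima (set Bm)"
    by (simp add: cmi_answer_def meet_irreducibles_red_base[OF sub(2)])
  also have "\<dots> \<longleftrightarrow> ?f ` set Bp = ?f ` maxima (set Bm)"
  proof -
    have "A \<union> S = A \<union> T \<longleftrightarrow> S = T" if "A \<inter> S = {}" "A \<inter> T = {}" for A S T :: "nat set set"
      using that by blast
    then show ?thesis using fresh[OF sub(1)] fresh[OF sub(3)] .
  qed
  also have "\<dots> \<longleftrightarrow> set Bp = maxima (set Bm)"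
    by (rule inj_on_image_eq_iff[OF inj sub(1,3)])
  also have "\<dots> \<longleftrightarrow> dual_answer n \<Sigma> Bp Bm" by (rule dual_answer_iff_maxima[OF Bp, symmetric])
  finally show ?thesis .
qed

lemma red_instance:
  assumes Bp: "is_antichain_of n \<Sigma> Bp" and Bm: "is_antichain_of n \<Sigma> Bm"
  shows "cmi_instance (Suc n) (red_base n \<Sigma> Bm) (red_sets n \<Sigma> Bp)"
proof -
  have B: "B \<subseteq> {0..<Suc n}" if "B \<in> set Bp \<or> B \<in> set Bm" for B
    using that assms by (fastforce simp: is_antichain_of_def closed_sets_def)
  have "wf_base (Suc n) (red_base n \<Sigma> Bm)"
    using B N_less by (force simp: wf_base_def red_base_def set_arcs)
  moreover have "M \<subseteq> {0..<Suc n}" if M: "M \<in> set (red_sets n \<Sigma> Bp)" for M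
  proof -
    have N: "N \<subseteq> {0..<Suc n}" using less_SucI[OF N_less] by auto
    consider i where "M = insert n (N \<union> ({0..<n} - P i))" | C where "C \<in> set Bp" "M = C \<union> N"
      using M unfolding red_sets_def set_append set_map by blast
    then show ?thesis
    proof cases
      case 1
      then show ?thesis using N by auto
    next
      case 2
      then show ?thesis using N B[of C] by simp
    qed
  qed
  ultimately show ?thesis by (simp add: cmi_instance_def)
qed

text \<open>The number of predecessors strictly increases along strict reachability, and the new
  element gets rank \<open>Suc n\<close>, beyond every possible number of predecessors.\<close>

lemma red_acyclic:
  assumes Bm: "is_antichain_of n \<Sigma> Bm"
  shows "acyclic_base (red_base n \<Sigma> Bm)"
proof -
  define rank where "rank v = (if v < n then card (P v) else Suc n)" for v
  have P_sub: "P v \<subseteq> {0..<n}" if "v < n" for v using P_less[OF that] by auto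
  have "(x, y) \<in> measure rank" if xy: "(x, y) \<in> impl_graph (red_base n \<Sigma> Bm)" for x y
  proof -
    consider "x < n" "y < n" "x \<in> P y" "y \<notin> P x" | B where "B \<in> set Bm" "x \<in> B" "y = n"
    proof -
      obtain A where A: "(A, y) \<in> set (red_base n \<Sigma> Bm)" "x \<in> A"
        using xy by (auto simp: impl_graph_def)
      then have "(A, y) \<in> set (arcs n \<Sigma>) \<or> A \<in> set Bm \<and> y = n" by (auto simp: red_base_def)
      then show ?thesis using A(2) that by (auto simp: set_arcs)
    qed
    then show ?thesis
    proof cases
      case 1
      have "P x \<subseteq> P y" using P_trans[OF 1(2,3)] by blast
      moreover have "P x \<noteq> P y" using P_refl[of y] 1(4) by blast
      ultimately have "card (P x) < card (P y)"
        using finite_subset[OF P_sub[OF 1(2)]] by (intro psubset_card_mono) auto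
      then show ?thesis using 1 by (simp add: rank_def)
    next
      case 2
      then have x: "x < n" using Bm closed_sets_D by (fastforce simp: is_antichain_of_def)
      have "card (P x) \<le> n" using card_mono[OF _ P_sub[OF x]] by simp
      then show ?thesis using 2 x by (simp add: rank_def)
    qed
  qed
  then have "impl_graph (red_base n \<Sigma> Bm) \<subseteq> measure rank" by auto
  then show ?thesis unfolding acyclic_base_def
    by (rule acyclic_subset[OF wf_acyclic[OF wf_measure]])
qed

end

section \<open>Composition\<close>

lemma decides_within_mono:
  assumes "decides_within M w ans t" "t \<le> t'"
  shows "decides_within M w ans t'"
proof -
  obtain Q S d where M: "M = (Q, S, d)" by (cases M)
  obtain q x where q: "(astep d ^^ t) (0, 0, input_tape w) = (q, x)"
    by (cases "(astep d ^^ t) (0, 0, input_tape w)")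
  have h: "q \<in> {1, 2}" "q = 1 \<longleftrightarrow> ans"
    using assms(1) unfolding decides_within_def M tm_state_run q by auto
  have "reaches (astep d) (0, 0, input_tape w) t' (q, x)"
    using q assms(2) by (auto simp: reaches_def)
  from reaches_halted[OF this] h have "(astep d ^^ t') (0, 0, input_tape w) = (q, x)" by auto
  then show ?thesis unfolding decides_within_def M tm_state_run using h by auto
qed

text \<open>Adapts to the tape orientation: the input sits reversed in register 0, is turned into
  register 1 for the single view, and the result is turned back from register 2 once register 1 has
  been cleared.\<close>

lemma PT_program:
  assumes "PT {\<lambda>w. w} f"
  obtains c C e where "wf_com c"
    "\<And>w. valid w \<Longrightarrow> exec c (input_regs (rev w)) (C * (1 + length w) ^ e) (input_regs (rev (f w)))"
proof -
  let ?V = "{\<lambda>w :: nat list. w}"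
  obtain c T where c: "wf_com c" and T: "poly_bounded ?V T"
    and ex: "\<And>w s. vok ?V w \<Longrightarrow> (\<And>v. v \<in> ?V \<Longrightarrow> s 1 = v w) \<Longrightarrow> (\<And>i. 2 \<le> i \<Longrightarrow> s i = [])
       \<Longrightarrow> exec c s (T w) (s(2 := f w))"
    using PT_E[where \<rho> = "\<lambda>_. 1" and m = 2, OF assms] by auto
  define c' where "c' = move_rev 0 1 ;; c ;; clear 1 ;; move_rev 2 0"
  define T' where "T' w = 10 * length w + 2 + (T w + (3 * length w + 2 + (10 * length (f w) + 2)))" for w
  have len: "poly_bounded ?V (\<lambda>w. length w)"     by (rule poly_bounded_mono[OF poly_bounded_vsize]) (simp add: vsize_def)
  have "poly_bounded ?V T'"
    unfolding T'_def by (intro poly_bounded_intros len T PT_length assms)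
  then obtain C e where Ce: "\<And>w. valid w \<Longrightarrow> T' w \<le> C * (1 + length w) ^ e"
    unfolding poly_bounded_def by (auto simp: vok_def vsize_def)
  have "exec c' (input_regs (rev w)) (T' w) (input_regs (rev (f w)))" if w: "valid w" for w
  proof -
    define s1 :: regs where "s1 = (\<lambda>_. [])(1 := w)"
    define s2 where "s2 = s1(2 := f w)"
    have vw: "vok ?V w" using w by (simp add: vok_def)
    have vf: "valid (f w)" by (rule PT_valid[OF assms vw])
    have "exec (move_rev 0 1) (input_regs (rev w)) (10 * length w + 2)
        ((input_regs (rev w))(0 := [], 1 := w))"
      using exec_move_rev[of "input_regs (rev w)" 0 1] w by (simp add: input_regs_def)
    moreover have "(input_regs (rev w))(0 := [], 1 := w) = s1"
      by (auto simp: input_regs_def s1_def fun_eq_iff)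
    ultimately have e1: "exec (move_rev 0 1) (input_regs (rev w)) (10 * length w + 2) s1" by simp
    have e2: "exec c s1 (T w) s2"
      unfolding s2_def by (rule ex[OF vw]) (auto simp: s1_def)
    have e3: "exec (clear 1) s2 (3 * length w + 2) (s2(1 := []))"
      using exec_clear[of s2 1] w by (simp add: s2_def s1_def)
    have "exec (move_rev 2 0) (s2(1 := [])) (10 * length (f w) + 2)
        (s2(1 := [], 2 := [], 0 := rev (f w)))"
      using exec_move_rev[of "s2(1 := [])" 2 0] vf by (simp add: s2_def s1_def)
    moreover have "s2(1 := [], 2 := [], 0 := rev (f w)) = input_regs (rev (f w))"
      by (auto simp: s2_def s1_def input_regs_def fun_eq_iff)
    ultimately have e4: "exec (move_rev 2 0) (s2(1 := [])) (10 * length (f w) + 2) (input_regs (rev (f w)))"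
      by simp
    show ?thesis unfolding c'_def T'_def
      by (rule exec.Seq[OF e1 exec.Seq[OF e2 exec.Seq[OF e3 e4]]])
  qed
  then have "exec c' (input_regs (rev w)) (C * (1 + length w) ^ e) (input_regs (rev (f w)))"
    if "valid w" for w using Ce that exec.Slack by blast
  moreover have "wf_com c'" using c by (simp add: c'_def)
  ultimately show ?thesis using that by blast
qed

theorem theorem1:
  assumes "poly_time_CMI_acyclic"
  shows "poly_time_DUAL_unit"
proof -
  obtain M c k where M: "wf_tm M" and dec: "\<And>n \<Sigma> Ms. cmi_instance n \<Sigma> Ms \<Longrightarrow> acyclic_base \<Sigma> \<Longrightarrow>
      decides_within M (enc_cmi n \<Sigma> Ms) (cmi_answer n \<Sigma> Ms) (c * (length (enc_cmi n \<Sigma> Ms) + 1) ^ k)"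
    using assms unfolding poly_time_CMI_acyclic_def by blast
  obtain p C e where p: "wf_com p" and ex: "\<And>w. valid w \<Longrightarrow>
      exec p (input_regs (rev w)) (C * (1 + length w) ^ e) (input_regs (rev (reduce w)))"
    using PT_program[OF PT_reduce] by blast
  obtain M' where M': "wf_tm M'" and sim: "\<And>w w' t T ans. valid w \<Longrightarrow>
      exec p (input_regs (rev w)) t (input_regs (rev w')) \<Longrightarrow> decides_within M w' ans T \<Longrightarrow>
      decides_within M' w ans (3 + t * (2 * (length w + t) + 4) + T)"
    using compose_machine[OF p M] by blast
  let ?V = "{\<lambda>w :: nat list. w}"
  define t where "t w = C * (1 + length w) ^ e" for w :: "nat list"
  \<comment> \<open>The total time of the composed machine, with the length of the intermediate word
    \<open>w'\<close> estimated by \<open>length w + t w\<close>.\<close>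
  define B where "B w = 3 + t w * (2 * (length w + t w) + 4) + c * (length w + t w + 1) ^ k" for w
  have len: "poly_bounded ?V (\<lambda>w. length w)"     by (rule poly_bounded_mono[OF poly_bounded_vsize]) (simp add: vsize_def)
  have "poly_bounded ?V B"
    unfolding B_def t_def by (intro poly_bounded_intros len)
  then obtain C' e' where "\<And>w. valid w \<Longrightarrow> B w \<le> C' * (1 + length w) ^ e'"
    unfolding poly_bounded_def by (auto simp: vok_def vsize_def)
  then have bound: "\<And>w. valid w \<Longrightarrow> B w \<le> C' * (length w + 1) ^ e'" by (simp add: add.commute)
  have "decides_within M' (enc_dual n \<Sigma> Bp Bm) (dual_answer n \<Sigma> Bp Bm)
      (C' * (length (enc_dual n \<Sigma> Bp Bm) + 1) ^ e')"
    if inst: "dual_instance n \<Sigma> Bp Bm" and unit: "unit_premises \<Sigma>" for n \<Sigma> Bp Bm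
  proof -
    interpret unit_base n \<Sigma>
      by unfold_locales (use inst unit in \<open>auto simp: dual_instance_def\<close>)
    have Bp: "is_antichain_of n \<Sigma> Bp" and Bm: "is_antichain_of n \<Sigma> Bm"
      using inst by (auto simp: dual_instance_def)
    define w where "w = enc_dual n \<Sigma> Bp Bm"
    define w' where "w' = enc_cmi (Suc n) (red_base n \<Sigma> Bm) (red_sets n \<Sigma> Bp)"
    have w: "valid w" unfolding w_def by (rule valid_enc_dual)
    have run: "exec p (input_regs (rev w)) (t w) (input_regs (rev w'))"
      using ex[OF w] unfolding t_def w'_def w_def reduce_enc[OF inst] .
    have "decides_within M w' (dual_answer n \<Sigma> Bp Bm) (c * (length w' + 1) ^ k)"
      using dec[OF red_instance[OF Bp Bm] red_acyclic[OF Bm]] red_answer[OF Bp Bm]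
      unfolding w'_def by simp
    from sim[OF w run this]
    have "decides_within M' w (dual_answer n \<Sigma> Bp Bm)
        (3 + t w * (2 * (length w + t w) + 4) + c * (length w' + 1) ^ k)" .
    \<comment> \<open>The running time of the program bounds its output, so the size of the CMI
      encoding never has to be computed.\<close>
    moreover have "length w' \<le> length w + t w"
      using exec_length[OF run, of 0] by (simp add: input_regs_def)
    then have "3 + t w * (2 * (length w + t w) + 4) + c * (length w' + 1) ^ k \<le> B w"
      unfolding B_def by (intro add_left_mono mult_left_mono power_mono) auto
    ultimately show ?thesis
      using decides_within_mono order_trans[OF _ bound[OF w]] unfolding w_def by blast
  qed
  then show ?thesis unfolding poly_time_DUAL_unit_def using M' by blast
qed

end
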